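(* Let $\Omega\subseteq\mathbb{R}^n$ be open and let $P$ be a partial differential operator of order $m$ with coefficients in $\mathcal{G}(\Omega)$, represented by the family $(P_\varepsilon)_\varepsilon$ with symbols $P_\varepsilon(x,\xi)$. Let $(x_0,\xi_0)\in\Omega\times(\mathbb{R}^n\setminus\{0\})$ with an open conic neighborhood $U\times\Gamma$ ($U\ni x_0$ open in $\Omega$, $\Gamma\ni\xi_0$ an open cone in $\mathbb{R}^n\setminus\{0\}$), and let $m_0\in\mathbb{R}$, $0\le\delta<\rho\le 1$ be such that the following hypotheses are satisfied for every compact subset $K\subset U$: 1. There exist $q>0$, a slow scale net $r_\varepsilon>0$ and $\varepsilon_0>0$ such that $$|P_\varepsilon(x,\xi)|\ge \varepsilon^q(1+|\xi|)^{m_0}$$ for all $(x,\xi)\in K\times\Gamma$ with $|\xi|\ge r_\varepsilon$ and all $0<\varepsilon<\varepsilon_0$. 2. For every $\alpha\in\mathbb{N}_0^n$ there exist slow scale nets $s_\varepsilon^\alpha, r_\varepsilon^\alpha>0$ and $\varepsilon_\alpha>0$ such that for all $\beta\in\mathbb{N}_0^n$ with $0\le|\beta|\le m$ $$|\partial_x^\alpha\partial_\xi^\beta P_\varepsilon(x,\xi)|\le s_\varepsilon^\alpha\,|P_\varepsilon(x,\xi)|\,(1+|\xi|)^{\delta|\alpha|-\rho|\beta|}$$ for all $(x,\xi)\in K\times\Gamma$ with $|\xi|\ge r_\varepsilon^\alpha$ and all $0<\varepsilon<\varepsilon_\alpha$. Then, with $\Lambda=U\times\Gamma$, for any $u\in\mathcal{G}(\Omega)$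 $$\Lambda\cap \mathrm{WF}_g(u)=\Lambda\cap\mathrm{WF}_g(Pu).$$
   Context: Colombeau algebra: $\mathcal{E}_M(\Omega)$ is the set of families $(u_\varepsilon)_{\varepsilon\in(0,1]}$ of functions $u_\varepsilon\in C^\infty(\Omega)$ such that for all compact $K\subset\Omega$ and all $\alpha\in\mathbb{N}_0^n$ there is $p\ge0$ with $\sup_{x\in K}|\partial^\alpha u_\varepsilon(x)|=O(\varepsilon^{-p})$ as $\varepsilon\to0$. $\mathcal{N}(\Omega)$ is the set of families such that for all compact $K\subset\Omega$, all $\alpha$ and all $q\ge0$, $\sup_{x\in K}|\partial^\alpha u_\varepsilon(x)|=O(\varepsilon^q)$. $\mathcal{G}(\Omega)=\mathcal{E}_M(\Omega)/\mathcal{N}(\Omega)$; classes are written $[(u_\varepsilon)_\varepsilon]$. Operators: with $D=(-i\partial_1,\dots,-i\partial_n)$, an operator of order $m$ with coefficients $a_\alpha=[(a_\alpha^\varepsilon)_\varepsilon]\in\mathcal{G}(\Omega)$ is $P=\sum_{|\alpha|\le m}a_\alpha D^\alpha$, represented by $P_\varepsilon(x,D)=\sum_{|\alpha|\le m}a_\alpha^\varepsilon(x)D^\alpha$ with symbol $P_\varepsilon(x,\xi)=\sum_{|\alpha|\le m}a^\varepsilon_\alpha(x)\xi^\alpha$; it acts by $Pu=[(P_\varepsilon(x,D)u_\varepsilon)_\varepsilon]$. Slow scale: a net $(r_\varepsilon)_{\varepsilon\in(0,1]}$ of complex numbers with $|r_\varepsilon|=O(\varepsilon^{-p})$ for some $p$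 is a slow scale net if for all $t\ge0$ there is $\varepsilon_t>0$ with $|r_\varepsilon|^t\le\varepsilon^{-1}$ for all $\varepsilon\in(0,\varepsilon_t)$. Generalized wave front set: $u=[(u_\varepsilon)_\varepsilon]\in\mathcal{G}(\Omega)$ is microlocally regular at $(x_0,\xi_0)\in\Omega\times(\mathbb{R}^n\setminus\{0\})$ if there are an open neighborhood $U$ of $x_0$ and a conic neighborhood $\Gamma$ of $\xi_0$ such that for all $\varphi\in\mathcal{D}(U)=C_c^\infty(U)$: there is $N\in\mathbb{R}$ such that for all $l\in\mathbb{N}_0$ there are $C>0$, $\varepsilon_0>0$ with $|\widehat{\varphi u_\varepsilon}(\xi)|\le C\varepsilon^{-N}(1+|\xi|)^{-l}$ for all $\xi\in\Gamma$, $\varepsilon\in(0,\varepsilon_0)$, where $\widehat{v}(\xi)=\int v(x)e^{-i\xi x}dx$. $\mathrm{WF}_g(u)$ is the complement in $\Omega\times(\mathbb{R}^n\setminus\{0\})$ of the set of points where $u$ is microlocally regular. *)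

theory Defs
  imports "HOL-Analysis.Analysis" "HOL-Library.Landau_Symbols"
begin

definition pderiv_at :: "'n::finite \<Rightarrow> (real ^ 'n \<Rightarrow> complex) \<Rightarrow> real ^ 'n \<Rightarrow> complex" where
  "pderiv_at i f x = vector_derivative (\<lambda>t. f (x + t *\<^sub>R axis i 1)) (at 0)"

definition partials :: "'n::finite list \<Rightarrow> (real ^ 'n \<Rightarrow> complex) \<Rightarrow> real ^ 'n \<Rightarrow> complex" where
  "partials is f = foldr pderiv_at is f"

text \<open>Functions on an open set \<open>\<Omega>\<close> are represented by total functions; their values outside
  \<open>\<Omega>\<close> are irrelevant.  \<open>C\<^sup>\<infinity>(\<Omega>)\<close>: the iterated partial derivatives of all orders exist and are
  continuous on \<open>\<Omega>\<close>.\<close>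

definition smooth_on :: "(real ^ 'n::finite) set \<Rightarrow> (real ^ 'n \<Rightarrow> complex) \<Rightarrow> bool" where
  "smooth_on \<Omega> f \<longleftrightarrow>
     (\<forall>is. continuous_on \<Omega> (partials is f) \<and>
           (\<forall>i. \<forall>x\<in>\<Omega>. (\<lambda>t. partials is f (x + t *\<^sub>R axis i 1)) differentiable (at 0)))"

type_synonym 'n multi_index = "'n \<Rightarrow> nat"

definition mi_len :: "'n::finite multi_index \<Rightarrow> nat" where
  "mi_len \<alpha> = (\<Sum>i\<in>UNIV. \<alpha> i)"

text \<open>The type of coordinates carries no order, so \<open>\<partial>\<^sup>\<alpha>\<close> uses a fixed but unspecified enumeration
  of the coordinates; for smooth functions the choice does not matter.\<close>

definition coords :: "'n::finite list" where
  "coords = (SOME is. distinct is \<and> set is = UNIV)"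

definition mderiv :: "'n::finite multi_index \<Rightarrow> (real ^ 'n \<Rightarrow> complex) \<Rightarrow> real ^ 'n \<Rightarrow> complex" where
  "mderiv \<alpha> f = partials (concat (map (\<lambda>i. replicate (\<alpha> i) i) coords)) f"

definition mpower :: "real ^ 'n::finite \<Rightarrow> 'n multi_index \<Rightarrow> real" where
  "mpower \<xi> \<alpha> = (\<Prod>i\<in>UNIV. (\<xi> $ i) ^ \<alpha> i)"

text \<open>A net \<open>(u\<^sub>\<epsilon>)\<close>, \<open>\<epsilon> \<in> (0,1]\<close>, is a function of a real argument of which only the values
  on \<open>(0,1]\<close> matter.\<close>

type_synonym 'n net = "real \<Rightarrow> real ^ 'n \<Rightarrow> complex"

text \<open>The empty compact set is excluded only because \<open>Sup {}\<close> is unspecified on the reals.\<close>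

definition moderate :: "(real ^ 'n::finite) set \<Rightarrow> 'n net set" where
  "moderate \<Omega> = {u. (\<forall>\<epsilon>\<in>{0<..1}. smooth_on \<Omega> (u \<epsilon>)) \<and>
     (\<forall>K \<alpha>. compact K \<and> K \<noteq> {} \<and> K \<subseteq> \<Omega> \<longrightarrow>
        (\<exists>p\<ge>0. (\<lambda>\<epsilon>. SUP x\<in>K. norm (mderiv \<alpha> (u \<epsilon>) x)) \<in> O[at_right 0](\<lambda>\<epsilon>. \<epsilon> powr (- p))))}"

definition negligible_nets :: "(real ^ 'n::finite) set \<Rightarrow> 'n net set" where
  "negligible_nets \<Omega> = {u. (\<forall>\<epsilon>\<in>{0<..1}. smooth_on \<Omega> (u \<epsilon>)) \<and>
     (\<forall>K \<alpha>. \<forall>q\<ge>0. compact K \<and> K \<noteq> {} \<and> K \<subseteq> \<Omega> \<longrightarrow>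
        (\<lambda>\<epsilon>. SUP x\<in>K. norm (mderiv \<alpha> (u \<epsilon>) x)) \<in> O[at_right 0](\<lambda>\<epsilon>. \<epsilon> powr q))}"

definition colombeau_rel :: "(real ^ 'n::finite) set \<Rightarrow> ('n net \<times> 'n net) set" where
  "colombeau_rel \<Omega> = {(u, v). u \<in> moderate \<Omega> \<and> v \<in> moderate \<Omega> \<and>
     (\<lambda>\<epsilon> x. u \<epsilon> x - v \<epsilon> x) \<in> negligible_nets \<Omega>}"

definition colombeau :: "(real ^ 'n::finite) set \<Rightarrow> 'n net set set" where
  "colombeau \<Omega> = moderate \<Omega> // colombeau_rel \<Omega>"

text \<open>The net \<open>\<Sum>\<^bsub>|\<alpha>| \<le> m\<^esub> a\<^sub>\<alpha>\<^sup>\<epsilon> D\<^sup>\<alpha> u\<^sub>\<epsilon>\<close> with \<open>D = -i\<partial>\<close>, so that \<open>D\<^sup>\<alpha> = (-i)\<^bsup>|\<alpha>|\<^esup> \<partial>\<^sup>\<alpha>\<close>.\<close>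

definition diff_op_net :: "nat \<Rightarrow> ('n::finite multi_index \<Rightarrow> 'n net) \<Rightarrow> 'n net \<Rightarrow> 'n net" where
  "diff_op_net m A u = (\<lambda>\<epsilon> x.
     \<Sum>\<alpha> | mi_len \<alpha> \<le> m. A \<alpha> \<epsilon> x * ((- \<i>) ^ mi_len \<alpha> * mderiv \<alpha> (u \<epsilon>) x))"

definition op_symbol ::
    "nat \<Rightarrow> ('n::finite multi_index \<Rightarrow> 'n net) \<Rightarrow> real \<Rightarrow> real ^ 'n \<Rightarrow> real ^ 'n \<Rightarrow> complex" where
  "op_symbol m A \<epsilon> x \<xi> = (\<Sum>\<alpha> | mi_len \<alpha> \<le> m. A \<alpha> \<epsilon> x * of_real (mpower \<xi> \<alpha>))"

definition op_symbol_deriv ::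
    "nat \<Rightarrow> ('n::finite multi_index \<Rightarrow> 'n net) \<Rightarrow> 'n multi_index \<Rightarrow> 'n multi_index \<Rightarrow>
     real \<Rightarrow> real ^ 'n \<Rightarrow> real ^ 'n \<Rightarrow> complex" where
  "op_symbol_deriv m A \<alpha> \<beta> \<epsilon> x \<xi> = mderiv \<alpha> (\<lambda>y. mderiv \<beta> (\<lambda>\<eta>. op_symbol m A \<epsilon> y \<eta>) \<xi>) x"

definition represents :: "nat \<Rightarrow> ('n::finite multi_index \<Rightarrow> 'n net) \<Rightarrow>
     ('n multi_index \<Rightarrow> 'n net set) \<Rightarrow> bool" where
  "represents m A a \<longleftrightarrow> (\<forall>\<alpha>. mi_len \<alpha> \<le> m \<longrightarrow> A \<alpha> \<in> a \<alpha>)"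

text \<open>The action \<open>P u = [(P\<^sub>\<epsilon>(x,D) u\<^sub>\<epsilon>)]\<close> on classes.  All classes in the union coincide, since
  the class on the right does not depend on the representatives of the coefficients and of \<open>u\<close>.\<close>

definition diff_op :: "(real ^ 'n::finite) set \<Rightarrow> nat \<Rightarrow> ('n multi_index \<Rightarrow> 'n net set) \<Rightarrow>
     'n net set \<Rightarrow> 'n net set" where
  "diff_op \<Omega> m a u =
     (\<Union>A\<in>{A. represents m A a}. \<Union>v\<in>u. colombeau_rel \<Omega> `` {diff_op_net m A v})"

definition slow_scale :: "(real \<Rightarrow> 'a::real_normed_field) \<Rightarrow> bool" where
  "slow_scale r \<longleftrightarrow>
     (\<exists>p. (\<lambda>\<epsilon>. norm (r \<epsilon>)) \<in> O[at_right 0](\<lambda>\<epsilon>. \<epsilon> powr (- p))) \<and>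
     (\<forall>t\<ge>0. \<exists>\<epsilon>\<^sub>t>0. \<forall>\<epsilon>\<in>{0<..<\<epsilon>\<^sub>t}. norm (r \<epsilon>) powr t \<le> 1 / \<epsilon>)"

definition pos_slow_scale :: "(real \<Rightarrow> real) \<Rightarrow> bool" where
  "pos_slow_scale r \<longleftrightarrow> slow_scale r \<and> (\<forall>\<epsilon>\<in>{0<..1}. r \<epsilon> > 0)"

text \<open>Cones live in \<open>\<real>\<^sup>n \<setminus> {0}\<close>; the library's \<open>conic\<close> sets contain \<open>0\<close>.\<close>

definition open_cone :: "(real ^ 'n::finite) set \<Rightarrow> bool" where
  "open_cone \<Gamma> \<longleftrightarrow> open \<Gamma> \<and> 0 \<notin> \<Gamma> \<and> (\<forall>\<xi>\<in>\<Gamma>. \<forall>t>0. t *\<^sub>R \<xi> \<in> \<Gamma>)"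

text \<open>Elements of \<open>C\<^sub>c\<^sup>\<infinity>(U)\<close> are extended by zero to the whole space.\<close>

definition test_functions :: "(real ^ 'n::finite) set \<Rightarrow> (real ^ 'n \<Rightarrow> complex) set" where
  "test_functions U = {\<phi>. smooth_on UNIV \<phi> \<and>
     compact (closure {x. \<phi> x \<noteq> 0}) \<and> closure {x. \<phi> x \<noteq> 0} \<subseteq> U}"

definition fourier :: "(real ^ 'n::finite \<Rightarrow> complex) \<Rightarrow> real ^ 'n \<Rightarrow> complex" where
  "fourier v \<xi> = (LINT x|lborel. v x * exp (- (\<i> * of_real (\<xi> \<bullet> x))))"

definition microlocally_regular_net ::
    "(real ^ 'n::finite) set \<Rightarrow> 'n net \<Rightarrow> real ^ 'n \<Rightarrow> real ^ 'n \<Rightarrow> bool" where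
  "microlocally_regular_net \<Omega> u x\<^sub>0 \<xi>\<^sub>0 \<longleftrightarrow>
     (\<exists>U \<Gamma>. open U \<and> U \<subseteq> \<Omega> \<and> x\<^sub>0 \<in> U \<and> open_cone \<Gamma> \<and> \<xi>\<^sub>0 \<in> \<Gamma> \<and>
       (\<forall>\<phi>\<in>test_functions U. \<exists>N::real. \<forall>l::nat. \<exists>C>0. \<exists>\<epsilon>\<^sub>0>0.
          \<forall>\<xi>\<in>\<Gamma>. \<forall>\<epsilon>\<in>{0<..<\<epsilon>\<^sub>0}.
            norm (fourier (\<lambda>x. \<phi> x * u \<epsilon> x) \<xi>) \<le> C * \<epsilon> powr (- N) * (1 + norm \<xi>) powr (- real l)))"

text \<open>Regularity does not depend on the representative of the class \<open>u\<close>.\<close>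

definition microlocally_regular ::
    "(real ^ 'n::finite) set \<Rightarrow> 'n net set \<Rightarrow> real ^ 'n \<Rightarrow> real ^ 'n \<Rightarrow> bool" where
  "microlocally_regular \<Omega> u x\<^sub>0 \<xi>\<^sub>0 \<longleftrightarrow> (\<exists>v\<in>u. microlocally_regular_net \<Omega> v x\<^sub>0 \<xi>\<^sub>0)"

definition WFg :: "(real ^ 'n::finite) set \<Rightarrow> 'n net set \<Rightarrow> ((real ^ 'n) \<times> (real ^ 'n)) set" where
  "WFg \<Omega> u = {(x, \<xi>). x \<in> \<Omega> \<and> \<xi> \<noteq> 0 \<and> \<not> microlocally_regular \<Omega> u x \<xi>}"

end

theory Submission
  imports Defs "HOL-Probability.Characteristic_Functions" "HOL-Probability.Sinc_Integral"
begin

text \<open>Write \<open>\<langle>\<xi>\<rangle> = 1 + |\<xi>|\<close>.  Moving the operator \<open>P\<close> from \<open>u\<close> to an amplitude \<open>w\<close> with compact support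
  gives
  \[ \<integral> (Pu)(x) w(x) e^{-ix\<xi>} dx = \<integral> u(x) (T_\<xi> w)(x) e^{-ix\<xi>} dx, \qquad
     T_\<xi> w = \<Sum>_\<gamma> (-D)^\<gamma> (\<partial>_\<xi>^\<gamma> P(x,\<xi>) w) / \<gamma>! \]
  (\<open>fourier_diff_op\<close>), and both inclusions come from inserting suitable amplitudes that
  depend on \<open>\<epsilon>\<close> and \<open>\<xi>\<close>.

  Pseudolocality: for a test function \<open>\<phi>\<close> put \<open>w = \<phi>\<close>.  By the estimates on the symbol, the
  derivatives of \<open>T_\<xi> \<phi>\<close> of order \<open>k\<close> are bounded by a slow scale multiple of
  \<open>|P(x,\<xi>)| \<langle>\<xi>\<rangle>^{\<delta> k}\<close>, and \<open>|P| \<le> \<epsilon>^{-q} \<langle>\<xi>\<rangle>^m\<close>.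

  Elliptic regularity: \<open>T_\<xi>(v/P) = v - R v\<close>, where every term of the remainder \<open>R v\<close> contains at
  least one \<open>\<xi>\<close>-derivative of \<open>P\<close>, which gains \<open>\<langle>\<xi>\<rangle>^{-\<rho>}\<close>, and as many \<open>x\<close>-derivatives, which
  cost \<open>\<langle>\<xi>\<rangle>^\<delta>\<close> each.  For \<open>w = P^{-1} \<Sum>_{j<J} R^j \<phi>\<close> the sum telescopes to
  \<open>T_\<xi> w = \<phi> - R^J \<phi>\<close>, and \<open>R^J \<phi> = O(\<langle>\<xi>\<rangle>^{-(\<rho>-\<delta>)J})\<close> decays as fast as desired when \<open>J\<close> grows.
  The derivatives of \<open>w\<close> of order \<open>k\<close> are bounded by a slow scale multiple of
  \<open>\<langle>\<xi>\<rangle>^{\<delta> k}/|P| \<le> \<epsilon>^{-q} \<langle>\<xi>\<rangle>^{\<delta> k - m_0}\<close>.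

  In both cases it remains to see that such an amplitude \<open>g\<close>, multiplied by a microlocally regular
  net \<open>h\<close> and transformed at \<open>\<xi>\<close>, decays rapidly in a smaller cone (\<open>symbol_pairing_decay\<close>).
  The transform of \<open>g h\<close> is a convolution (\<open>fourier_product\<close>): frequencies of \<open>g\<close> comparable to
  \<open>|\<xi>|\<close> contribute little, because \<open>k\<close> derivatives of \<open>g\<close> cost \<open>\<langle>\<xi>\<rangle>^{\<delta> k}\<close> but gain
  \<open>\<langle>\<xi>\<rangle>^{-k}\<close> and \<open>\<delta> < 1\<close>; for the other frequencies of \<open>g\<close> the transform of \<open>h\<close> is
  evaluated in the cone in which it decays (\<open>fourier_product_decay\<close>).

  Slow scale nets enter in two ways.  A slow scale factor of any size costs a single power
  \<open>\<epsilon>^{-1}\<close>, so the exponent of \<open>\<epsilon>\<close> in the final estimate does not depend on the order of decay.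
  And frequencies below a slow scale radius need only a moderate bound, since there any power
  of \<open>\<langle>\<xi>\<rangle>\<close> is at most \<open>\<epsilon>^{-1}\<close> (\<open>rapidly_decreasing_high_freqI\<close>); the filter
  \<open>high_freq\<close> removes them from all intermediate statements.\<close>

section \<open>Smooth functions\<close>

abbreviation has_partial ::
  "(real ^ 'n::finite \<Rightarrow> complex) \<Rightarrow> 'n \<Rightarrow> complex \<Rightarrow> real ^ 'n \<Rightarrow> bool" where
  "has_partial f i d x \<equiv> ((\<lambda>t. f (x + t *\<^sub>R axis i 1)) has_vector_derivative d) (at 0)"

lemma has_partial_imp_pderiv: "has_partial f i d x \<Longrightarrow> pderiv_at i f x = d"
  unfolding pderiv_at_def by (rule vector_derivative_at)

lemma has_partial_pderiv:
  "(\<lambda>t. f (x + t *\<^sub>R axis i 1)) differentiable (at 0) \<Longrightarrow> has_partial f i (pderiv_at i f x) x"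
  unfolding pderiv_at_def by (simp add: vector_derivative_works)

lemma eventually_line_in_open:
  fixes x :: "real^'n::finite"
  assumes "open V" "x \<in> V"
  shows "eventually (\<lambda>t. x + t *\<^sub>R axis i 1 \<in> V) (nhds 0)"
proof -
  have "((\<lambda>t::real. x + t *\<^sub>R axis i 1) \<longlongrightarrow> x + 0 *\<^sub>R axis i 1) (nhds 0)"
    by (intro tendsto_intros filterlim_ident)
  then show ?thesis using assms by (auto dest: topological_tendstoD)
qed

lemma has_partial_cong_open:
  assumes "open V" "x \<in> V" "\<And>y. y \<in> V \<Longrightarrow> f y = g y" "has_partial f i d x"
  shows "has_partial g i d x"
proof -
  have ev: "eventually (\<lambda>t. f (x + t *\<^sub>R axis i 1) = g (x + t *\<^sub>R axis i 1)) (nhds 0)"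
    using eventually_line_in_open[OF assms(1,2), of i] by eventually_elim (use assms(3) in auto)
  show ?thesis
    using has_vector_derivative_cong_ev[of UNIV "\<lambda>t. f (x + t *\<^sub>R axis i 1)" "\<lambda>t. g (x + t *\<^sub>R axis i 1)" 0 d]
      ev assms(2-4) by simp
qed

lemma pderiv_at_cong_open:
  assumes "open V" "x \<in> V" "\<And>y. y \<in> V \<Longrightarrow> f y = g y"
  shows "pderiv_at i f x = pderiv_at i g x"
  unfolding pderiv_at_def
  by (rule vector_derivative_cong_eq)
     (use eventually_line_in_open[OF assms(1,2), of i] assms(3) in \<open>auto elim: eventually_mono\<close>)

text \<open>The finite-order classes \<open>C\<^sup>k(V)\<close>: closure properties of \<open>C\<^sup>\<infinity>(V)\<close> are proved by
  induction on the order, since the derivative of a product or of a reciprocal is again built from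
  functions of the same kind.\<close>

primrec Ck :: "nat \<Rightarrow> (real ^ 'n::finite) set \<Rightarrow> (real ^ 'n \<Rightarrow> complex) \<Rightarrow> bool" where
  "Ck 0 V f \<longleftrightarrow> continuous_on V f"
| "Ck (Suc k) V f \<longleftrightarrow> continuous_on V f \<and>
     (\<forall>i. (\<forall>x\<in>V. (\<lambda>t. f (x + t *\<^sub>R axis i 1)) differentiable (at 0)) \<and> Ck k V (pderiv_at i f))"

lemma partials_Nil [simp]: "partials [] f = f"
  and partials_Cons: "partials (i # is) f = pderiv_at i (partials is f)"
  and partials_append: "partials (is @ js) f = partials is (partials js f)"
  and partials_snoc: "partials (is @ [i]) f = partials is (pderiv_at i f)"
  by (simp_all add: partials_def)

lemma smooth_on_imp_continuous: "smooth_on V f \<Longrightarrow> continuous_on V f"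
  unfolding smooth_on_def by (drule spec[of _ "[]"]) simp

lemma smooth_on_imp_differentiable:
  "smooth_on V f \<Longrightarrow> x \<in> V \<Longrightarrow> (\<lambda>t. f (x + t *\<^sub>R axis i 1)) differentiable (at 0)"
  unfolding smooth_on_def by (drule spec[of _ "[]"]) simp

lemma smooth_on_has_partial:
  "smooth_on V f \<Longrightarrow> x \<in> V \<Longrightarrow> has_partial f i (pderiv_at i f x) x"
  by (intro has_partial_pderiv smooth_on_imp_differentiable)

lemma smooth_on_partials: "smooth_on V f \<Longrightarrow> smooth_on V (partials js f)"
  unfolding smooth_on_def by (metis partials_append)

lemma smooth_on_pderiv: "smooth_on V f \<Longrightarrow> smooth_on V (pderiv_at i f)"
  using smooth_on_partials[of V f "[i]"] by (simp add: partials_Cons)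

lemma smooth_on_mderiv: "smooth_on V f \<Longrightarrow> smooth_on V (mderiv \<alpha> f)"
  unfolding mderiv_def by (rule smooth_on_partials)

text \<open>In \<open>partials is f\<close> the last entry of the list is the derivative that acts on \<open>f\<close> first, which is
  the one that \<open>Ck\<close> splits off; hence the induction from the end of the list.\<close>

lemma smooth_on_iff_Ck: "smooth_on V f \<longleftrightarrow> (\<forall>k. Ck k V f)"
proof
  have "\<forall>f. smooth_on V f \<longrightarrow> Ck k V f" for k
    by (induction k) (auto intro: smooth_on_imp_continuous smooth_on_imp_differentiable smooth_on_pderiv)
  then show "smooth_on V f \<Longrightarrow> \<forall>k. Ck k V f" by blast
next
  assume *: "\<forall>k. Ck k V f"
  have "\<forall>f. (\<forall>k. Ck k V f) \<longrightarrow> continuous_on V (partials is f) \<and>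
           (\<forall>i. \<forall>x\<in>V. (\<lambda>t. partials is f (x + t *\<^sub>R axis i 1)) differentiable (at 0))" for "is"
  proof (induction "is" rule: rev_induct)
    case Nil
    then show ?case
    proof (intro allI impI)
      fix f assume *: "\<forall>k. Ck k V f"
      from *[rule_format, of "Suc 0"] show "continuous_on V (partials [] f) \<and>
           (\<forall>i. \<forall>x\<in>V. (\<lambda>t. partials [] f (x + t *\<^sub>R axis i 1)) differentiable (at 0))" by auto
    qed
  next
    case (snoc i "is")
    show ?case
    proof (intro allI impI)
      fix f assume *: "\<forall>k. Ck k V f"
      have "Ck k V (pderiv_at i f)" for k using *[rule_format, of "Suc k"] by auto
      then show "continuous_on V (partials (is @ [i]) f) \<and>
           (\<forall>ia. \<forall>x\<in>V. (\<lambda>t. partials (is @ [i]) f (x + t *\<^sub>R axis ia 1)) differentiable (at 0))"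
        unfolding partials_snoc using snoc.IH by blast
    qed
  qed
  with * show "smooth_on V f" unfolding smooth_on_def by blast
qed

lemma Ck_imp_continuous: "Ck k V f \<Longrightarrow> continuous_on V f"
  by (cases k) auto

lemma Ck_SucD: "Ck (Suc k) V f \<Longrightarrow> Ck k V f"
  by (induction k arbitrary: f) auto

lemma Ck_SucD_pderiv: "Ck (Suc k) V f \<Longrightarrow> Ck k V (pderiv_at i f)"
  by simp

lemma Ck_has_partial: "Ck (Suc k) V f \<Longrightarrow> x \<in> V \<Longrightarrow> has_partial f i (pderiv_at i f x) x"
  by (simp add: has_partial_pderiv)

lemma Ck_cong:
  assumes "open V" "\<And>x. x \<in> V \<Longrightarrow> f x = g x" "Ck k V f"
  shows "Ck k V g"
  using assms(2,3)
proof (induction k arbitrary: f g)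
  case 0
  then show ?case by (auto cong: continuous_on_cong)
next
  case (Suc k)
  have "continuous_on V g" using Suc.prems by (auto cong: continuous_on_cong)
  moreover have "(\<lambda>t. g (x + t *\<^sub>R axis i 1)) differentiable (at 0)" if "x \<in> V" for i x
    by (rule differentiableI_vector[OF has_partial_cong_open[OF assms(1) that Suc.prems(1)
          Ck_has_partial[OF Suc.prems(2) that]]])
  moreover have "Ck k V (pderiv_at i g)" for i
  proof (rule Suc.IH)
    show "pderiv_at i f x = pderiv_at i g x" if "x \<in> V" for x
      by (rule pderiv_at_cong_open[OF assms(1) that Suc.prems(1)])
    show "Ck k V (pderiv_at i f)" using Suc.prems(2) by simp
  qed
  ultimately show ?case by auto
qed

text \<open>Only a formula \<open>g\<close> for the derivatives on \<open>V\<close> is required, because \<open>Ck\<close> is insensitive to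
  changes off the open set \<open>V\<close>.\<close>

lemma Ck_SucI:
  assumes "open V" "continuous_on V f"
    and "\<And>i x. x \<in> V \<Longrightarrow> has_partial f i (g i x) x" "\<And>i. Ck k V (g i)"
  shows "Ck (Suc k) V f"
proof -
  have "Ck k V (pderiv_at i f)" for i
    by (rule Ck_cong[OF assms(1) _ assms(4)]) (simp add: has_partial_imp_pderiv[OF assms(3)])
  moreover have "(\<lambda>t. f (x + t *\<^sub>R axis i 1)) differentiable (at 0)" if "x \<in> V" for i x
    by (rule differentiableI_vector[OF assms(3)[OF that]])
  ultimately show ?thesis using assms(2) by simp
qed

declare Ck.simps(2) [simp del]

lemma Ck_const [simp]: "open V \<Longrightarrow> Ck k V (\<lambda>x. c)"
proof (induction k arbitrary: c)
  case (Suc k)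
  show ?case by (rule Ck_SucI[where g = "\<lambda>i x. 0"]) (use Suc in \<open>auto intro: derivative_eq_intros\<close>)
qed auto

lemma Ck_add: "open V \<Longrightarrow> Ck k V f \<Longrightarrow> Ck k V g \<Longrightarrow> Ck k V (\<lambda>x. f x + g x)"
proof (induction k arbitrary: f g)
  case 0
  then show ?case by (auto intro: continuous_intros)
next
  case (Suc k)
  show ?case
  proof (rule Ck_SucI[where g = "\<lambda>i x. pderiv_at i f x + pderiv_at i g x"])
    show "Ck k V (\<lambda>x. pderiv_at i f x + pderiv_at i g x)" for i
      using Suc.prems by (intro Suc.IH) (auto dest: Ck_SucD_pderiv)
  qed (use Suc.prems in \<open>auto intro!: continuous_intros has_vector_derivative_add
         Ck_has_partial[of k V] dest: Ck_imp_continuous\<close>)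
qed

lemma has_partial_mult:
  assumes "has_partial f i a x" "has_partial g i b x"
  shows "has_partial (\<lambda>x. f x * g x) i (a * g x + f x * b) x"
  using has_vector_derivative_mult[OF assms] by (simp add: algebra_simps)

lemma has_partial_inverse:
  fixes f :: "real^'n::finite \<Rightarrow> complex"
  assumes "has_partial f i a x" "f x \<noteq> 0"
  shows "has_partial (\<lambda>x. inverse (f x)) i (- (a * (inverse (f x) * inverse (f x)))) x"
proof -
  have "((inverse \<circ> (\<lambda>t. f (x + t *\<^sub>R axis i 1))) has_vector_derivative (a * (- (inverse (f x) * inverse (f x))))) (at 0)"
    by (rule field_vector_diff_chain_at[OF assms(1)])
       (use assms(2) in \<open>auto intro!: derivative_eq_intros\<close>)
  then show ?thesis by (simp add: o_def)
qed

lemma Ck_mult: "open V \<Longrightarrow> Ck k V f \<Longrightarrow> Ck k V g \<Longrightarrow> Ck k V (\<lambda>x. f x * g x)"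
proof (induction k arbitrary: f g)
  case 0
  then show ?case by (auto intro: continuous_intros)
next
  case (Suc k)
  show ?case
  proof (rule Ck_SucI[where g = "\<lambda>i x. pderiv_at i f x * g x + f x * pderiv_at i g x"])
    show "Ck k V (\<lambda>x. pderiv_at i f x * g x + f x * pderiv_at i g x)" for i
      using Suc.prems by (intro Ck_add Suc.IH) (auto dest: Ck_SucD Ck_SucD_pderiv)
  qed (use Suc.prems in \<open>auto intro!: continuous_intros has_partial_mult Ck_has_partial[of k V] dest: Ck_imp_continuous\<close>)
qed

lemma Ck_inverse:
  "open V \<Longrightarrow> Ck k V f \<Longrightarrow> (\<And>x. x \<in> V \<Longrightarrow> f x \<noteq> 0) \<Longrightarrow> Ck k V (\<lambda>x. inverse (f x))"
proof (induction k arbitrary: f)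
  case 0
  then show ?case by (auto intro: continuous_intros)
next
  case (Suc k)
  show ?case
  proof (rule Ck_SucI[where g = "\<lambda>i x. - (pderiv_at i f x * (inverse (f x) * inverse (f x)))"])
    have "Ck k V (\<lambda>x. - 1 * (pderiv_at i f x * (inverse (f x) * inverse (f x))))" for i
      using Suc.prems by (intro Ck_mult Suc.IH Ck_const) (auto dest: Ck_SucD Ck_SucD_pderiv)
    then show "Ck k V (\<lambda>x. - (pderiv_at i f x * (inverse (f x) * inverse (f x))))" for i
      by simp
  qed (use Suc.prems in \<open>auto intro!: continuous_intros has_partial_inverse Ck_has_partial[of k V] dest: Ck_imp_continuous\<close>)
qed

lemma continuous_on_open_Un_iff:
  "open A \<Longrightarrow> open B \<Longrightarrow> continuous_on (A \<union> B) f \<longleftrightarrow> continuous_on A f \<and> continuous_on B f"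
  by (auto intro: continuous_on_open_Un continuous_on_subset)

lemma Ck_Un: "open A \<Longrightarrow> open B \<Longrightarrow> Ck k A f \<Longrightarrow> Ck k B f \<Longrightarrow> Ck k (A \<union> B) f"
  by (induction k arbitrary: f) (auto simp: Ck.simps continuous_on_open_Un_iff)

lemma Ck_subset: "Ck k A f \<Longrightarrow> B \<subseteq> A \<Longrightarrow> Ck k B f"
  by (induction k arbitrary: f) (auto simp: Ck.simps intro: continuous_on_subset)

lemma smooth_on_cong:
  "open V \<Longrightarrow> (\<And>x. x \<in> V \<Longrightarrow> f x = g x) \<Longrightarrow> smooth_on V f \<Longrightarrow> smooth_on V g"
  unfolding smooth_on_iff_Ck by (blast intro: Ck_cong)

lemma smooth_on_subset: "smooth_on A f \<Longrightarrow> B \<subseteq> A \<Longrightarrow> smooth_on B f"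
  unfolding smooth_on_iff_Ck by (blast intro: Ck_subset)

lemma smooth_on_Un: "open A \<Longrightarrow> open B \<Longrightarrow> smooth_on A f \<Longrightarrow> smooth_on B f \<Longrightarrow> smooth_on (A \<union> B) f"
  unfolding smooth_on_iff_Ck by (blast intro: Ck_Un)

lemma smooth_on_const: "open V \<Longrightarrow> smooth_on V (\<lambda>x. c)"
  by (simp add: smooth_on_iff_Ck)

lemma smooth_on_add: "open V \<Longrightarrow> smooth_on V f \<Longrightarrow> smooth_on V g \<Longrightarrow> smooth_on V (\<lambda>x. f x + g x)"
  by (simp add: smooth_on_iff_Ck Ck_add)

lemma smooth_on_mult: "open V \<Longrightarrow> smooth_on V f \<Longrightarrow> smooth_on V g \<Longrightarrow> smooth_on V (\<lambda>x. f x * g x)"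
  by (simp add: smooth_on_iff_Ck Ck_mult)

lemma smooth_on_inverse:
  "open V \<Longrightarrow> smooth_on V f \<Longrightarrow> (\<And>x. x \<in> V \<Longrightarrow> f x \<noteq> 0) \<Longrightarrow> smooth_on V (\<lambda>x. inverse (f x))"
  by (simp add: smooth_on_iff_Ck Ck_inverse)

lemma smooth_on_uminus: "open V \<Longrightarrow> smooth_on V f \<Longrightarrow> smooth_on V (\<lambda>x. - f x)"
  using smooth_on_mult[of V "\<lambda>x. -1" f] by (simp add: smooth_on_const)

lemma smooth_on_diff: "open V \<Longrightarrow> smooth_on V f \<Longrightarrow> smooth_on V g \<Longrightarrow> smooth_on V (\<lambda>x. f x - g x)"
  using smooth_on_add[of V f "\<lambda>x. - g x"] by (simp add: smooth_on_uminus)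

lemma smooth_on_sum:
  "open V \<Longrightarrow> (\<And>a. a \<in> S \<Longrightarrow> smooth_on V (f a)) \<Longrightarrow> smooth_on V (\<lambda>x. \<Sum>a\<in>S. f a x)"
  by (induction S rule: infinite_finite_induct) (auto intro: smooth_on_const smooth_on_add)

lemmas smooth_on_intros = smooth_on_const smooth_on_add smooth_on_mult smooth_on_uminus
  smooth_on_diff smooth_on_sum smooth_on_pderiv smooth_on_mderiv smooth_on_partials

text \<open>\<open>V\<close> and \<open>- K\<close> are open and cover the space, and \<open>f\<close> vanishes on the second.\<close>

lemma smooth_on_extend_zero:
  assumes "open V" "closed K" "K \<subseteq> V" "smooth_on V f" "\<And>x. x \<notin> K \<Longrightarrow> f x = 0"
  shows "smooth_on UNIV f"
proof -
  have "smooth_on (- K) f"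
    by (rule smooth_on_cong[OF _ _ smooth_on_const[of _ 0]]) (use assms in auto)
  then have "smooth_on (V \<union> - K) f" using assms by (intro smooth_on_Un) auto
  moreover have "V \<union> - K = UNIV" using assms by auto
  ultimately show ?thesis by simp
qed

section \<open>Differentiation rules\<close>

lemma pderiv_at_add:
  "smooth_on V f \<Longrightarrow> smooth_on V g \<Longrightarrow> x \<in> V \<Longrightarrow>
   pderiv_at i (\<lambda>x. f x + g x) x = pderiv_at i f x + pderiv_at i g x"
  by (rule has_partial_imp_pderiv) (auto intro!: has_vector_derivative_add smooth_on_has_partial)

lemma pderiv_at_mult:
  "smooth_on V f \<Longrightarrow> smooth_on V g \<Longrightarrow> x \<in> V \<Longrightarrow>
   pderiv_at i (\<lambda>x. f x * g x) x = pderiv_at i f x * g x + f x * pderiv_at i g x"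
  by (rule has_partial_imp_pderiv) (auto intro!: has_partial_mult smooth_on_has_partial)

lemma pderiv_at_inverse:
  "smooth_on V f \<Longrightarrow> x \<in> V \<Longrightarrow> f x \<noteq> 0 \<Longrightarrow>
   pderiv_at i (\<lambda>x. inverse (f x)) x = - (pderiv_at i f x * (inverse (f x) * inverse (f x)))"
  by (rule has_partial_imp_pderiv) (auto intro!: has_partial_inverse smooth_on_has_partial)

lemma pderiv_at_cmult:
  assumes "smooth_on V f" "x \<in> V"
  shows "pderiv_at i (\<lambda>x. c * f x) x = c * pderiv_at i f x"
  by (rule has_partial_imp_pderiv)
     (use has_vector_derivative_mult_right[OF smooth_on_has_partial[OF assms]] in simp)

lemma pderiv_at_const: "pderiv_at i (\<lambda>x. c) x = 0"
  by (rule has_partial_imp_pderiv) (rule has_vector_derivative_const)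

lemma partials_cong_open:
  "open V \<Longrightarrow> (\<And>y. y \<in> V \<Longrightarrow> f y = g y) \<Longrightarrow> x \<in> V \<Longrightarrow> partials is f x = partials is g x"
proof (induction "is" arbitrary: x)
  case (Cons i "is")
  then show ?case unfolding partials_Cons by (intro pderiv_at_cong_open[OF Cons.prems(1)]) auto
qed simp

lemma partials_add:
  assumes "open V" "smooth_on V f" "smooth_on V g" "x \<in> V"
  shows "partials is (\<lambda>x. f x + g x) x = partials is f x + partials is g x"
  using assms(4)
proof (induction "is" arbitrary: x)
  case (Cons i "is")
  have "pderiv_at i (partials is (\<lambda>x. f x + g x)) x = pderiv_at i (\<lambda>x. partials is f x + partials is g x) x"
    by (rule pderiv_at_cong_open[OF assms(1)]) (use Cons in auto)
  then show ?case unfolding partials_Cons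
    using pderiv_at_add[OF smooth_on_partials[OF assms(2)] smooth_on_partials[OF assms(3)] Cons.prems] by simp
qed simp

lemma partials_cmult:
  assumes "open V" "smooth_on V f" "x \<in> V"
  shows "partials is (\<lambda>x. c * f x) x = c * partials is f x"
  using assms(3)
proof (induction "is" arbitrary: x)
  case (Cons i "is")
  have "pderiv_at i (partials is (\<lambda>x. c * f x)) x = pderiv_at i (\<lambda>x. c * partials is f x) x"
    by (rule pderiv_at_cong_open[OF assms(1)]) (use Cons in auto)
  then show ?case unfolding partials_Cons
    using pderiv_at_cmult[OF smooth_on_partials[OF assms(2)] Cons.prems] by simp
qed simp

lemma partials_zero: "partials is (\<lambda>x. 0) = (\<lambda>x. 0)"
  by (induction "is") (simp_all add: partials_Cons pderiv_at_const[abs_def])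

lemma partials_sum:
  assumes "open V" "\<And>a. a \<in> S \<Longrightarrow> smooth_on V (f a)" "x \<in> V"
  shows "partials is (\<lambda>x. \<Sum>a\<in>S. f a x) x = (\<Sum>a\<in>S. partials is (f a) x)"
  using assms(2)
proof (induction S rule: infinite_finite_induct)
  case (insert a S)
  then show ?case using partials_add[OF assms(1) _ _ assms(3), of "f a" "\<lambda>x. \<Sum>a\<in>S. f a x" "is"]
    by (simp add: smooth_on_sum[OF assms(1)])
qed (auto simp: partials_zero)

section \<open>Symmetry of mixed derivatives\<close>

lemma line_has_vector_derivative:
  assumes "smooth_on V f" "x + s *\<^sub>R axis i 1 \<in> V"
  shows "((\<lambda>t. f (x + t *\<^sub>R axis i 1)) has_vector_derivative pderiv_at i f (x + s *\<^sub>R axis i 1)) (at s)"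
proof -
  have "((\<lambda>t. t - s) has_vector_derivative 1) (at s)"
    by (auto intro!: derivative_eq_intros)
  moreover have "has_partial f i (pderiv_at i f (x + s *\<^sub>R axis i 1)) (x + s *\<^sub>R axis i 1)"
    using smooth_on_has_partial[OF assms] .
  ultimately have "((\<lambda>t. f ((x + s *\<^sub>R axis i 1) + t *\<^sub>R axis i 1)) \<circ> (\<lambda>t. t - s) has_vector_derivative
      1 *\<^sub>R pderiv_at i f (x + s *\<^sub>R axis i 1)) (at s)"
    by (intro vector_diff_chain_at) auto
  then show ?thesis by (simp add: o_def algebra_simps)
qed

text \<open>Two applications of the mean value theorem to the second difference over a square of side
  \<open>\<tau>\<close>.  The theorem is about real functions, hence the real linear functional \<open>h\<close>, which will be
  the real or the imaginary part.\<close>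

lemma second_difference_mean_value:
  fixes h :: "complex \<Rightarrow> real"
  assumes "bounded_linear h" "smooth_on V f" "\<tau> > 0"
    and sq: "\<And>s t. 0 \<le> s \<Longrightarrow> s \<le> \<tau> \<Longrightarrow> 0 \<le> t \<Longrightarrow> t \<le> \<tau> \<Longrightarrow> x + s *\<^sub>R axis i 1 + t *\<^sub>R axis j 1 \<in> V"
  obtains s t where "0 \<le> s" "s \<le> \<tau>" "0 \<le> t" "t \<le> \<tau>"
    "h (f (x + \<tau> *\<^sub>R axis i 1 + \<tau> *\<^sub>R axis j 1)) - h (f (x + \<tau> *\<^sub>R axis i 1))
       - h (f (x + \<tau> *\<^sub>R axis j 1)) + h (f x)
     = \<tau> * \<tau> * h (pderiv_at j (pderiv_at i f) (x + s *\<^sub>R axis i 1 + t *\<^sub>R axis j 1))"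
proof -
  define G where "G s = h (f ((x + \<tau> *\<^sub>R axis j 1) + s *\<^sub>R axis i 1)) - h (f (x + s *\<^sub>R axis i 1))" for s
  define G' where "G' s = h (pderiv_at i f ((x + \<tau> *\<^sub>R axis j 1) + s *\<^sub>R axis i 1))
     - h (pderiv_at i f (x + s *\<^sub>R axis i 1))" for s
  have "DERIV G s :> G' s" if "0 \<le> s" "s \<le> \<tau>" for s
    unfolding G_def G'_def has_real_derivative_iff_has_vector_derivative
    by (intro has_vector_derivative_diff bounded_linear.has_vector_derivative[OF assms(1)]
          line_has_vector_derivative[OF assms(2)])
       (use sq[of s \<tau>] sq[of s 0] that assms(3) in \<open>simp_all add: algebra_simps\<close>)
  from MVT2[OF assms(3) this] obtain s where s: "0 < s" "s < \<tau>" "G \<tau> - G 0 = (\<tau> - 0) * G' s"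
    by blast
  let ?y = "x + s *\<^sub>R axis i 1"
  have "DERIV (\<lambda>t. h (pderiv_at i f (?y + t *\<^sub>R axis j 1))) t :> h (pderiv_at j (pderiv_at i f) (?y + t *\<^sub>R axis j 1))"
    if "0 \<le> t" "t \<le> \<tau>" for t
    unfolding has_real_derivative_iff_has_vector_derivative
    by (intro bounded_linear.has_vector_derivative[OF assms(1)]
          line_has_vector_derivative[OF smooth_on_pderiv[OF assms(2)]])
       (use sq[of s t] that s in simp_all)
  from MVT2[OF assms(3) this] obtain t where t: "0 < t" "t < \<tau>"
    "h (pderiv_at i f (?y + \<tau> *\<^sub>R axis j 1)) - h (pderiv_at i f (?y + 0 *\<^sub>R axis j 1))
      = (\<tau> - 0) * h (pderiv_at j (pderiv_at i f) (?y + t *\<^sub>R axis j 1))"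
    by blast
  have "G' s = \<tau> * h (pderiv_at j (pderiv_at i f) (?y + t *\<^sub>R axis j 1))"
    using t(3) by (simp add: G'_def algebra_simps)
  then have "G \<tau> - G 0 = \<tau> * \<tau> * h (pderiv_at j (pderiv_at i f) (?y + t *\<^sub>R axis j 1))"
    using s(3) by simp
  moreover have "G \<tau> - G 0 = h (f (x + \<tau> *\<^sub>R axis i 1 + \<tau> *\<^sub>R axis j 1)) - h (f (x + \<tau> *\<^sub>R axis i 1))
       - h (f (x + \<tau> *\<^sub>R axis j 1)) + h (f x)"
    by (simp add: G_def algebra_simps)
  ultimately show thesis using s t by (intro that[of s t]) auto
qed

text \<open>The second difference is symmetric in \<open>i\<close> and \<open>j\<close>.  So, in every small
  square at \<open>x\<close>, one mixed derivative has the same value at some point as the other at some other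
  point, and by continuity they agree at \<open>x\<close>.\<close>

lemma pderiv_at_commute:
  fixes x :: "real^'n::finite"
  assumes "open V" "smooth_on V f" "x \<in> V"
  shows "pderiv_at i (pderiv_at j f) x = pderiv_at j (pderiv_at i f) x"
proof -
  have "h (pderiv_at i (pderiv_at j f) x) = h (pderiv_at j (pderiv_at i f) x)"
    if h: "bounded_linear h" for h :: "complex \<Rightarrow> real"
  proof (rule ccontr)
    assume ne: "h (pderiv_at i (pderiv_at j f) x) \<noteq> h (pderiv_at j (pderiv_at i f) x)"
    define e where "e = \<bar>h (pderiv_at i (pderiv_at j f) x) - h (pderiv_at j (pderiv_at i f) x)\<bar> / 2"
    have "e > 0" using ne by (simp add: e_def)
    have near: "\<exists>d>0. ball x d \<subseteq> V \<and> (\<forall>y\<in>ball x d. \<bar>h (pderiv_at k (pderiv_at l f) y) - h (pderiv_at k (pderiv_at l f) x)\<bar> < e)"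
      for k l
    proof -
      have "continuous_on V (\<lambda>y. h (pderiv_at k (pderiv_at l f) y))"
        by (intro bounded_linear.continuous_on[OF h] smooth_on_imp_continuous smooth_on_pderiv assms(2))
      then have "isCont (\<lambda>y. h (pderiv_at k (pderiv_at l f) y)) x"
        using assms continuous_on_eq_continuous_at by blast
      then obtain d1 where "d1 > 0" "\<And>y. dist y x < d1 \<Longrightarrow> dist (h (pderiv_at k (pderiv_at l f) y)) (h (pderiv_at k (pderiv_at l f) x)) < e"
        using \<open>e > 0\<close> unfolding continuous_at_eps_delta by blast
      moreover obtain d2 where "d2 > 0" "ball x d2 \<subseteq> V" using assms open_contains_ball by blast
      ultimately show ?thesis
        by (intro exI[of _ "min d1 d2"]) (auto simp: dist_real_def dist_commute)
    qed
    obtain d1 where d1: "d1 > 0" "ball x d1 \<subseteq> V"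
      "\<And>y. y \<in> ball x d1 \<Longrightarrow> \<bar>h (pderiv_at i (pderiv_at j f) y) - h (pderiv_at i (pderiv_at j f) x)\<bar> < e"
      using near[of i j] by blast
    obtain d2 where d2: "d2 > 0" "ball x d2 \<subseteq> V"
      "\<And>y. y \<in> ball x d2 \<Longrightarrow> \<bar>h (pderiv_at j (pderiv_at i f) y) - h (pderiv_at j (pderiv_at i f) x)\<bar> < e"
      using near[of j i] by blast
    define d where "d = min d1 d2"
    have d: "d > 0" "ball x d \<subseteq> ball x d1" "ball x d \<subseteq> ball x d2" using d1(1) d2(1) by (auto simp: d_def)
    define \<tau> where "\<tau> = d / 3"
    have \<tau>: "\<tau> > 0" using d by (simp add: \<tau>_def)
    have sq: "x + s *\<^sub>R axis k 1 + t *\<^sub>R axis l 1 \<in> ball x d" if "0 \<le> s" "s \<le> \<tau>" "0 \<le> t" "t \<le> \<tau>"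
      for s t and k l :: 'n
    proof -
      have "norm (s *\<^sub>R axis k 1 + t *\<^sub>R axis l 1 :: real^'n) \<le> s + t"
        by (rule order_trans[OF norm_triangle_ineq]) (use that in \<open>simp add: norm_axis_1\<close>)
      moreover have "s + t < d" using that d by (simp add: \<tau>_def)
      moreover have "dist x (x + (s *\<^sub>R axis k 1 + t *\<^sub>R axis l 1)) = norm (s *\<^sub>R axis k 1 + t *\<^sub>R axis l 1 :: real^'n)"
        by (subst dist_commute) (simp add: dist_norm)
      ultimately show ?thesis by (simp add: add.assoc)
    qed
    obtain s t where st: "0 \<le> s" "s \<le> \<tau>" "0 \<le> t" "t \<le> \<tau>"
      "h (f (x + \<tau> *\<^sub>R axis i 1 + \<tau> *\<^sub>R axis j 1)) - h (f (x + \<tau> *\<^sub>R axis i 1))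
         - h (f (x + \<tau> *\<^sub>R axis j 1)) + h (f x)
       = \<tau> * \<tau> * h (pderiv_at j (pderiv_at i f) (x + s *\<^sub>R axis i 1 + t *\<^sub>R axis j 1))"
      using second_difference_mean_value[OF h assms(2) \<tau>, of x i j] sq[of _ _ i j] d d1 by blast
    obtain s' t' where st': "0 \<le> s'" "s' \<le> \<tau>" "0 \<le> t'" "t' \<le> \<tau>"
      "h (f (x + \<tau> *\<^sub>R axis j 1 + \<tau> *\<^sub>R axis i 1)) - h (f (x + \<tau> *\<^sub>R axis j 1))
         - h (f (x + \<tau> *\<^sub>R axis i 1)) + h (f x)
       = \<tau> * \<tau> * h (pderiv_at i (pderiv_at j f) (x + s' *\<^sub>R axis j 1 + t' *\<^sub>R axis i 1))"
      using second_difference_mean_value[OF h assms(2) \<tau>, of x j i] sq[of _ _ j i] d d1 by blast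
    have comm: "x + \<tau> *\<^sub>R axis j 1 + \<tau> *\<^sub>R axis i 1 = x + \<tau> *\<^sub>R axis i 1 + \<tau> *\<^sub>R axis j 1"
      by (simp add: algebra_simps)
    have "\<tau> * \<tau> * h (pderiv_at i (pderiv_at j f) (x + s' *\<^sub>R axis j 1 + t' *\<^sub>R axis i 1))
        = \<tau> * \<tau> * h (pderiv_at j (pderiv_at i f) (x + s *\<^sub>R axis i 1 + t *\<^sub>R axis j 1))"
      using st(5) st'(5)[unfolded comm] by linarith
    then have eq: "h (pderiv_at i (pderiv_at j f) (x + s' *\<^sub>R axis j 1 + t' *\<^sub>R axis i 1))
        = h (pderiv_at j (pderiv_at i f) (x + s *\<^sub>R axis i 1 + t *\<^sub>R axis j 1))"
      using \<tau> by simp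
    have "\<bar>h (pderiv_at i (pderiv_at j f) (x + s' *\<^sub>R axis j 1 + t' *\<^sub>R axis i 1)) - h (pderiv_at i (pderiv_at j f) x)\<bar> < e"
      using d1(3) d(2) sq[OF st'(1-4)] by blast
    moreover have "\<bar>h (pderiv_at j (pderiv_at i f) (x + s *\<^sub>R axis i 1 + t *\<^sub>R axis j 1)) - h (pderiv_at j (pderiv_at i f) x)\<bar> < e"
      using d2(3) d(3) sq[OF st(1-4)] by blast
    moreover have "\<bar>p - q\<bar> \<le> \<bar>a - p\<bar> + \<bar>a - q\<bar>" for a p q :: real by linarith
    ultimately show False unfolding eq e_def by (smt (verit) field_sum_of_halves)
  qed
  from this[OF bounded_linear_Re] this[OF bounded_linear_Im] show ?thesis
    by (simp add: complex_eq_iff)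
qed

text \<open>The head of the first list is moved to its place in the second by transpositions of
  neighbours.\<close>

lemma partials_perm:
  assumes "open V" "smooth_on V f" "mset is = mset js" "x \<in> V"
  shows "partials is f x = partials js f x"
  using assms(3,4)
proof (induction "is" arbitrary: js x)
  case Nil
  then have "js = []" by simp
  then show ?case by (simp only:)
next
  case (Cons i "is")
  have "i \<in> set js" using Cons.prems(1) by (metis list.set_intros(1) mset_eq_setD)
  then obtain as bs where js: "js = as @ i # bs" by (meson split_list)
  have eq: "partials (is) f y = partials (as @ bs) f y" if "y \<in> V" for y
    by (rule Cons.IH) (use Cons.prems js that in auto)
  have move: "y \<in> V \<Longrightarrow> partials (i # cs @ bs) f y = partials (cs @ i # bs) f y" for cs y
  proof (induction cs arbitrary: y)
    case (Cons c cs)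
    have "partials (i # (c # cs) @ bs) f y = pderiv_at i (pderiv_at c (partials (cs @ bs) f)) y"
      by (simp add: partials_Cons)
    also have "\<dots> = pderiv_at c (pderiv_at i (partials (cs @ bs) f)) y"
      by (rule pderiv_at_commute[OF assms(1) smooth_on_partials[OF assms(2)] Cons.prems])
    also have "\<dots> = pderiv_at c (partials (cs @ i # bs) f) y"
      by (rule pderiv_at_cong_open[OF assms(1) Cons.prems]) (use Cons.IH in \<open>simp add: partials_Cons\<close>)
    finally show ?case by (simp add: partials_Cons)
  qed simp
  have "partials (i # is) f x = partials (i # as @ bs) f x"
    unfolding partials_Cons by (rule pderiv_at_cong_open[OF assms(1) Cons.prems(2) eq])
  also have "\<dots> = partials js f x" unfolding js by (rule move[OF Cons.prems(2)])
  finally show ?case .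
qed

section \<open>Lists of coordinates and multi-indices\<close>

text \<open>Lists of coordinates are better suited to inductions, multi-indices to the expansion of a
  symbol; for smooth functions both describe the same derivatives.\<close>

lemma coords: "distinct (coords :: 'n::finite list)" "set (coords :: 'n list) = UNIV"
proof -
  have "\<exists>is::'n list. distinct is \<and> set is = UNIV" using finite_distinct_list[OF finite[of "UNIV :: 'n set"]] by (metis (no_types))
  from someI_ex[OF this] show "distinct (coords :: 'n list)" "set (coords :: 'n list) = UNIV"
    unfolding coords_def by auto
qed

definition mi_list :: "'n::finite multi_index \<Rightarrow> 'n list" where
  "mi_list \<alpha> = concat (map (\<lambda>i. replicate (\<alpha> i) i) coords)"

lemma mderiv_eq_partials: "mderiv \<alpha> = partials (mi_list \<alpha>)"
  by (simp add: fun_eq_iff mderiv_def mi_list_def)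

lemma count_mi_list: "count (mset (mi_list \<alpha>)) i = \<alpha> i"
proof -
  have "count (mset (concat (map (\<lambda>i. replicate (\<alpha> i) i) cs))) i = (if i \<in> set cs then \<alpha> i else 0)"
    if "distinct cs" for cs
    using that by (induction cs) auto
  from this[OF coords(1)] show ?thesis by (simp add: mi_list_def coords(2))
qed

lemma length_mi_list: "length (mi_list \<alpha>) = mi_len \<alpha>"
proof -
  have "size (mset (mi_list \<alpha>)) = (\<Sum>i\<in>UNIV. count (mset (mi_list \<alpha>)) i)"
    unfolding size_multiset_overloaded_eq
    by (rule sum.mono_neutral_left) (auto simp: not_in_iff)
  then show ?thesis by (simp add: count_mi_list mi_len_def)
qed

lemma partials_eq_mderiv:
  assumes "open V" "smooth_on V f" "x \<in> V"
  shows "partials is f x = mderiv (count (mset is)) f x"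
  unfolding mderiv_eq_partials
  by (rule partials_perm[OF assms(1,2) _ assms(3)]) (simp add: multiset_eq_iff count_mi_list)

lemma mi_len_count: "mi_len (count (mset is)) = length is"
proof -
  have "mset (mi_list (count (mset is))) = mset is" by (simp add: multiset_eq_iff count_mi_list)
  then show ?thesis by (metis length_mi_list size_mset)
qed

section \<open>Integration by parts\<close>

lemma pderiv_at_off_support:
  assumes "closed K" "\<And>x. x \<notin> K \<Longrightarrow> f x = 0" "x \<notin> K"
  shows "pderiv_at i f x = 0"
proof -
  have "pderiv_at i f x = pderiv_at i (\<lambda>x. 0) x"
    by (rule pderiv_at_cong_open[of "- K"]) (use assms in auto)
  then show ?thesis by (simp add: pderiv_at_const)
qed

lemma partials_off_support:
  assumes "closed K" "\<And>x. x \<notin> K \<Longrightarrow> f x = 0" "x \<notin> K"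
  shows "partials is f x = 0"
  using assms(3)
  by (induction "is" arbitrary: x) (auto simp: partials_Cons assms(2) intro!: pderiv_at_off_support[OF assms(1)])

lemma integrable_compact_support:
  fixes f :: "'a::euclidean_space \<Rightarrow> complex"
  assumes "compact K" "continuous_on UNIV f" "\<And>x. x \<notin> K \<Longrightarrow> f x = 0"
  shows "integrable lborel f"
proof -
  have "integrable lborel (\<lambda>x. indicator K x *\<^sub>R f x)"
    by (rule borel_integrable_compact) (use assms(1,2) in \<open>auto intro: continuous_on_subset\<close>)
  moreover have "(\<lambda>x. indicator K x *\<^sub>R f x) = f"
    using assms(3) by (auto simp: fun_eq_iff indicator_def)
  ultimately show ?thesis by simp
qed

lemma norm_integral_compact_support:
  fixes f :: "'a::euclidean_space \<Rightarrow> complex"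
  assumes "compact K" "\<And>x. x \<notin> K \<Longrightarrow> f x = 0" "\<And>x. x \<in> K \<Longrightarrow> norm (f x) \<le> B" "B \<ge> 0"
  shows "norm (LINT x|lborel. f x) \<le> B * measure lborel K"
proof -
  have K: "K \<in> sets lborel" "emeasure lborel K < \<infinity>"
    using assms(1) emeasure_compact_finite by (auto simp: borel_compact)
  then have "integrable lborel (\<lambda>x. B * indicator K x :: real)" by simp
  then have "norm (LINT x|lborel. f x) \<le> (LINT x|lborel. B * indicator K x)"
  proof (cases "integrable lborel f")
    case True
    show ?thesis
      by (rule Bochner_Integration.integral_norm_bound_integral[OF True \<open>integrable lborel (\<lambda>x. B * indicator K x)\<close>])
         (use assms in \<open>auto simp: indicator_def\<close>)
  next
    case False
    then show ?thesis using assms(4) by (simp add: not_integrable_integral_eq)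
  qed
  also have "\<dots> = B * measure lborel K" using K by simp
  finally show ?thesis .
qed

lemma lborel_integral_affine:
  fixes f :: "'a::euclidean_space \<Rightarrow> complex"
  assumes [measurable]: "f \<in> borel_measurable borel" and "c \<noteq> 0"
  shows "(LINT x|lborel. f x) = of_real (\<bar>c\<bar> ^ DIM('a)) * (LINT x|lborel. f (a + c *\<^sub>R x))"
proof -
  have "(LINT x|lborel. f x) = (LINT x|density (distr lborel borel (\<lambda>x. a + c *\<^sub>R x)) (\<lambda>_. ennreal (\<bar>c\<bar> ^ DIM('a))). f x)"
    using lborel_affine[OF assms(2), of a] by (simp add: ennreal_power)
  also have "\<dots> = (LINT x|lborel. \<bar>c\<bar> ^ DIM('a) *\<^sub>R f (a + c *\<^sub>R x))"
    by (subst integral_density) (simp_all add: integral_distr)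
  finally show ?thesis by (simp add: scaleR_conv_of_real)
qed

lemma lborel_integral_translate:
  fixes f :: "'a::euclidean_space \<Rightarrow> complex"
  assumes "f \<in> borel_measurable borel"
  shows "(LINT x|lborel. f (a + x)) = (LINT x|lborel. f x)"
  using lborel_integral_affine[OF assms, of 1 a] by simp

lemma smooth_on_borel_measurable: "smooth_on UNIV f \<Longrightarrow> f \<in> borel_measurable borel"
  by (simp add: borel_measurable_continuous_onI smooth_on_imp_continuous)

lemma norm_difference_quotient_le:
  assumes "smooth_on UNIV f" "\<And>y. norm (pderiv_at i f y) \<le> B"
  shows "norm (f (x + t *\<^sub>R axis i 1) - f x) \<le> B * \<bar>t\<bar>"
proof -
  have "norm ((\<lambda>t. f (x + t *\<^sub>R axis i 1)) t - (\<lambda>t. f (x + t *\<^sub>R axis i 1)) 0) \<le> B * norm (t - 0)"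
  proof (rule differentiable_bound[of UNIV])
    show "((\<lambda>t. f (x + t *\<^sub>R axis i 1)) has_derivative (\<lambda>h. h *\<^sub>R pderiv_at i f (x + s *\<^sub>R axis i 1))) (at s within UNIV)" for s
      using line_has_vector_derivative[OF assms(1), of x s i] by (simp add: has_vector_derivative_def)
    show "onorm (\<lambda>h::real. h *\<^sub>R pderiv_at i f (x + s *\<^sub>R axis i 1)) \<le> B" for s
      by (rule onorm_le) (simp add: mult.commute[of B] mult_left_mono assms(2))
  qed auto
  then show ?thesis by simp
qed

lemma has_partial_quotient:
  assumes "has_partial f i d x"
  shows "((\<lambda>s. (f (x + s *\<^sub>R axis i 1) - f x) /\<^sub>R s) \<longlongrightarrow> d) (at 0)"
proof -
  have "((\<lambda>h. norm (f (x + h *\<^sub>R axis i 1) - f x - h *\<^sub>R d) / norm h) \<longlongrightarrow> 0) (at 0)"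
    using assms unfolding has_vector_derivative_def has_derivative_at by simp
  then have "((\<lambda>h. norm ((f (x + h *\<^sub>R axis i 1) - f x) /\<^sub>R h - d)) \<longlongrightarrow> 0) (at 0)"
  proof (rule Lim_transform_eventually)
    have "norm (f (x + h *\<^sub>R axis i 1) - f x - h *\<^sub>R d) / norm h
      = norm ((f (x + h *\<^sub>R axis i 1) - f x) /\<^sub>R h - d)" if "h \<noteq> 0" for h
  proof -
    have "(f (x + h *\<^sub>R axis i 1) - f x) /\<^sub>R h - d = (f (x + h *\<^sub>R axis i 1) - f x - h *\<^sub>R d) /\<^sub>R h"
      using that by (simp add: scaleR_diff_right)
    then show ?thesis by (simp add: divide_inverse mult.commute)
  qed
    then show "\<forall>\<^sub>F h in at 0. norm (f (x + h *\<^sub>R axis i 1) - f x - h *\<^sub>R d) / norm h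
      = norm ((f (x + h *\<^sub>R axis i 1) - f x) /\<^sub>R h - d)"
      unfolding eventually_at_filter by (intro always_eventually) blast
  qed
  then show ?thesis by (simp only: tendsto_norm_zero_iff LIM_zero_iff)
qed

text \<open>The integral is invariant under translations, so the difference quotients have integral
  zero, and they converge to the derivative under a common bound.\<close>

lemma integral_pderiv_zero:
  fixes f :: "real^'n::finite \<Rightarrow> complex"
  assumes f: "smooth_on UNIV f" and K: "compact K" "\<And>x. x \<notin> K \<Longrightarrow> f x = 0"
  shows "(LINT x|lborel. pderiv_at i f x) = 0"
proof -
  note [measurable] = smooth_on_borel_measurable[OF f]
  define t where "t k = 1 / real (Suc k)" for k
  have t: "t k > 0" "t k \<le> 1" for k by (auto simp: t_def)
  have "continuous_on K (\<lambda>x. norm (pderiv_at i f x))"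
    by (intro continuous_intros continuous_on_subset[OF smooth_on_imp_continuous[OF smooth_on_pderiv[OF f]]]) auto
  then have "bdd_above ((\<lambda>x. norm (pderiv_at i f x)) ` K)"
    by (intro bounded_imp_bdd_above compact_imp_bounded compact_continuous_image K(1))
  then obtain B where BK: "\<And>x. x \<in> K \<Longrightarrow> norm (pderiv_at i f x) \<le> B" by (auto simp: bdd_above_def)
  have B: "norm (pderiv_at i f x) \<le> max B 0" for x
  proof (cases "x \<in> K")
    case True
    then show ?thesis using BK[OF True] by simp
  next
    case False
    have "pderiv_at i f x = 0"
      by (rule pderiv_at_off_support[OF compact_imp_closed[OF K(1)] _ False]) (rule K(2))
    then show ?thesis by simp
  qed
  define Q where "Q k x = of_real (1 / t k) * (f (x + t k *\<^sub>R axis i 1) - f x)" for k x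
  obtain R where "\<And>x. x \<in> K \<Longrightarrow> norm x \<le> R" using compact_imp_bounded[OF K(1)] unfolding bounded_iff by auto
  then have R: "K \<subseteq> cball 0 R" by auto
  (* The steps are at most 1, so the quotients vanish outside the ball of radius R + 1. *)
  have zero: "Q k x = 0" if "x \<notin> cball 0 (R + 1)" for k x
  proof -
    have "norm x \<le> norm (x + t k *\<^sub>R axis i 1) + norm (t k *\<^sub>R axis i 1 :: real^'n)"
      by (metis add_diff_cancel_right' norm_triangle_ineq4)
    then have "x + t k *\<^sub>R axis i 1 \<notin> cball 0 R" "x \<notin> cball 0 R" using that t[of k] by (auto simp: norm_axis_1)
    then have "x + t k *\<^sub>R axis i 1 \<notin> K" "x \<notin> K" using R by blast+
    then show ?thesis using K(2) by (simp add: Q_def)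
  qed
  have Qint: "(LINT x|lborel. Q k x) = 0" for k
  proof -
    have int: "integrable lborel (\<lambda>x. f x)"
      by (rule integrable_compact_support[OF K(1) smooth_on_imp_continuous[OF f] K(2)])
    have int2: "integrable lborel (\<lambda>x. f (x + t k *\<^sub>R axis i 1))"
    proof (rule integrable_compact_support[of "cball 0 (R+1)"])
      show "continuous_on UNIV (\<lambda>x. f (x + t k *\<^sub>R axis i 1))"
        by (intro continuous_intros continuous_on_compose2[OF smooth_on_imp_continuous[OF f]]) auto
      show "f (x + t k *\<^sub>R axis i 1) = 0" if "x \<notin> cball 0 (R + 1)" for x
      proof -
        have "x \<notin> cball 0 R" using that by simp
        then have "x \<notin> K" using R by blast
        then show ?thesis using zero[OF that, of k] K(2)[of x] t[of k] by (simp add: Q_def)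
      qed
    qed auto
    show ?thesis unfolding Q_def using int int2 lborel_integral_translate[of f "t k *\<^sub>R axis i 1"]
      by (simp add: add.commute)
  qed
  have "(\<lambda>k. LINT x|lborel. Q k x) \<longlonglongrightarrow> (LINT x|lborel. pderiv_at i f x)"
  proof (rule integral_dominated_convergence[where w = "\<lambda>x. max B 0 * indicator (cball 0 (R+1)) x"])
    show "(\<lambda>x. pderiv_at i f x) \<in> borel_measurable lborel"
      using smooth_on_borel_measurable[OF smooth_on_pderiv[OF f]] by simp
    show "Q k \<in> borel_measurable lborel" for k unfolding Q_def by simp
    show "integrable lborel (\<lambda>x::real^'n. max B 0 * indicator (cball 0 (R+1)) x :: real)"
      by (intro integrable_mult_right integrable_real_indicator) (use emeasure_lborel_cball_finite[of "0::real^'n" "R + 1"] in auto)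
    show "AE x in lborel. (\<lambda>k. Q k x) \<longlonglongrightarrow> pderiv_at i f x"
    proof (rule AE_I2)
      fix x
      have "((\<lambda>s. (f (x + s *\<^sub>R axis i 1) - f x) /\<^sub>R s) \<longlongrightarrow> pderiv_at i f x) (at 0)"
        by (rule has_partial_quotient, rule smooth_on_has_partial[OF f]) simp
      moreover have "filterlim t (at 0) sequentially"
        unfolding filterlim_at using LIMSEQ_Suc[OF lim_1_over_n] t(1)
        by (auto simp: t_def[abs_def])
      ultimately have "(\<lambda>k. (f (x + t k *\<^sub>R axis i 1) - f x) /\<^sub>R t k) \<longlonglongrightarrow> pderiv_at i f x"
        by (rule filterlim_compose)
      then show "(\<lambda>k. Q k x) \<longlonglongrightarrow> pderiv_at i f x"
        by (simp add: Q_def scaleR_conv_of_real inverse_eq_divide)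
    qed
    show "AE x in lborel. norm (Q k x) \<le> max B 0 * indicator (cball 0 (R+1)) x" for k
    proof (rule AE_I2)
      fix x
      have "norm (Q k x) = norm (f (x + t k *\<^sub>R axis i 1) - f x) / t k"
        using t(1)[of k] by (simp add: Q_def norm_mult norm_divide)
      also have "\<dots> \<le> max B 0"
        using norm_difference_quotient_le[OF f B, of x "t k"] t(1)[of k] by (simp add: divide_le_eq)
      finally show "norm (Q k x) \<le> max B 0 * indicator (cball 0 (R+1)) x"
        using zero[of x k] by (cases "x \<in> cball 0 (R+1)") auto
    qed
  qed
  then show ?thesis unfolding Qint using LIMSEQ_unique tendsto_const by blast
qed

lemma integral_by_parts:
  assumes V: "open V" "smooth_on V u" "smooth_on V w"
    and K: "compact K" "K \<subseteq> V" "\<And>x. x \<notin> K \<Longrightarrow> w x = 0"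
  shows "(LINT x|lborel. pderiv_at i u x * w x) = - (LINT x|lborel. u x * pderiv_at i w x)"
proof -
  note cl = compact_imp_closed[OF K(1)]
  have w': "pderiv_at i w x = 0" if "x \<notin> K" for x by (rule pderiv_at_off_support[OF cl K(3) that])
  have sm: "smooth_on UNIV (\<lambda>x. a x * b x)" if "smooth_on V a" "smooth_on V b" "\<And>x. x \<notin> K \<Longrightarrow> b x = 0" for a b
    by (rule smooth_on_extend_zero[OF V(1) cl K(2)]) (use that V(1) in \<open>auto intro: smooth_on_mult\<close>)
  have s1: "smooth_on UNIV (\<lambda>x. pderiv_at i u x * w x)"
    and s2: "smooth_on UNIV (\<lambda>x. u x * pderiv_at i w x)" and s3: "smooth_on UNIV (\<lambda>x. u x * w x)"
    using sm V K(3) w' by (auto intro: smooth_on_pderiv)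
  have i1: "integrable lborel (\<lambda>x. pderiv_at i u x * w x)"
    by (rule integrable_compact_support[OF K(1) smooth_on_imp_continuous[OF s1]]) (simp add: K(3))
  have i2: "integrable lborel (\<lambda>x. u x * pderiv_at i w x)"
    by (rule integrable_compact_support[OF K(1) smooth_on_imp_continuous[OF s2]]) (simp add: w')
  have "pderiv_at i (\<lambda>x. u x * w x) x = pderiv_at i u x * w x + u x * pderiv_at i w x" for x
  proof (cases "x \<in> V")
    case True
    then show ?thesis by (rule pderiv_at_mult[OF V(2,3)])
  next
    case False
    then have "x \<notin> K" using K(2) by blast
    moreover have "pderiv_at i (\<lambda>x. u x * w x) x = 0"
      by (rule pderiv_at_off_support[OF cl _ \<open>x \<notin> K\<close>]) (simp add: K(3))
    ultimately show ?thesis using K(3) w' by simp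
  qed
  then have "(LINT x|lborel. pderiv_at i u x * w x) + (LINT x|lborel. u x * pderiv_at i w x)
      = (LINT x|lborel. pderiv_at i (\<lambda>x. u x * w x) x)"
    using i1 i2 by simp
  also have "\<dots> = 0"
    by (rule integral_pderiv_zero[OF s3 K(1)]) (simp add: K(3))
  finally show ?thesis by (simp add: eq_neg_iff_add_eq_0)
qed

section \<open>Fourier transforms of functions with compact support\<close>

definition expi :: "real^'n::finite \<Rightarrow> real^'n \<Rightarrow> complex" where
  "expi \<xi> x = exp (- (\<i> * of_real (\<xi> \<bullet> x)))"

lemma norm_expi [simp]: "norm (expi \<xi> x) = 1"
proof -
  have "expi \<xi> x = exp (\<i> * of_real (- (\<xi> \<bullet> x)))" by (simp add: expi_def)
  then show ?thesis by (simp only: norm_exp_i_times)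
qed

lemma continuous_on_expi: "continuous_on A (expi \<xi>)"
  unfolding expi_def by (intro continuous_intros)

lemma borel_measurable_expi [measurable]: "expi \<xi> \<in> borel_measurable borel"
  by (intro borel_measurable_continuous_onI continuous_on_expi)

lemma has_partial_expi: "has_partial (expi \<xi>) i (- \<i> * of_real (\<xi> $ i) * expi \<xi> x) x"
proof -
  have *: "expi \<xi> (x + t *\<^sub>R axis i 1) = expi \<xi> x * exp (of_real t * (- \<i> * of_real (\<xi> $ i)))" for t
    by (simp add: expi_def inner_add_right inner_axis algebra_simps exp_add[symmetric])
  have "((\<lambda>t. exp (t *\<^sub>R (- \<i> * of_real (\<xi> $ i)))) has_vector_derivative
        exp (0 *\<^sub>R (- \<i> * of_real (\<xi> $ i))) * (- \<i> * of_real (\<xi> $ i))) (at 0)"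
    by (rule exp_scaleR_has_vector_derivative_right)
  from has_vector_derivative_mult_right[OF this, of "expi \<xi> x"]
  show ?thesis unfolding * by (simp add: mult_ac scaleR_conv_of_real)
qed

lemma smooth_on_expi:
  assumes "open V" shows "smooth_on V (expi \<xi>)"
proof -
  have "Ck k V (expi \<xi>)" for k
  proof (induction k)
    case (Suc k)
    show ?case
      by (rule Ck_SucI[OF assms continuous_on_expi has_partial_expi])
         (intro Ck_mult Ck_const assms Suc)
  qed (simp add: continuous_on_expi)
  then show ?thesis by (simp add: smooth_on_iff_Ck)
qed

lemma integrable_smooth_expi:
  assumes "open V" "smooth_on V a" "smooth_on V b" and K: "compact K" "K \<subseteq> V" "\<And>x. x \<notin> K \<Longrightarrow> a x = 0"
  shows "integrable lborel (\<lambda>x. a x * b x * expi \<xi> x)"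
proof (rule integrable_compact_support[OF K(1)])
  have "smooth_on UNIV (\<lambda>x. a x * b x * expi \<xi> x)"
    by (rule smooth_on_extend_zero[OF assms(1) compact_imp_closed[OF K(1)] K(2)])
       (use assms in \<open>auto intro!: smooth_on_mult smooth_on_expi\<close>)
  then show "continuous_on UNIV (\<lambda>x. a x * b x * expi \<xi> x)" by (rule smooth_on_imp_continuous)
qed (simp add: K(3))

lemma fourier_eq: "fourier v \<xi> = (LINT x|lborel. v x * expi \<xi> x)"
  by (simp add: fourier_def expi_def)

lemma fourier_pderiv:
  assumes "smooth_on UNIV f" "compact K" "\<And>x. x \<notin> K \<Longrightarrow> f x = 0"
  shows "fourier (pderiv_at i f) \<xi> = \<i> * of_real (\<xi> $ i) * fourier f \<xi>"
proof -
  have "(LINT x|lborel. pderiv_at i (expi \<xi>) x * f x) = - (LINT x|lborel. expi \<xi> x * pderiv_at i f x)"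
    by (rule integral_by_parts[of UNIV]) (use assms smooth_on_expi in auto)
  moreover have "pderiv_at i (expi \<xi>) x * f x = (- \<i> * of_real (\<xi> $ i)) * (f x * expi \<xi> x)" for x
    unfolding has_partial_imp_pderiv[OF has_partial_expi] by simp
  ultimately have "(- \<i> * of_real (\<xi> $ i)) * fourier f \<xi> = - fourier (pderiv_at i f) \<xi>"
    unfolding fourier_eq by (simp add: mult.commute)
  then show ?thesis by (metis minus_mult_left minus_equation_iff)
qed

lemma norm_fourier_le:
  assumes "compact K" "\<And>x. x \<notin> K \<Longrightarrow> f x = 0" "\<And>x. x \<in> K \<Longrightarrow> norm (f x) \<le> B" "B \<ge> 0"
  shows "norm (fourier f \<xi>) \<le> B * measure lborel K"
  unfolding fourier_eq by (rule norm_integral_compact_support) (use assms in \<open>auto simp: norm_mult\<close>)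

text \<open>Decay of order \<open>k\<close> costs \<open>k\<close> derivatives.  Only the pure derivatives in the direction of the
  largest coordinate of \<open>\<zeta>\<close> are needed.\<close>

lemma fourier_decay:
  fixes f :: "real^'n::finite \<Rightarrow> complex"
  assumes f: "smooth_on UNIV f" and K: "compact K" "\<And>x. x \<notin> K \<Longrightarrow> f x = 0"
    and B: "\<And>is x. length is \<le> k \<Longrightarrow> x \<in> K \<Longrightarrow> norm (partials is f x) \<le> B" "B \<ge> 0"
  shows "norm (fourier f \<zeta>) * (1 + norm \<zeta>) ^ k \<le> real (CARD('n) + 1) ^ k * measure lborel K * B"
proof -
  have eq: "fourier (partials (replicate j i) f) \<zeta> = (\<i> * of_real (\<zeta> $ i)) ^ j * fourier f \<zeta>" for i j
  proof (induction j)
    case (Suc j)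
    have "fourier (pderiv_at i (partials (replicate j i) f)) \<zeta> = \<i> * of_real (\<zeta> $ i) * fourier (partials (replicate j i) f) \<zeta>"
      by (rule fourier_pderiv[OF smooth_on_partials[OF f] K(1)]) (rule partials_off_support[OF compact_imp_closed[OF K(1)] K(2)])
    then show ?case using Suc by (simp add: partials_Cons)
  qed simp
  have le: "\<bar>\<zeta> $ i\<bar> ^ k * norm (fourier f \<zeta>) \<le> B * measure lborel K" for i
  proof -
    have "norm (fourier (partials (replicate k i) f) \<zeta>) \<le> B * measure lborel K"
      by (rule norm_fourier_le[OF K(1)]) (use B partials_off_support[OF compact_imp_closed[OF K(1)] K(2)] in auto)
    then show ?thesis by (simp add: eq norm_mult norm_power)
  qed
  have le0: "1 ^ k * norm (fourier f \<zeta>) \<le> B * measure lborel K"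
    using norm_fourier_le[OF K, where B=B] B(1)[of "[]"] B(2) by simp
  define M where "M = Max (insert 1 (range (\<lambda>i. \<bar>\<zeta> $ i\<bar>)))"
  have M: "M \<in> insert 1 (range (\<lambda>i. \<bar>\<zeta> $ i\<bar>))" unfolding M_def by (rule Max_in) auto
  have M': "1 \<le> M" "\<bar>\<zeta> $ i\<bar> \<le> M" for i unfolding M_def by (intro Max_ge; simp)+
  have "1 + norm \<zeta> \<le> 1 + (\<Sum>i\<in>UNIV. \<bar>\<zeta> $ i\<bar>)" using norm_le_l1_cart[of \<zeta>] by simp
  also have "\<dots> \<le> M + (\<Sum>i\<in>(UNIV::'n set). M)" by (intro add_mono sum_mono M')
  also have "\<dots> = real (CARD('n) + 1) * M" by (simp add: algebra_simps)
  finally have "norm (fourier f \<zeta>) * (1 + norm \<zeta>) ^ k \<le> norm (fourier f \<zeta>) * (real (CARD('n) + 1) * M) ^ k"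
    by (intro mult_left_mono power_mono) auto
  also have "\<dots> = real (CARD('n) + 1) ^ k * (M ^ k * norm (fourier f \<zeta>))"
    by (simp add: power_mult_distrib)
  also have "\<dots> \<le> real (CARD('n) + 1) ^ k * (B * measure lborel K)"
    by (rule mult_left_mono) (use M le le0 in auto)
  finally show ?thesis by (simp add: mult_ac)
qed


section \<open>Fourier inversion and convolution\<close>

lemma lborel_integral_prod:
  fixes h :: "'a::euclidean_space \<Rightarrow> real \<Rightarrow> complex"
  assumes int: "\<And>b. b \<in> Basis \<Longrightarrow> integrable lborel (h b)"
  shows "integrable lborel (\<lambda>x. \<Prod>b\<in>Basis. h b (x \<bullet> b))"
    and "(LINT x|lborel. (\<Prod>b\<in>Basis. h b (x \<bullet> b))) = (\<Prod>b\<in>Basis. LINT t|lborel. h b t)"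
proof -
  interpret product_sigma_finite "\<lambda>_::'a. lborel :: real measure" by standard
  have [measurable]: "h b \<in> borel_measurable borel" if "b \<in> Basis" for b
    using int[OF that] by (simp add: borel_measurable_integrable)
  have m: "(\<lambda>x::'a. \<Prod>b\<in>Basis. h b (x \<bullet> b)) \<in> borel_measurable borel" by measurable
  have T: "(\<lambda>f. \<Sum>b\<in>Basis. f b *\<^sub>R b) \<in> (\<Pi>\<^sub>M b\<in>(Basis::'a set). lborel) \<rightarrow>\<^sub>M (borel :: 'a measure)" by measurable
  have eq: "(\<Prod>b\<in>Basis. h b ((\<Sum>b'\<in>Basis. f b' *\<^sub>R b') \<bullet> b)) = (\<Prod>b\<in>Basis. h b (f b))" for f
    by (rule prod.cong) simp_all
  show "integrable lborel (\<lambda>x. \<Prod>b\<in>Basis. h b (x \<bullet> b))"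
    by (subst lborel_eq, subst integrable_distr_eq[OF T m], unfold eq)
       (rule product_integrable_prod[OF finite_Basis int])
  show "(LINT x|lborel. (\<Prod>b\<in>Basis. h b (x \<bullet> b))) = (\<Prod>b\<in>Basis. LINT t|lborel. h b t)"
    by (subst lborel_eq, subst integral_distr[OF T m], unfold eq)
       (rule product_integral_prod[OF finite_Basis int])
qed

definition gauss :: "'a::euclidean_space \<Rightarrow> complex" where
  "gauss x = of_real (exp (- (norm x)\<^sup>2 / 2))"

text \<open>The characteristic function of the standard normal distribution.\<close>

lemma gauss_real_fourier:
  shows "integrable lborel (\<lambda>t::real. exp (- (\<i> * of_real (s * t))) * of_real (exp (- t\<^sup>2 / 2)))"
    and "(LINT t|lborel. exp (- (\<i> * of_real (s * t))) * of_real (exp (- t\<^sup>2 / 2)))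
      = of_real (sqrt (2 * pi)) * of_real (exp (- s\<^sup>2 / 2))"
proof -
  have dens: "std_normal_density t = exp (- t\<^sup>2 / 2) / sqrt (2 * pi)" for t
    by (simp add: std_normal_density_def)
  have eq: "exp (- (\<i> * of_real (s * t))) * of_real (exp (- t\<^sup>2 / 2))
      = of_real (sqrt (2 * pi)) * (std_normal_density t *\<^sub>R exp (\<i> * of_real ((- s) * t)))" for t
    by (simp add: dens scaleR_conv_of_real)
  have "integrable lborel std_normal_density" by simp
  then have "integrable lborel (\<lambda>t. std_normal_density t *\<^sub>R exp (\<i> * of_real ((- s) * t)))"
    by (rule Bochner_Integration.integrable_bound) (auto simp: normal_density_nonneg simp del: of_real_mult mult_minus_left of_real_minus)
  then show "integrable lborel (\<lambda>t::real. exp (- (\<i> * of_real (s * t))) * of_real (exp (- t\<^sup>2 / 2)))"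
    unfolding eq by (rule integrable_mult_right)
  have "char std_normal_distribution (- s) = (LINT t|lborel. std_normal_density t *\<^sub>R exp (\<i> * of_real ((- s) * t)))"
    unfolding char_def by (subst integral_density) (auto simp: normal_density_nonneg)
  then show "(LINT t|lborel. exp (- (\<i> * of_real (s * t))) * of_real (exp (- t\<^sup>2 / 2)))
      = of_real (sqrt (2 * pi)) * of_real (exp (- s\<^sup>2 / 2))"
    unfolding eq by (simp only: integral_mult_right_zero char_std_normal_distribution power2_minus)
qed

lemma prod_gauss: "(\<Prod>b\<in>Basis. of_real (exp (- (x \<bullet> b)\<^sup>2 / 2))) = gauss x"
proof -
  have "(\<Prod>b\<in>Basis. exp (- (x \<bullet> b)\<^sup>2 / 2)) = exp (\<Sum>b\<in>Basis. - (x \<bullet> b)\<^sup>2 / 2)"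
    by (simp add: exp_sum)
  also have "(\<Sum>b\<in>Basis. - (x \<bullet> b)\<^sup>2 / 2) = - (norm x)\<^sup>2 / 2"
    unfolding power2_norm_eq_inner euclidean_inner[of x x]
    by (simp add: sum_divide_distrib[symmetric] sum_negf power2_eq_square)
  finally show ?thesis by (simp add: gauss_def of_real_prod[symmetric] del: of_real_prod)
qed

lemma gauss_fourier:
  fixes y :: "'a::euclidean_space"
  shows "integrable lborel (\<lambda>\<zeta>. exp (- (\<i> * of_real (y \<bullet> \<zeta>))) * gauss \<zeta>)"
    and "(LINT \<zeta>|lborel. exp (- (\<i> * of_real (y \<bullet> \<zeta>))) * gauss \<zeta>) = of_real (sqrt (2 * pi) ^ DIM('a)) * gauss y"
proof -
  define h where "h b t = exp (- (\<i> * of_real ((y \<bullet> b) * t))) * of_real (exp (- t\<^sup>2 / 2))" for b t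
  have eq: "(\<Prod>b\<in>Basis. h b (\<zeta> \<bullet> b)) = exp (- (\<i> * of_real (y \<bullet> \<zeta>))) * gauss \<zeta>" for \<zeta>
  proof -
    have "(\<Prod>b\<in>Basis. exp (- (\<i> * of_real ((y \<bullet> b) * (\<zeta> \<bullet> b))))) = exp (\<Sum>b\<in>Basis. - (\<i> * of_real ((y \<bullet> b) * (\<zeta> \<bullet> b))))"
      by (simp add: exp_sum)
    also have "(\<Sum>b\<in>Basis. - (\<i> * of_real ((y \<bullet> b) * (\<zeta> \<bullet> b)))) = - (\<i> * of_real (y \<bullet> \<zeta>))"
      unfolding euclidean_inner[of y \<zeta>] by (simp add: sum_negf sum_distrib_left)
    finally show ?thesis unfolding h_def prod.distrib prod_gauss by simp
  qed
  have hi: "integrable lborel (h b)" for b unfolding h_def by (rule gauss_real_fourier(1))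
  show "integrable lborel (\<lambda>\<zeta>. exp (- (\<i> * of_real (y \<bullet> \<zeta>))) * gauss \<zeta>)"
    using lborel_integral_prod(1)[of h, OF hi] unfolding eq .
  have "(LINT \<zeta>|lborel. exp (- (\<i> * of_real (y \<bullet> \<zeta>))) * gauss \<zeta>) = (\<Prod>b\<in>Basis. LINT t|lborel. h b t)"
    using lborel_integral_prod(2)[of h, OF hi] unfolding eq .
  also have "\<dots> = (\<Prod>b\<in>Basis. of_real (sqrt (2 * pi)) * of_real (exp (- (y \<bullet> b)\<^sup>2 / 2)))"
    unfolding h_def gauss_real_fourier(2) ..
  also have "\<dots> = of_real (sqrt (2 * pi) ^ DIM('a)) * gauss y"
    unfolding prod.distrib prod_gauss by simp
  finally show "(LINT \<zeta>|lborel. exp (- (\<i> * of_real (y \<bullet> \<zeta>))) * gauss \<zeta>) = of_real (sqrt (2 * pi) ^ DIM('a)) * gauss y" .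
qed

lemma continuous_on_gauss: "continuous_on A gauss"
  unfolding gauss_def[abs_def] by (intro continuous_intros) auto

lemma borel_measurable_gauss [measurable]: "gauss \<in> borel_measurable borel"
  by (intro borel_measurable_continuous_onI continuous_on_gauss)

lemma integrable_gauss: "integrable lborel (gauss :: 'a::euclidean_space \<Rightarrow> complex)"
  using gauss_fourier(1)[of "0::'a"] by simp

lemma integral_gauss: "(LINT x|lborel. gauss (x::'a::euclidean_space)) = of_real (sqrt (2 * pi) ^ DIM('a))"
  using gauss_fourier(2)[of "0::'a"] by (simp add: gauss_def)

lemma integrable_lborel_pair_bound:
  fixes f :: "'a::euclidean_space \<Rightarrow> 'b::euclidean_space \<Rightarrow> complex"
  assumes m [measurable]: "case_prod f \<in> borel_measurable (lborel \<Otimes>\<^sub>M lborel)"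
    and a: "integrable lborel a" and b: "integrable lborel b"
    and le: "\<And>x y. norm (f x y) \<le> a x * b y"
  shows "integrable (lborel \<Otimes>\<^sub>M lborel) (case_prod f)"
proof (rule lborel_pair.Fubini_integrable[OF m])
  have fx: "integrable lborel (\<lambda>y. f x y)" for x
  proof (rule Bochner_Integration.integrable_bound)
    show "integrable lborel (\<lambda>y. a x * b y)" using b by simp
    show "AE y in lborel. norm (f x y) \<le> norm (a x * b y)"
      by (intro AE_I2 order_trans[OF le]) (simp only: real_norm_def abs_ge_self)
  qed measurable
  then show "AE x in lborel. integrable lborel (\<lambda>y. case_prod f (x, y))" by simp
  show "integrable lborel (\<lambda>x. LINT y|lborel. norm (case_prod f (x, y)))"
  proof (rule Bochner_Integration.integrable_bound)
    show "integrable lborel (\<lambda>x. a x * (LINT y|lborel. b y))" using a by simp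
    show "AE x in lborel. norm (LINT y|lborel. norm (case_prod f (x, y))) \<le> norm (a x * (LINT y|lborel. b y))"
    proof (intro AE_I2)
      fix x
      have "(LINT y|lborel. norm (f x y)) \<le> (LINT y|lborel. a x * b y)"
        by (rule integral_mono) (use fx b le in auto)
      then show "norm (LINT y|lborel. norm (case_prod f (x, y))) \<le> norm (a x * (LINT y|lborel. b y))"
        by simp
    qed
  qed measurable
qed

text \<open>The Gaussian factor makes the double integral over \<open>\<zeta>\<close> and \<open>y\<close> absolutely convergent.
  After exchanging the integrals, the inner one is the transform of a Gaussian, so that \<open>g\<close> is
  averaged over a Gaussian of width \<open>t\<close> around \<open>x\<close>.\<close>

lemma gauss_averaging:
  fixes g :: "real^'n::finite \<Rightarrow> complex"
  assumes gc: "continuous_on UNIV g" and K: "compact K" "\<And>x. x \<notin> K \<Longrightarrow> g x = 0" and t: "t > 0"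
  shows "(LINT \<zeta>|lborel. fourier g \<zeta> * exp (\<i> * of_real (\<zeta> \<bullet> x)) * gauss (t *\<^sub>R \<zeta>))
     = of_real (sqrt (2 * pi) ^ CARD('n)) * (LINT z|lborel. g (x + t *\<^sub>R z) * gauss z)"
proof -
  have [measurable]: "g \<in> borel_measurable borel" by (rule borel_measurable_continuous_onI[OF gc])
  have gi: "integrable lborel g" by (rule integrable_compact_support[OF K(1) gc K(2)])
  let ?n = "CARD('n)"
  let ?F = "\<lambda>\<zeta> y. g y * expi \<zeta> y * exp (\<i> * of_real (\<zeta> \<bullet> x)) * gauss (t *\<^sub>R \<zeta>)"
  have em [measurable]: "(\<lambda>(\<zeta>, y). expi \<zeta> y) \<in> borel_measurable (lborel \<Otimes>\<^sub>M (lborel :: (real^'n) measure))"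
    unfolding expi_def by simp
  have gt: "integrable lborel (\<lambda>\<zeta>::real^'n. norm (gauss (t *\<^sub>R \<zeta>)))"
  proof -
    have "integrable (distr lborel borel (\<lambda>x. 0 + t *\<^sub>R x)) (gauss :: real^'n \<Rightarrow> complex)"
    proof -
      have "integrable (density (distr lborel borel (\<lambda>x. 0 + t *\<^sub>R x)) (\<lambda>_. ennreal (t ^ DIM(real^'n)))) (gauss :: real^'n \<Rightarrow> complex)"
        using lborel_affine[of t "0::real^'n"] t integrable_gauss by (simp add: ennreal_power)
      then have "integrable (distr lborel borel (\<lambda>x. 0 + t *\<^sub>R x)) (\<lambda>x. t ^ DIM(real^'n) *\<^sub>R gauss (x :: real^'n))"
        by (subst (asm) integrable_density) (use t in auto)
      from integrable_scaleR_right[OF this, of "1 / t ^ DIM(real^'n)"] show ?thesis using t by simp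
    qed
    then show ?thesis by (subst (asm) integrable_distr_eq) auto
  qed
  have eone: "norm (exp (\<i> * of_real s)) = 1" for s by simp
  have int: "integrable (lborel \<Otimes>\<^sub>M lborel) (case_prod ?F)"
  proof (rule integrable_lborel_pair_bound[OF _ gt integrable_norm[OF gi]])
    show "norm (?F \<zeta> y) \<le> norm (gauss (t *\<^sub>R \<zeta>)) * norm (g y)" for \<zeta> y
      by (simp add: norm_mult)
  qed measurable
  have "(LINT \<zeta>|lborel. fourier g \<zeta> * exp (\<i> * of_real (\<zeta> \<bullet> x)) * gauss (t *\<^sub>R \<zeta>)) = (LINT \<zeta>|lborel. LINT y|lborel. ?F \<zeta> y)"
    by (simp add: fourier_eq)
  also have "\<dots> = (LINT y|lborel. LINT \<zeta>|lborel. ?F \<zeta> y)"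
    by (rule lborel_pair.Fubini_integral[OF int, symmetric])
  also have "\<dots> = (LINT y|lborel. g y * of_real (sqrt (2 * pi) ^ ?n / t ^ ?n) * gauss ((1 / t) *\<^sub>R (y - x)))"
  proof (rule Bochner_Integration.integral_cong[OF refl])
    fix y
    define v where "v = (1 / t) *\<^sub>R (y - x)"
    have "(LINT \<zeta>|lborel. ?F \<zeta> y) = (LINT \<zeta>|lborel. g y * (exp (- (\<i> * of_real (v \<bullet> (t *\<^sub>R \<zeta>)))) * gauss (t *\<^sub>R \<zeta>)))"
      by (rule Bochner_Integration.integral_cong[OF refl])
         (use t in \<open>simp add: v_def expi_def exp_add[symmetric] algebra_simps inner_commute\<close>)
    also have "\<dots> = g y * (LINT \<zeta>|lborel. exp (- (\<i> * of_real (v \<bullet> (t *\<^sub>R \<zeta>)))) * gauss (t *\<^sub>R \<zeta>))"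
      by simp
    also have "(LINT \<zeta>|lborel. exp (- (\<i> * of_real (v \<bullet> (t *\<^sub>R \<zeta>)))) * gauss (t *\<^sub>R \<zeta>))
        = of_real (1 / t ^ ?n) * (LINT \<zeta>|lborel. exp (- (\<i> * of_real (v \<bullet> \<zeta>))) * gauss \<zeta>)"
      using lborel_integral_affine[of "\<lambda>\<zeta>. exp (- (\<i> * of_real (v \<bullet> \<zeta>))) * gauss \<zeta>" t 0] t by simp
    also have "(LINT \<zeta>|lborel. exp (- (\<i> * of_real (v \<bullet> \<zeta>))) * gauss \<zeta>) = of_real (sqrt (2 * pi) ^ ?n) * gauss v"
      using gauss_fourier(2)[of v] by simp
    finally show "(LINT \<zeta>|lborel. ?F \<zeta> y) = g y * of_real (sqrt (2 * pi) ^ ?n / t ^ ?n) * gauss ((1 / t) *\<^sub>R (y - x))"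
      by (simp add: v_def)
  qed
  also have "\<dots> = of_real (t ^ ?n) * (LINT z|lborel. g (x + t *\<^sub>R z) * of_real (sqrt (2 * pi) ^ ?n / t ^ ?n) * gauss z)"
    by (subst lborel_integral_affine[of _ t x]) (use t in simp_all)
  also have "\<dots> = of_real (sqrt (2 * pi) ^ ?n) * (LINT z|lborel. g (x + t *\<^sub>R z) * gauss z)"
    using t by (simp add: mult.commute[of "g _"] mult.assoc)
  finally show ?thesis .
qed

lemma fourier_borel_measurable [measurable]:
  assumes [measurable]: "g \<in> borel_measurable borel"
  shows "fourier g \<in> borel_measurable borel"
proof -
  have [measurable]: "(\<lambda>(\<zeta>, y). expi \<zeta> y) \<in> borel_measurable (lborel \<Otimes>\<^sub>M (lborel :: (real^'a) measure))"
    unfolding expi_def by simp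
  have "(\<lambda>\<zeta>. LINT x|lborel. g x * expi \<zeta> x) \<in> borel_measurable lborel" by measurable
  then show ?thesis by (simp add: fourier_eq[abs_def])
qed

text \<open>Both sides of \<open>gauss_averaging\<close> converge as \<open>t\<close> tends to zero, the left one by the
  integrability of the transform, the right one by the continuity of \<open>g\<close>.\<close>

theorem fourier_inversion:
  fixes g :: "real^'n::finite \<Rightarrow> complex"
  assumes gc: "continuous_on UNIV g" and K: "compact K" "\<And>x. x \<notin> K \<Longrightarrow> g x = 0"
    and int: "integrable lborel (fourier g)"
  shows "(LINT \<zeta>|lborel. fourier g \<zeta> * exp (\<i> * of_real (\<zeta> \<bullet> x))) = of_real ((2 * pi) ^ CARD('n)) * g x"
proof -
  have [measurable]: "g \<in> borel_measurable borel" by (rule borel_measurable_continuous_onI[OF gc])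
  define t where "t k = 1 / real (Suc k)" for k
  have t: "t k > 0" for k by (simp add: t_def)
  have t0: "t \<longlonglongrightarrow> 0" unfolding t_def[abs_def] using LIMSEQ_Suc[OF lim_1_over_n] by simp
  let ?c = "complex_of_real (sqrt (2 * pi) ^ CARD('n))"
  have L: "(\<lambda>k. LINT \<zeta>|lborel. fourier g \<zeta> * exp (\<i> * of_real (\<zeta> \<bullet> x)) * gauss (t k *\<^sub>R \<zeta>))
      \<longlonglongrightarrow> (LINT \<zeta>|lborel. fourier g \<zeta> * exp (\<i> * of_real (\<zeta> \<bullet> x)))"
  proof (rule integral_dominated_convergence[OF _ _ integrable_norm[OF int]])
    show "AE \<zeta> in lborel. (\<lambda>k. fourier g \<zeta> * exp (\<i> * of_real (\<zeta> \<bullet> x)) * gauss (t k *\<^sub>R \<zeta>))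
        \<longlonglongrightarrow> fourier g \<zeta> * exp (\<i> * of_real (\<zeta> \<bullet> x))"
    proof (intro AE_I2)
      fix \<zeta> :: "real^'n"
      have "(\<lambda>k. gauss (t k *\<^sub>R \<zeta>)) \<longlonglongrightarrow> gauss (0 *\<^sub>R \<zeta>)"
        unfolding gauss_def by (intro tendsto_intros t0) auto
      then have "(\<lambda>k. fourier g \<zeta> * exp (\<i> * of_real (\<zeta> \<bullet> x)) * gauss (t k *\<^sub>R \<zeta>))
        \<longlonglongrightarrow> fourier g \<zeta> * exp (\<i> * of_real (\<zeta> \<bullet> x)) * gauss (0 *\<^sub>R \<zeta>)"
        by (intro tendsto_intros)
      then show "(\<lambda>k. fourier g \<zeta> * exp (\<i> * of_real (\<zeta> \<bullet> x)) * gauss (t k *\<^sub>R \<zeta>))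
        \<longlonglongrightarrow> fourier g \<zeta> * exp (\<i> * of_real (\<zeta> \<bullet> x))"
        by (simp add: gauss_def)
    qed
    show "AE \<zeta> in lborel. norm (fourier g \<zeta> * exp (\<i> * of_real (\<zeta> \<bullet> x)) * gauss (t k *\<^sub>R \<zeta>)) \<le> norm (fourier g \<zeta>)" for k
      by (intro AE_I2) (simp add: norm_mult gauss_def mult_left_le)
  qed measurable
  obtain B where B: "\<And>x. norm (g x) \<le> B"
  proof -
    have "bounded (g ` K)"
      by (intro compact_imp_bounded compact_continuous_image K(1) continuous_on_subset[OF gc]) auto
    then obtain B where "\<And>x. x \<in> K \<Longrightarrow> norm (g x) \<le> B" by (auto simp: bounded_iff)
    then have "norm (g x) \<le> max B 0" for x by (cases "x \<in> K") (auto simp: K(2) le_max_iff_disj)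
    then show thesis by (rule that)
  qed
  have R: "(\<lambda>k. ?c * (LINT z|lborel. g (x + t k *\<^sub>R z) * gauss z)) \<longlonglongrightarrow> ?c * (LINT z|lborel. g x * gauss (z::real^'n))"
  proof (intro tendsto_intros integral_dominated_convergence[where w = "\<lambda>z. B * norm (gauss z)"])
    show "integrable lborel (\<lambda>z::real^'n. B * norm (gauss z))" using integrable_norm[OF integrable_gauss[where 'a="real^'n"]] by simp
    show "AE z in lborel. (\<lambda>k. g (x + t k *\<^sub>R z) * gauss z) \<longlonglongrightarrow> g x * gauss z"
    proof (intro AE_I2)
      fix z :: "real^'n"
      have "(\<lambda>k. x + t k *\<^sub>R z) \<longlonglongrightarrow> x + 0 *\<^sub>R z" by (intro tendsto_intros t0)
      then have "(\<lambda>k. g (x + t k *\<^sub>R z)) \<longlonglongrightarrow> g x"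
        using continuous_on_tendsto_compose[OF gc, of "\<lambda>k. x + t k *\<^sub>R z" x sequentially] by simp
      then show "(\<lambda>k. g (x + t k *\<^sub>R z) * gauss z) \<longlonglongrightarrow> g x * gauss z" by (intro tendsto_intros)
    qed
    show "AE z in lborel. norm (g (x + t k *\<^sub>R z) * gauss z) \<le> B * norm (gauss z)" for k
      by (intro AE_I2) (simp add: norm_mult mult_right_mono B)
  qed measurable
  have "(LINT \<zeta>|lborel. fourier g \<zeta> * exp (\<i> * of_real (\<zeta> \<bullet> x))) = ?c * (LINT z|lborel. g x * gauss (z::real^'n))"
  proof (rule LIMSEQ_unique[OF L])
    have eq: "(LINT \<zeta>|lborel. fourier g \<zeta> * exp (\<i> * of_real (\<zeta> \<bullet> x)) * gauss (t k *\<^sub>R \<zeta>))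
        = ?c * (LINT z|lborel. g (x + t k *\<^sub>R z) * gauss z)" for k
      by (rule gauss_averaging[OF gc K(1) _ t]) (rule K(2))
    show "(\<lambda>k. LINT \<zeta>|lborel. fourier g \<zeta> * exp (\<i> * of_real (\<zeta> \<bullet> x)) * gauss (t k *\<^sub>R \<zeta>))
        \<longlonglongrightarrow> ?c * (LINT z|lborel. g x * gauss (z::real^'n))"
      unfolding eq by (rule R)
  qed
  also have "\<dots> = (?c * ?c) * g x"
    by (simp add: integral_gauss)
  also have "?c * ?c = of_real ((2 * pi) ^ CARD('n))"
    by (simp only: of_real_mult[symmetric] power_mult_distrib[symmetric]) simp
  finally show ?thesis .
qed

text \<open>The inversion formula for \<open>g\<close> is inserted into the transform of the product, and the integrals
  are exchanged.\<close>

theorem fourier_product: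
  fixes g h :: "real^'n::finite \<Rightarrow> complex"
  assumes gc: "continuous_on UNIV g" and K: "compact K" "\<And>x. x \<notin> K \<Longrightarrow> g x = 0"
    and int: "integrable lborel (fourier g)" and h: "integrable lborel h"
  shows "of_real ((2 * pi) ^ CARD('n)) * fourier (\<lambda>x. g x * h x) \<xi> = (LINT \<zeta>|lborel. fourier g \<zeta> * fourier h (\<xi> - \<zeta>))"
proof -
  have [measurable]: "g \<in> borel_measurable borel" by (rule borel_measurable_continuous_onI[OF gc])
  have [measurable]: "h \<in> borel_measurable borel" using h by (simp add: borel_measurable_integrable)
  let ?F = "\<lambda>\<zeta> x. fourier g \<zeta> * (h x * expi (\<xi> - \<zeta>) x)"
  have em [measurable]: "(\<lambda>(\<zeta>, y). expi (\<xi> - \<zeta>) y) \<in> borel_measurable (lborel \<Otimes>\<^sub>M (lborel :: (real^'n) measure))"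
    unfolding expi_def by simp
  have F: "integrable (lborel \<Otimes>\<^sub>M lborel) (case_prod ?F)"
    by (rule integrable_lborel_pair_bound[OF _ integrable_norm[OF int] integrable_norm[OF h]])
       (measurable, simp add: norm_mult)
  have "(LINT \<zeta>|lborel. fourier g \<zeta> * fourier h (\<xi> - \<zeta>)) = (LINT \<zeta>|lborel. LINT x|lborel. ?F \<zeta> x)"
    by (simp add: fourier_eq)
  also have "\<dots> = (LINT x|lborel. LINT \<zeta>|lborel. ?F \<zeta> x)"
    by (rule lborel_pair.Fubini_integral[OF F, symmetric])
  also have "\<dots> = (LINT x|lborel. of_real ((2 * pi) ^ CARD('n)) * (g x * h x * expi \<xi> x))"
  proof (rule Bochner_Integration.integral_cong[OF refl])
    fix x :: "real^'n"
    have e: "expi (\<xi> - \<zeta>) x = expi \<xi> x * exp (\<i> * of_real (\<zeta> \<bullet> x))" for \<zeta>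
      by (simp add: expi_def exp_add[symmetric] algebra_simps)
    have "(LINT \<zeta>|lborel. ?F \<zeta> x) = (LINT \<zeta>|lborel. (h x * expi \<xi> x) * (fourier g \<zeta> * exp (\<i> * of_real (\<zeta> \<bullet> x))))"
      unfolding e by (simp add: mult_ac)
    also have "\<dots> = (h x * expi \<xi> x) * (of_real ((2 * pi) ^ CARD('n)) * g x)"
      by (simp add: fourier_inversion[OF gc K int])
    finally show "(LINT \<zeta>|lborel. ?F \<zeta> x) = of_real ((2 * pi) ^ CARD('n)) * (g x * h x * expi \<xi> x)"
      by (simp add: mult_ac)
  qed
  finally show ?thesis by (simp add: fourier_eq)
qed


section \<open>Decay of the transform of a product\<close>

text \<open>The power \<open>(1 + |\<zeta>|)^{2n}\<close> dominates the product of the \<open>1 + \<zeta>_i\<^sup>2\<close>, whose reciprocal is a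
  product of integrable functions of one variable.\<close>

lemma integrable_decay_weight:
  "integrable lborel (\<lambda>\<zeta>::real^'n::finite. 1 / (1 + norm \<zeta>) ^ (2 * CARD('n)))"
proof -
  have "set_integrable lborel UNIV (\<lambda>x::real. inverse (1 + x\<^sup>2))"
    using integrable_inverse_1_plus_square by (simp add: einterval_eq_UNIV)
  then have "integrable lborel (\<lambda>x::real. inverse (1 + x\<^sup>2))"
    by (simp add: set_integrable_def)
  then have "integrable lborel (\<lambda>x::real. complex_of_real (inverse (1 + x\<^sup>2)))"
    by (rule integrable_of_real)
  then have int: "integrable lborel (\<lambda>\<zeta>::real^'n. \<Prod>b\<in>Basis. complex_of_real (inverse (1 + (\<zeta> \<bullet> b)\<^sup>2)))"
    by (rule lborel_integral_prod(1))
  show ?thesis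
  proof (rule Bochner_Integration.integrable_bound[OF int])
    show "AE \<zeta>::real^'n in lborel. norm (1 / (1 + norm \<zeta>) ^ (2 * CARD('n)))
       \<le> norm (\<Prod>b\<in>Basis. complex_of_real (inverse (1 + (\<zeta> \<bullet> b)\<^sup>2)))"
    proof (intro AE_I2)
      fix \<zeta> :: "real^'n"
      have "(\<Prod>b\<in>Basis. 1 + (\<zeta> \<bullet> b)\<^sup>2) \<le> (\<Prod>b\<in>(Basis :: (real^'n) set). (1 + norm \<zeta>)\<^sup>2)"
      proof (rule prod_mono)
        fix b :: "real^'n" assume "b \<in> Basis"
        then have "(\<zeta> \<bullet> b)\<^sup>2 \<le> (norm \<zeta>)\<^sup>2"
          using Basis_le_norm[of b \<zeta>] by (simp add: abs_le_square_iff[symmetric])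
        then show "0 \<le> 1 + (\<zeta> \<bullet> b)\<^sup>2 \<and> 1 + (\<zeta> \<bullet> b)\<^sup>2 \<le> (1 + norm \<zeta>)\<^sup>2"
          using norm_ge_zero[of \<zeta>] by (simp add: power2_sum add_increasing2)
      qed
      also have "\<dots> = (1 + norm \<zeta>) ^ (2 * CARD('n))" by (simp add: power_mult)
      finally have le: "(\<Prod>b\<in>Basis. 1 + (\<zeta> \<bullet> b)\<^sup>2) \<le> (1 + norm \<zeta>) ^ (2 * CARD('n))" .
      have pos: "(\<Prod>b\<in>Basis. 1 + (\<zeta> \<bullet> b)\<^sup>2) > 0" by (rule prod_pos) (simp add: add_pos_nonneg)
      have "norm (\<Prod>b\<in>Basis. complex_of_real (inverse (1 + (\<zeta> \<bullet> b)\<^sup>2))) = inverse (\<Prod>b\<in>Basis. 1 + (\<zeta> \<bullet> b)\<^sup>2)"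
        using pos prod_inversef[of "\<lambda>b. 1 + (\<zeta> \<bullet> b)\<^sup>2" Basis]
        by (simp add: of_real_prod[symmetric] o_def del: of_real_prod of_real_inverse of_real_add)
      then show "norm (1 / (1 + norm \<zeta>) ^ (2 * CARD('n)))
         \<le> norm (\<Prod>b\<in>Basis. complex_of_real (inverse (1 + (\<zeta> \<bullet> b)\<^sup>2)))"
        using le pos by (simp add: inverse_eq_divide frac_le)
    qed
  qed measurable
qed

text \<open>The quantitative form of microlocalisation.  In the convolution of the two transforms at
  \<open>\<xi>\<close>, frequencies \<open>\<zeta>\<close> with \<open>|\<zeta>| \<ge> c|\<xi>|\<close> are paid for by the smoothness of \<open>g\<close>; for the
  others \<open>\<xi> - \<zeta>\<close> lies in the cone and is at least half as long as \<open>\<xi>\<close>, so the decay of the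
  transform of \<open>h\<close> applies.\<close>

theorem fourier_product_decay:
  fixes g h :: "real^'n::finite \<Rightarrow> complex"
  defines "I \<equiv> (LINT \<zeta>|lborel. 1 / (1 + norm (\<zeta> :: real^'n)) ^ (2 * CARD('n)))"
  assumes gc: "continuous_on UNIV g" and K: "compact K" "\<And>x. x \<notin> K \<Longrightarrow> g x = 0" and h: "integrable lborel h"
    and G0: "\<And>\<zeta>. norm (fourier g \<zeta>) * (1 + norm \<zeta>) ^ (2 * CARD('n)) \<le> G0"
    and Gk: "\<And>\<zeta>. norm (fourier g \<zeta>) * (1 + norm \<zeta>) ^ (k + 2 * CARD('n)) \<le> Gk"
    and B: "\<And>\<eta>. norm (fourier h \<eta>) \<le> B"
    and A: "\<And>\<eta>. \<eta> \<in> \<Gamma> \<Longrightarrow> norm (fourier h \<eta>) * (1 + norm \<eta>) ^ l \<le> A" "A \<ge> 0"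
    and c: "0 < c" "c \<le> 1 / 2" "\<And>\<eta>. \<eta> \<notin> \<Gamma> \<Longrightarrow> c * norm \<xi> \<le> norm (\<xi> - \<eta>)"
  shows "norm (fourier (\<lambda>x. g x * h x) \<xi>)
     \<le> I * (Gk * B / (c * (1 + norm \<xi>)) ^ k + G0 * (A * 2 ^ l / (1 + norm \<xi>) ^ l))"
proof -
  define w :: "real^'n \<Rightarrow> real" where "w \<zeta> = 1 / (1 + norm \<zeta>) ^ (2 * CARD('n))" for \<zeta>
  have Iw: "I = (LINT \<zeta>|lborel. w \<zeta>)" by (simp add: I_def w_def)
  have w: "w \<zeta> > 0" for \<zeta> by (simp add: w_def add_pos_nonneg)
  have wint: "integrable lborel w" unfolding w_def by (rule integrable_decay_weight)
  have pos: "1 + norm \<zeta> > 0" for \<zeta> :: "real^'n" by (simp add: add_pos_nonneg)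
  have [measurable]: "g \<in> borel_measurable borel" by (rule borel_measurable_continuous_onI[OF gc])
  have g0: "norm (fourier g \<zeta>) \<le> G0 * w \<zeta>" for \<zeta>
    using G0[of \<zeta>] pos[of \<zeta>] by (simp add: w_def pos_le_divide_eq)
  have gk: "norm (fourier g \<zeta>) \<le> Gk * w \<zeta> / (1 + norm \<zeta>) ^ k" for \<zeta>
    using Gk[of \<zeta>] pos[of \<zeta>] by (simp add: w_def pos_le_divide_eq power_add mult_ac)
  have "0 \<le> G0" "0 \<le> Gk" using G0[of 0] Gk[of 0] order_trans[OF norm_ge_zero[of "fourier g 0"]] by simp_all
  have "0 \<le> B" using B[of 0] norm_ge_zero[of "fourier h 0"] by linarith
  have int: "integrable lborel (fourier g)"
  proof (rule Bochner_Integration.integrable_bound)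
    show "integrable lborel (\<lambda>\<zeta>. G0 * w \<zeta>)" using wint by simp
    show "AE \<zeta> in lborel. norm (fourier g \<zeta>) \<le> norm (G0 * w \<zeta>)"
      by (intro AE_I2 order_trans[OF g0]) simp
  qed measurable
  define E where "E = Gk * B / (c * (1 + norm \<xi>)) ^ k + G0 * (A * 2 ^ l / (1 + norm \<xi>) ^ l)"
  have E1: "0 \<le> Gk * B / (c * (1 + norm \<xi>)) ^ k" and E2: "0 \<le> G0 * (A * 2 ^ l / (1 + norm \<xi>) ^ l)"
    using \<open>0 \<le> G0\<close> \<open>0 \<le> Gk\<close> \<open>0 \<le> B\<close> A(2) c(1) pos[of \<xi>] by simp_all
  have le: "norm (fourier g \<zeta> * fourier h (\<xi> - \<zeta>)) \<le> E * w \<zeta>" for \<zeta>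
  proof (cases "c * norm \<xi> \<le> norm \<zeta>")
    case True
    have "c * (1 + norm \<xi>) \<le> 1 + norm \<zeta>" using True c(2) by (simp add: distrib_left)
    then have "(c * (1 + norm \<xi>)) ^ k \<le> (1 + norm \<zeta>) ^ k"
      using c(1) pos[of \<xi>] by (intro power_mono) auto
    then have "Gk * w \<zeta> / (1 + norm \<zeta>) ^ k \<le> Gk * w \<zeta> / (c * (1 + norm \<xi>)) ^ k"
      using \<open>0 \<le> Gk\<close> w[of \<zeta>] c(1) pos by (intro divide_left_mono mult_nonneg_nonneg mult_pos_pos zero_less_power) auto
    then have "norm (fourier g \<zeta>) \<le> Gk * w \<zeta> / (c * (1 + norm \<xi>)) ^ k" using gk[of \<zeta>] by linarith
    then have "norm (fourier g \<zeta>) * norm (fourier h (\<xi> - \<zeta>)) \<le> (Gk * w \<zeta> / (c * (1 + norm \<xi>)) ^ k) * B"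
      by (intro mult_mono B order_trans[OF norm_ge_zero]) auto
    also have "\<dots> = (Gk * B / (c * (1 + norm \<xi>)) ^ k) * w \<zeta>" by simp
    also have "\<dots> \<le> E * w \<zeta>" unfolding E_def using E2 w[of \<zeta>] by (intro mult_right_mono) auto
    finally show ?thesis by (simp add: norm_mult)
  next
    case False
    then have "\<xi> - \<zeta> \<in> \<Gamma>" using c(3)[of "\<xi> - \<zeta>"] by auto
    have "norm \<xi> \<le> norm (\<xi> - \<zeta>) + norm \<zeta>" using norm_triangle_sub[of \<xi> \<zeta>] by (simp add: add.commute)
    moreover have "norm \<zeta> \<le> norm \<xi> / 2"
      using False mult_right_mono[OF c(2) norm_ge_zero[of \<xi>]] by simp
    ultimately have "(1 + norm \<xi>) / 2 \<le> 1 + norm (\<xi> - \<zeta>)" by simp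
    then have p: "((1 + norm \<xi>) / 2) ^ l \<le> (1 + norm (\<xi> - \<zeta>)) ^ l"
      using pos[of \<xi>] by (intro power_mono) auto
    have "norm (fourier h (\<xi> - \<zeta>)) * ((1 + norm \<xi>) / 2) ^ l \<le> norm (fourier h (\<xi> - \<zeta>)) * (1 + norm (\<xi> - \<zeta>)) ^ l"
      by (rule mult_left_mono[OF p]) simp
    also have "\<dots> \<le> A" by (rule A(1)[OF \<open>\<xi> - \<zeta> \<in> \<Gamma>\<close>])
    finally have "norm (fourier h (\<xi> - \<zeta>)) \<le> A * 2 ^ l / (1 + norm \<xi>) ^ l"
      using pos[of \<xi>] by (simp add: power_divide pos_le_divide_eq pos_divide_le_eq)
    then have "norm (fourier g \<zeta>) * norm (fourier h (\<xi> - \<zeta>)) \<le> (G0 * w \<zeta>) * (A * 2 ^ l / (1 + norm \<xi>) ^ l)"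
      using \<open>0 \<le> G0\<close> w[of \<zeta>] by (intro mult_mono g0) auto
    also have "\<dots> = (G0 * (A * 2 ^ l / (1 + norm \<xi>) ^ l)) * w \<zeta>" by simp
    also have "\<dots> \<le> E * w \<zeta>" unfolding E_def using E1 w[of \<zeta>] by (intro mult_right_mono) auto
    finally show ?thesis by (simp add: norm_mult)
  qed
  have "norm (LINT \<zeta>|lborel. fourier g \<zeta> * fourier h (\<xi> - \<zeta>)) \<le> (LINT \<zeta>|lborel. E * w \<zeta>)"
  proof (cases "integrable lborel (\<lambda>\<zeta>. fourier g \<zeta> * fourier h (\<xi> - \<zeta>))")
    case True
    have "integrable lborel (\<lambda>\<zeta>. E * w \<zeta>)" using wint by simp
    then show ?thesis by (rule Bochner_Integration.integral_norm_bound_integral[OF True]) (rule le)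
  next
    case False
    have "0 \<le> (LINT \<zeta>|lborel. E * w \<zeta>)"
      using E1 E2 w by (intro Bochner_Integration.integral_nonneg mult_nonneg_nonneg) (auto simp: E_def less_imp_le)
    then show ?thesis using False by (simp add: not_integrable_integral_eq)
  qed
  also have "\<dots> = I * E" unfolding Iw by (subst integral_mult_right_zero) (simp add: mult.commute)
  also have "(LINT \<zeta>|lborel. fourier g \<zeta> * fourier h (\<xi> - \<zeta>)) = of_real ((2 * pi) ^ CARD('n)) * fourier (\<lambda>x. g x * h x) \<xi>"
    by (rule fourier_product[OF gc K(1) _ int h, symmetric]) (rule K(2))
  finally have le1: "(2 * pi) ^ CARD('n) * norm (fourier (\<lambda>x. g x * h x) \<xi>) \<le> I * E"
    by (simp add: norm_mult norm_power)
  have "1 \<le> (2 * pi) ^ CARD('n)" using pi_ge_two by (intro one_le_power) simp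
  then have "1 * norm (fourier (\<lambda>x. g x * h x) \<xi>) \<le> (2 * pi) ^ CARD('n) * norm (fourier (\<lambda>x. g x * h x) \<xi>)"
    by (intro mult_right_mono) auto
  with le1 show ?thesis by (simp add: E_def)
qed

section \<open>Polynomials and binomial coefficients\<close>

lemma smooth_on_coordinate: "open V \<Longrightarrow> smooth_on V (\<lambda>x. of_real (x $ i))"
proof -
  assume V: "open V"
  have "Ck k V (\<lambda>x. of_real (x $ i))" for k
  proof (cases k)
    case (Suc k')
    have hp: "has_partial (\<lambda>x. of_real (x $ i)) j (of_real (axis j 1 $ i)) x" for x j
    proof (rule has_vector_derivative_of_real)
      show "((\<lambda>t. (x + t *\<^sub>R axis j 1) $ i) has_real_derivative axis j 1 $ i) (at 0)"
        unfolding vector_add_component vector_scaleR_component by (auto intro!: derivative_eq_intros)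
    qed
    show ?thesis unfolding Suc
      by (rule Ck_SucI[OF V _ hp]) (auto intro!: continuous_intros Ck_const V)
  qed (auto intro!: continuous_intros)
  then show ?thesis by (simp add: smooth_on_iff_Ck)
qed

lemma smooth_on_prod:
  "open V \<Longrightarrow> (\<And>a. a \<in> S \<Longrightarrow> smooth_on V (f a)) \<Longrightarrow> smooth_on V (\<lambda>x. \<Prod>a\<in>S. f a x)"
  by (induction S rule: infinite_finite_induct) (auto intro: smooth_on_const smooth_on_mult)

lemma smooth_on_power: "open V \<Longrightarrow> smooth_on V f \<Longrightarrow> smooth_on V (\<lambda>x. f x ^ k)"
  by (induction k) (auto intro: smooth_on_const smooth_on_mult)

lemma smooth_on_mpower: "open V \<Longrightarrow> smooth_on V (\<lambda>x. of_real (mpower x \<alpha>))"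
  unfolding mpower_def of_real_prod of_real_power
  by (intro smooth_on_prod smooth_on_power smooth_on_coordinate)

lemma finite_mi_len: "finite {\<alpha> :: 'n::finite multi_index. mi_len \<alpha> \<le> m}"
proof (rule finite_subset)
  show "{\<alpha> :: 'n multi_index. mi_len \<alpha> \<le> m} \<subseteq> (\<Pi>\<^sub>E i\<in>UNIV. {..m})"
  proof
    fix \<alpha> :: "'n multi_index" assume "\<alpha> \<in> {\<alpha>. mi_len \<alpha> \<le> m}"
    then have "\<alpha> i \<le> m" for i
      using member_le_sum[of i UNIV \<alpha>] by (simp add: mi_len_def)
    then show "\<alpha> \<in> (\<Pi>\<^sub>E i\<in>UNIV. {..m})" by auto
  qed
  show "finite (\<Pi>\<^sub>E i\<in>(UNIV::'n set). {..m})" by (intro finite_PiE) auto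
qed

definition mfact :: "'n::finite multi_index \<Rightarrow> real" where
  "mfact \<gamma> = (\<Prod>i\<in>UNIV. fact (\<gamma> i))"

text \<open>The coefficient of \<open>\<eta>\<^sup>\<gamma>\<close> in \<open>(\<xi> + \<eta>)\<^sup>\<alpha>\<close>; it equals \<open>\<partial>\<^sup>\<gamma>(\<xi>\<^sup>\<alpha>) / \<gamma>!\<close>.\<close>

definition mbinom :: "'n::finite multi_index \<Rightarrow> 'n multi_index \<Rightarrow> real ^ 'n \<Rightarrow> real" where
  "mbinom \<alpha> \<gamma> \<xi> = (\<Prod>i\<in>UNIV. of_nat (\<alpha> i choose \<gamma> i) * (\<xi> $ i) ^ (\<alpha> i - \<gamma> i))"

lemma mfact_pos: "mfact \<gamma> > 0"
  unfolding mfact_def by (rule prod_pos) simp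

lemma mfact_zero: "mfact (\<lambda>i. 0) = 1"
  by (simp add: mfact_def)

lemma mbinom_eq_0:
  assumes "mi_len \<alpha> < mi_len \<gamma>"
  shows "mbinom \<alpha> \<gamma> \<xi> = 0"
proof -
  have "\<exists>i. \<alpha> i < \<gamma> i"
    using assms sum_mono[of UNIV \<gamma> \<alpha>] unfolding mi_len_def by (metis leD leI)
  then show ?thesis unfolding mbinom_def by (auto intro!: prod_zero binomial_eq_0)
qed

lemma prod_fun_upd:
  fixes g :: "'n::finite \<Rightarrow> 'c \<Rightarrow> 'b::comm_monoid_mult"
  shows "(\<Prod>j\<in>UNIV. g j ((f(i := v)) j)) = g i v * (\<Prod>j\<in>UNIV - {i}. g j (f j))"
proof -
  have "(\<Prod>j\<in>UNIV. g j ((f(i := v)) j)) = g i ((f(i := v)) i) * (\<Prod>j\<in>UNIV - {i}. g j ((f(i := v)) j))"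
    by (rule prod.remove) auto
  also have "(\<Prod>j\<in>UNIV - {i}. g j ((f(i := v)) j)) = (\<Prod>j\<in>UNIV - {i}. g j (f j))"
    by (rule prod.cong) auto
  finally show ?thesis by simp
qed

lemma mi_len_Suc: "mi_len (\<gamma>(i := Suc (\<gamma> i))) = Suc (mi_len \<gamma>)"
proof -
  have "mi_len (\<gamma>(i := Suc (\<gamma> i))) = Suc (\<gamma> i) + (\<Sum>j\<in>UNIV - {i}. (\<gamma>(i := Suc (\<gamma> i))) j)"
    unfolding mi_len_def by (subst sum.remove[of _ i]) auto
  also have "(\<Sum>j\<in>UNIV - {i}. (\<gamma>(i := Suc (\<gamma> i))) j) = (\<Sum>j\<in>UNIV - {i}. \<gamma> j)"
    by (rule sum.cong) auto
  also have "Suc (\<gamma> i) + (\<Sum>j\<in>UNIV - {i}. \<gamma> j) = Suc (mi_len \<gamma>)"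
    unfolding mi_len_def by (subst (2) sum.remove[of _ i]) auto
  finally show ?thesis .
qed

text \<open>Pascal's rule: \<open>(\<xi> + \<eta>)^{\<alpha> + e_i} = (\<xi>_i + \<eta>_i) (\<xi> + \<eta>)^\<alpha>\<close>.\<close>

lemma mbinom_Suc:
  "mbinom (\<alpha>(i := Suc (\<alpha> i))) \<gamma> \<xi>
     = \<xi> $ i * mbinom \<alpha> \<gamma> \<xi> + (if \<gamma> i = 0 then 0 else mbinom \<alpha> (\<gamma>(i := \<gamma> i - 1)) \<xi>)"
proof -
  let ?g = "\<lambda>a j c. of_nat (a choose c) * (\<xi> $ j) ^ (a - c)"
  let ?R = "\<Prod>j\<in>UNIV - {i}. ?g (\<alpha> j) j (\<gamma> j)"
  have 1: "mbinom (\<alpha>(i := Suc (\<alpha> i))) \<gamma> \<xi> = ?g (Suc (\<alpha> i)) i (\<gamma> i) * ?R"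
    unfolding mbinom_def using prod_fun_upd[of "\<lambda>j a. ?g a j (\<gamma> j)" \<alpha> i "Suc (\<alpha> i)"] .
  have 2: "mbinom \<alpha> \<gamma> \<xi> = ?g (\<alpha> i) i (\<gamma> i) * ?R"
    unfolding mbinom_def by (rule prod.remove) auto
  have 3: "mbinom \<alpha> (\<gamma>(i := \<gamma> i - 1)) \<xi> = ?g (\<alpha> i) i (\<gamma> i - 1) * ?R"
    unfolding mbinom_def using prod_fun_upd[of "\<lambda>j c. ?g (\<alpha> j) j c" \<gamma> i "\<gamma> i - 1"] .
  have 4: "?g (Suc a) i c = \<xi> $ i * ?g a i c + (if c = 0 then 0 else ?g a i (c - 1))" for a c
  proof (cases c)
    case (Suc d)
    show ?thesis
    proof (cases "d < a")
      case True
      then have "a - d = Suc (a - Suc d)" by simp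
      then show ?thesis using Suc by (simp add: algebra_simps)
    next
      case False
      then show ?thesis using Suc by (simp add: binomial_eq_0)
    qed
  qed simp
  show ?thesis unfolding 1 2 3 4[of "\<alpha> i" "\<gamma> i"] by (simp add: algebra_simps)
qed

lemma pderiv_at_separated:
  fixes f :: "'n::finite \<Rightarrow> real \<Rightarrow> real"
  assumes "(f i has_real_derivative d) (at (\<xi> $ i))"
  shows "has_partial (\<lambda>\<xi>. of_real (\<Prod>j\<in>UNIV. f j (\<xi> $ j))) i
     (of_real (d * (\<Prod>j\<in>UNIV - {i}. f j (\<xi> $ j)))) \<xi>"
proof -
  let ?R = "\<Prod>j\<in>UNIV - {i}. f j (\<xi> $ j)"
  have eq: "(\<Prod>j\<in>UNIV. f j ((\<xi> + t *\<^sub>R axis i 1) $ j)) = f i (\<xi> $ i + t) * ?R" for t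
  proof -
    have "(\<Prod>j\<in>UNIV. f j ((\<xi> + t *\<^sub>R axis i 1) $ j)) = f i ((\<xi> + t *\<^sub>R axis i 1) $ i) * (\<Prod>j\<in>UNIV - {i}. f j ((\<xi> + t *\<^sub>R axis i 1) $ j))"
      by (rule prod.remove) auto
    also have "(\<Prod>j\<in>UNIV - {i}. f j ((\<xi> + t *\<^sub>R axis i 1) $ j)) = ?R"
      by (rule prod.cong) (auto simp: axis_def)
    finally show ?thesis by simp
  qed
  have "((\<lambda>t. f i (\<xi> $ i + t)) has_real_derivative d) (at 0)"
    using DERIV_shift[of "f i" d 0 "\<xi> $ i"] assms by (simp add: add.commute)
  then have "((\<lambda>t. f i (\<xi> $ i + t) * ?R) has_real_derivative d * ?R) (at 0)"
    by (rule DERIV_cmult_right)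
  from has_vector_derivative_of_real[OF this] show ?thesis unfolding eq .
qed

lemma partials_mpower:
  "partials is (\<lambda>\<eta>. of_real (mpower \<eta> \<alpha>)) \<xi> = of_real (mfact (count (mset is)) * mbinom \<alpha> (count (mset is)) \<xi>)"
proof -
  (* p a c is the c-th derivative of the monomial of degree a in one variable. *)
  define p where "p a c t = fact c * (of_nat (a choose c) * t ^ (a - c))" for a c :: nat and t :: real
  have eq: "mfact \<gamma> * mbinom \<alpha> \<gamma> \<xi> = (\<Prod>j\<in>UNIV. p (\<alpha> j) (\<gamma> j) (\<xi> $ j))" for \<gamma> \<xi>
    by (simp add: mfact_def mbinom_def p_def prod.distrib)
  have dp: "(p a c has_real_derivative p a (Suc c) t) (at t)" for a c t
  proof -
    have "(p a c has_real_derivative fact c * (of_nat (a choose c) * (of_nat (a - c) * t ^ (a - c - 1)))) (at t)"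
      unfolding p_def[abs_def] by (auto intro!: derivative_eq_intros)
    moreover have ch: "real (a choose c) * real (a - c) = real (Suc c) * real (a choose Suc c)"
      using binomial_absorb_comp[of a c] binomial_absorption[of c a]
      by (metis Suc_times_binomial_eq binomial_absorption of_nat_mult mult.commute binomial_fact_lemma times_binomial_minus1_eq)
    moreover have "fact c * (of_nat (a choose c) * (of_nat (a - c) * t ^ (a - c - 1))) = p a (Suc c) t"
    proof -
      have "fact c * (of_nat (a choose c) * (of_nat (a - c) * t ^ (a - c - 1)))
          = fact c * ((real (a choose c) * real (a - c)) * t ^ (a - Suc c))" by simp
      then show ?thesis unfolding ch p_def by (simp add: algebra_simps)
    qed
    ultimately show ?thesis by simp
  qed
  have "\<forall>\<xi>. partials is (\<lambda>\<eta>. of_real (mpower \<eta> \<alpha>)) \<xi> = of_real (\<Prod>j\<in>UNIV. p (\<alpha> j) (count (mset is) j) (\<xi> $ j))"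
  proof (induction "is")
    case Nil
    show ?case by (simp add: mpower_def p_def)
  next
    case (Cons i "is")
    have e: "partials is (\<lambda>\<eta>. of_real (mpower \<eta> \<alpha>)) = (\<lambda>\<xi>. of_real (\<Prod>j\<in>UNIV. p (\<alpha> j) (count (mset is) j) (\<xi> $ j)))"
      using Cons.IH by blast
    show ?case
    proof
      fix \<xi>
      have "pderiv_at i (\<lambda>\<xi>. of_real (\<Prod>j\<in>UNIV. p (\<alpha> j) (count (mset is) j) (\<xi> $ j))) \<xi>
        = of_real (p (\<alpha> i) (Suc (count (mset is) i)) (\<xi> $ i) * (\<Prod>j\<in>UNIV - {i}. p (\<alpha> j) (count (mset is) j) (\<xi> $ j)))"
        by (rule has_partial_imp_pderiv[OF pderiv_at_separated[OF dp]])
      also have "\<dots> = of_real (\<Prod>j\<in>UNIV. p (\<alpha> j) (count (mset (i # is)) j) (\<xi> $ j))"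
        by (subst (2) prod.remove[of _ i]) auto
      finally show "partials (i # is) (\<lambda>\<eta>. of_real (mpower \<eta> \<alpha>)) \<xi> = of_real (\<Prod>j\<in>UNIV. p (\<alpha> j) (count (mset (i # is)) j) (\<xi> $ j))"
        unfolding partials_Cons e .
    qed
  qed
  then show ?thesis unfolding eq by blast
qed

lemma count_mi_list_fun: "count (mset (mi_list \<gamma>)) = \<gamma>"
  by (simp add: fun_eq_iff count_mi_list)

lemma mderiv_op_symbol:
  "mderiv \<gamma> (\<lambda>\<eta>. op_symbol m A \<epsilon> y \<eta>) \<xi>
     = of_real (mfact \<gamma>) * (\<Sum>\<alpha> | mi_len \<alpha> \<le> m. A \<alpha> \<epsilon> y * of_real (mbinom \<alpha> \<gamma> \<xi>))"
proof -
  have "partials (mi_list \<gamma>) (\<lambda>\<eta>. op_symbol m A \<epsilon> y \<eta>) \<xi>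
      = (\<Sum>\<alpha> | mi_len \<alpha> \<le> m. partials (mi_list \<gamma>) (\<lambda>\<eta>. A \<alpha> \<epsilon> y * of_real (mpower \<eta> \<alpha>)) \<xi>)"
    unfolding op_symbol_def
    by (rule partials_sum[of UNIV]) (auto intro!: smooth_on_mult smooth_on_const smooth_on_mpower)
  also have "\<dots> = (\<Sum>\<alpha> | mi_len \<alpha> \<le> m. A \<alpha> \<epsilon> y * of_real (mfact \<gamma> * mbinom \<alpha> \<gamma> \<xi>))"
    by (rule sum.cong[OF refl])
       (simp add: partials_cmult[of UNIV] smooth_on_mpower partials_mpower count_mi_list_fun)
  finally show ?thesis by (simp add: mderiv_eq_partials sum_distrib_left mult_ac)
qed

section \<open>The operator acting on amplitudes\<close>

text \<open>\<open>\<xi>\<^sub>i - D\<^sub>i\<close>: what \<open>D\<^sub>i\<close>, integrated against \<open>w e\<^sup>-\<^sup>i\<^sup>x\<^sup>\<xi>\<close>, does to the amplitude \<open>w\<close>.\<close>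

definition xi_minus_D :: "real ^ 'n::finite \<Rightarrow> 'n \<Rightarrow> (real ^ 'n \<Rightarrow> complex) \<Rightarrow> real ^ 'n \<Rightarrow> complex" where
  "xi_minus_D \<xi> i w = (\<lambda>x. of_real (\<xi> $ i) * w x + \<i> * pderiv_at i w x)"

lemma smooth_on_xi_minus_D: "open V \<Longrightarrow> smooth_on V w \<Longrightarrow> smooth_on V (xi_minus_D \<xi> i w)"
  unfolding xi_minus_D_def by (intro smooth_on_intros)

text \<open>The shift of the summation index in the second half of Pascal's rule.\<close>

lemma mi_len_lift_sum:
  fixes c :: "'n::finite multi_index \<Rightarrow> complex"
  shows "(\<Sum>\<gamma> | mi_len \<gamma> \<le> Suc M. (if \<gamma> i = 0 then 0 else of_real (mbinom \<alpha> (\<gamma>(i := \<gamma> i - 1)) \<xi>)) * c \<gamma>)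
    = (\<Sum>\<gamma> | mi_len \<gamma> \<le> M. of_real (mbinom \<alpha> \<gamma> \<xi>) * c (\<gamma>(i := Suc (\<gamma> i))))"
proof -
  have "(\<Sum>\<gamma> | mi_len \<gamma> \<le> Suc M. (if \<gamma> i = 0 then 0 else of_real (mbinom \<alpha> (\<gamma>(i := \<gamma> i - 1)) \<xi>)) * c \<gamma>)
     = (\<Sum>\<gamma> | mi_len \<gamma> \<le> Suc M \<and> \<gamma> i \<noteq> 0. of_real (mbinom \<alpha> (\<gamma>(i := \<gamma> i - 1)) \<xi>) * c \<gamma>)"
    by (rule sum.mono_neutral_cong_right) (auto simp: finite_mi_len)
  also have "\<dots> = (\<Sum>\<gamma> | mi_len \<gamma> \<le> M. of_real (mbinom \<alpha> \<gamma> \<xi>) * c (\<gamma>(i := Suc (\<gamma> i))))"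
  proof (rule sum.reindex_bij_witness[where i = "\<lambda>\<gamma>. \<gamma>(i := Suc (\<gamma> i))" and j = "\<lambda>\<gamma>. \<gamma>(i := \<gamma> i - 1)"])
    fix \<gamma> :: "'n multi_index" assume g: "\<gamma> \<in> {\<gamma>. mi_len \<gamma> \<le> Suc M \<and> \<gamma> i \<noteq> 0}"
    show e: "(\<gamma>(i := \<gamma> i - 1))(i := Suc ((\<gamma>(i := \<gamma> i - 1)) i)) = \<gamma>" using g by auto
    show "\<gamma>(i := \<gamma> i - 1) \<in> {\<gamma>. mi_len \<gamma> \<le> M}"
      using mi_len_Suc[of "\<gamma>(i := \<gamma> i - 1)" i] g unfolding e by auto
  qed (auto simp: mi_len_Suc)
  finally show ?thesis .
qed

text \<open>The multinomial formula for the commuting operators \<open>\<xi>\<^sub>i - D\<^sub>i\<close>, by Pascal's rule.\<close>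

lemma fold_xi_minus_D:
  assumes V: "open V"
  shows "smooth_on V w \<Longrightarrow> x \<in> V \<Longrightarrow> length is \<le> M \<Longrightarrow>
    fold (xi_minus_D \<xi>) is w x
      = (\<Sum>\<gamma> | mi_len \<gamma> \<le> M. of_real (mbinom (count (mset is)) \<gamma> \<xi>) * (\<i> ^ mi_len \<gamma> * mderiv \<gamma> w x))"
proof (induction "is" arbitrary: w M)
  case Nil
  have "of_real (mbinom (\<lambda>i. 0) \<gamma> \<xi>) * (\<i> ^ mi_len \<gamma> * mderiv \<gamma> w x) = (if \<gamma> = (\<lambda>i. 0) then w x else 0)" for \<gamma>
  proof (cases "\<gamma> = (\<lambda>i. 0)")
    case True
    have "length (mi_list (\<lambda>i::'a. 0)) = 0" unfolding length_mi_list by (simp add: mi_len_def)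
    then show ?thesis using True by (simp add: mbinom_def mderiv_eq_partials mi_len_def)
  next
    case False
    then obtain j where "\<gamma> j \<noteq> 0" by auto
    then have "mi_len \<gamma> > 0" unfolding mi_len_def by (simp add: sum_pos2[of UNIV j])
    then have "mbinom (\<lambda>i. 0) \<gamma> \<xi> = 0" by (intro mbinom_eq_0) (simp add: mi_len_def)
    then show ?thesis using False by simp
  qed
  moreover have "mi_len (\<lambda>i::'a. 0) \<le> M" by (simp add: mi_len_def)
  ultimately show ?case by (simp add: finite_mi_len)
next
  case (Cons i "is")
  obtain M' where M: "M = Suc M'" "length is \<le> M'" using Cons.prems(3) by (cases M) auto
  let ?\<alpha> = "count (mset is)"
  let ?c = "\<lambda>\<gamma>. \<i> ^ mi_len \<gamma> * mderiv \<gamma> w x"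
  have ex: "mderiv \<gamma> (xi_minus_D \<xi> i w) x = of_real (\<xi> $ i) * mderiv \<gamma> w x + \<i> * mderiv (\<gamma>(i := Suc (\<gamma> i))) w x" for \<gamma>
  proof -
    have "mderiv \<gamma> (xi_minus_D \<xi> i w) x = of_real (\<xi> $ i) * mderiv \<gamma> w x + \<i> * mderiv \<gamma> (pderiv_at i w) x"
      unfolding xi_minus_D_def mderiv_eq_partials using Cons.prems V
      by (simp add: partials_add[of V] partials_cmult[of V] smooth_on_intros)
    also have "mderiv \<gamma> (pderiv_at i w) x = partials (mi_list \<gamma> @ [i]) w x"
      by (simp add: mderiv_eq_partials partials_snoc)
    also have "\<dots> = mderiv (\<gamma>(i := Suc (\<gamma> i))) w x"
      unfolding partials_eq_mderiv[OF V Cons.prems(1,2)]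
      by (rule arg_cong[where f = "\<lambda>\<gamma>. mderiv \<gamma> w x"]) (auto simp: fun_eq_iff count_mi_list)
    finally show ?thesis .
  qed
  have ext: "(\<Sum>\<gamma> | mi_len \<gamma> \<le> M'. of_real (mbinom ?\<alpha> \<gamma> \<xi>) * d \<gamma>) = (\<Sum>\<gamma> | mi_len \<gamma> \<le> Suc M'. of_real (mbinom ?\<alpha> \<gamma> \<xi>) * d \<gamma>)"
    for d :: "_ \<Rightarrow> complex"
    by (rule sum.mono_neutral_left) (use M(2) in \<open>auto simp: finite_mi_len mi_len_count intro!: mbinom_eq_0\<close>)
  have "fold (xi_minus_D \<xi>) (i # is) w x = (\<Sum>\<gamma> | mi_len \<gamma> \<le> M'. of_real (mbinom ?\<alpha> \<gamma> \<xi>) * (\<i> ^ mi_len \<gamma> * mderiv \<gamma> (xi_minus_D \<xi> i w) x))"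
    using Cons.IH[OF smooth_on_xi_minus_D[OF V Cons.prems(1)] Cons.prems(2) M(2)] by simp
  also have "\<dots> = of_real (\<xi> $ i) * (\<Sum>\<gamma> | mi_len \<gamma> \<le> M'. of_real (mbinom ?\<alpha> \<gamma> \<xi>) * ?c \<gamma>)
      + (\<Sum>\<gamma> | mi_len \<gamma> \<le> M'. of_real (mbinom ?\<alpha> \<gamma> \<xi>) * ?c (\<gamma>(i := Suc (\<gamma> i))))"
    unfolding ex mi_len_Suc by (simp add: algebra_simps sum.distrib sum_distrib_left)
  also have "(\<Sum>\<gamma> | mi_len \<gamma> \<le> M'. of_real (mbinom ?\<alpha> \<gamma> \<xi>) * ?c (\<gamma>(i := Suc (\<gamma> i))))
      = (\<Sum>\<gamma> | mi_len \<gamma> \<le> Suc M'. (if \<gamma> i = 0 then 0 else of_real (mbinom ?\<alpha> (\<gamma>(i := \<gamma> i - 1)) \<xi>)) * ?c \<gamma>)"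
    by (rule mi_len_lift_sum[symmetric])
  also have "of_real (\<xi> $ i) * (\<Sum>\<gamma> | mi_len \<gamma> \<le> M'. of_real (mbinom ?\<alpha> \<gamma> \<xi>) * ?c \<gamma>)
       + (\<Sum>\<gamma> | mi_len \<gamma> \<le> Suc M'. (if \<gamma> i = 0 then 0 else of_real (mbinom ?\<alpha> (\<gamma>(i := \<gamma> i - 1)) \<xi>)) * ?c \<gamma>)
      = (\<Sum>\<gamma> | mi_len \<gamma> \<le> Suc M'. of_real (mbinom (?\<alpha>(i := Suc (?\<alpha> i))) \<gamma> \<xi>) * ?c \<gamma>)"
    unfolding ext sum_distrib_left sum.distrib[symmetric] mbinom_Suc
    by (rule sum.cong[OF refl]) (simp add: algebra_simps)
  also have "?\<alpha>(i := Suc (?\<alpha> i)) = count (mset (i # is))" by (auto simp: fun_eq_iff)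
  finally show ?case unfolding M(1) .
qed

text \<open>One integration by parts for each entry of the list, with
  \<open>-D_i(w e^{-ix\<xi>}) = ((\<xi>_i - D_i) w) e^{-ix\<xi>}\<close>.\<close>

lemma fourier_D:
  assumes V: "open V" "smooth_on V u" and K: "compact K" "K \<subseteq> V"
  shows "smooth_on V w \<Longrightarrow> (\<And>x. x \<notin> K \<Longrightarrow> w x = 0) \<Longrightarrow>
    fourier (\<lambda>x. w x * ((- \<i>) ^ length is * partials is u x)) \<xi> = fourier (\<lambda>x. fold (xi_minus_D \<xi>) is w x * u x) \<xi>"
proof (induction "is" arbitrary: w)
  case (Cons i "is")
  note cl = compact_imp_closed[OF K(1)]
  let ?v = "\<lambda>x. (- \<i>) ^ length is * partials is u x"
  have v: "smooth_on V ?v" using V by (intro smooth_on_intros)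
  have we: "smooth_on V (\<lambda>x. w x * expi \<xi> x)" using Cons.prems V by (intro smooth_on_intros smooth_on_expi)
  have w': "pderiv_at i w x = 0" if "x \<notin> K" for x
    by (rule pderiv_at_off_support[OF cl _ that]) (rule Cons.prems(2))
  have "fourier (\<lambda>x. w x * ((- \<i>) ^ length (i # is) * partials (i # is) u x)) \<xi> = (LINT x|lborel. - \<i> * (pderiv_at i ?v x * (w x * expi \<xi> x)))"
    unfolding fourier_eq
  proof (rule Bochner_Integration.integral_cong[OF refl])
    fix x
    show "w x * ((- \<i>) ^ length (i # is) * partials (i # is) u x) * expi \<xi> x = - \<i> * (pderiv_at i ?v x * (w x * expi \<xi> x))"
    proof (cases "x \<in> K")
      case True
      then show ?thesis using K V pderiv_at_cmult[OF smooth_on_partials[OF V(2)], of x i "(- \<i>) ^ length is" "is"]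
        by (auto simp: partials_Cons)
    qed (simp add: Cons.prems(2))
  qed
  also have "\<dots> = - \<i> * (LINT x|lborel. pderiv_at i ?v x * (w x * expi \<xi> x))" by simp
  also have "(LINT x|lborel. pderiv_at i ?v x * (w x * expi \<xi> x)) = - (LINT x|lborel. ?v x * pderiv_at i (\<lambda>x. w x * expi \<xi> x) x)"
    by (rule integral_by_parts[OF V(1) v we K]) (simp add: Cons.prems(2))
  also have "- \<i> * - (LINT x|lborel. ?v x * pderiv_at i (\<lambda>x. w x * expi \<xi> x) x) = (LINT x|lborel. \<i> * (?v x * pderiv_at i (\<lambda>x. w x * expi \<xi> x) x))"
    by simp
  also have "\<dots> = fourier (\<lambda>x. xi_minus_D \<xi> i w x * ?v x) \<xi>"
    unfolding fourier_eq
  proof (rule Bochner_Integration.integral_cong[OF refl])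
    fix x
    show "\<i> * (?v x * pderiv_at i (\<lambda>x. w x * expi \<xi> x) x) = xi_minus_D \<xi> i w x * ?v x * expi \<xi> x"
    proof (cases "x \<in> K")
      case True
      then have "x \<in> V" using K by auto
      have e: "pderiv_at i (\<lambda>x. w x * expi \<xi> x) x = pderiv_at i w x * expi \<xi> x + w x * (- \<i> * of_real (\<xi> $ i) * expi \<xi> x)"
        by (rule has_partial_imp_pderiv[OF has_partial_mult[OF smooth_on_has_partial[OF Cons.prems(1) \<open>x \<in> V\<close>] has_partial_expi]])
      show ?thesis unfolding e xi_minus_D_def by (simp add: algebra_simps)
    next
      case False
      have "pderiv_at i (\<lambda>x. w x * expi \<xi> x) x = 0"
        by (rule pderiv_at_off_support[OF cl _ False]) (simp add: Cons.prems(2))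
      then show ?thesis using w'[OF False] Cons.prems(2)[OF False] by (simp add: xi_minus_D_def)
    qed
  qed
  also have "\<dots> = fourier (\<lambda>x. fold (xi_minus_D \<xi>) is (xi_minus_D \<xi> i w) x * u x) \<xi>"
    by (rule Cons.IH[OF smooth_on_xi_minus_D[OF V(1) Cons.prems(1)]]) (simp add: xi_minus_D_def w' Cons.prems(2))
  finally show ?case by simp
qed simp

text \<open>The transpose of the operator acting on amplitudes:
  \<open>e\<^sup>i\<^sup>x\<^sup>\<xi> \<^sup>tP(e\<^sup>-\<^sup>i\<^sup>x\<^sup>\<xi> w) = \<Sum>\<^sub>\<gamma> (-D)\<^sup>\<gamma>(\<partial>\<^sub>\<xi>\<^sup>\<gamma>P(x,\<xi>) w) / \<gamma>!\<close>.\<close>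

definition amplitude_op ::
    "nat \<Rightarrow> ('n::finite multi_index \<Rightarrow> 'n net) \<Rightarrow> real \<Rightarrow> real ^ 'n \<Rightarrow> (real ^ 'n \<Rightarrow> complex) \<Rightarrow> real ^ 'n \<Rightarrow> complex" where
  "amplitude_op m A \<epsilon> \<xi> w x = (\<Sum>\<gamma> | mi_len \<gamma> \<le> m.
     (\<i> ^ mi_len \<gamma> / of_real (mfact \<gamma>)) * mderiv \<gamma> (\<lambda>y. mderiv \<gamma> (\<lambda>\<eta>. op_symbol m A \<epsilon> y \<eta>) \<xi> * w y) x)"

lemma smooth_on_op_symbol_deriv:
  assumes "open V" "\<And>\<alpha>. mi_len \<alpha> \<le> m \<Longrightarrow> smooth_on V (A \<alpha> \<epsilon>)"
  shows "smooth_on V (\<lambda>y. mderiv \<gamma> (\<lambda>\<eta>. op_symbol m A \<epsilon> y \<eta>) \<xi>)"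
  unfolding mderiv_op_symbol using assms by (intro smooth_on_intros) auto

text \<open>By \<open>fourier_D\<close> the operator turns into \<open>\<Sum>\<^sub>\<alpha> (\<xi> - D)^\<alpha> (a\<^sub>\<alpha> w)\<close>.  Expanding the powers and
  summing over \<open>\<alpha>\<close> first, the coefficients of \<open>(-D)^\<gamma>\<close> add up to \<open>\<partial>\<^sub>\<xi>^\<gamma> P / \<gamma>!\<close>.\<close>

theorem fourier_diff_op:
  assumes V: "open V" "smooth_on V (u \<epsilon>)" and K: "compact K" "K \<subseteq> V"
    and A: "\<And>\<alpha>. mi_len \<alpha> \<le> m \<Longrightarrow> smooth_on V (A \<alpha> \<epsilon>)"
    and w: "smooth_on V w" "\<And>x. x \<notin> K \<Longrightarrow> w x = 0"
  shows "fourier (\<lambda>x. w x * diff_op_net m A u \<epsilon> x) \<xi> = fourier (\<lambda>x. amplitude_op m A \<epsilon> \<xi> w x * u \<epsilon> x) \<xi>"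
proof -
  note cl = compact_imp_closed[OF K(1)]
  let ?a = "\<lambda>\<alpha> x. A \<alpha> \<epsilon> x * w x"
  have aw: "smooth_on V (?a \<alpha>)" if "mi_len \<alpha> \<le> m" for \<alpha> using A[OF that] w(1) V(1) by (intro smooth_on_intros)
  have aw0: "?a \<alpha> x = 0" if "x \<notin> K" for \<alpha> x using w(2)[OF that] by simp
  have fold0: "fold (xi_minus_D \<xi>) is v x = 0" if "x \<notin> K" "\<And>x. x \<notin> K \<Longrightarrow> v x = 0" for "is" v x
    using that(2)
  proof (induction "is" arbitrary: v)
    case (Cons i "is")
    have "xi_minus_D \<xi> i v y = 0" if "y \<notin> K" for y
    proof -
      have "pderiv_at i v y = 0" by (rule pderiv_at_off_support[OF cl _ that]) (rule Cons.prems)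
      then show ?thesis using Cons.prems[OF that] by (simp add: xi_minus_D_def)
    qed
    then show ?case using Cons.IH[of "xi_minus_D \<xi> i v"] by simp
  qed (use that(1) in simp)
  have foldsm: "smooth_on V (fold (xi_minus_D \<xi>) is v)" if "smooth_on V v" for "is" v
    using that by (induction "is" arbitrary: v) (auto intro: smooth_on_xi_minus_D[OF V(1)])
  have cont: "integrable lborel (\<lambda>x. a x * b x * expi \<xi> x)" if "smooth_on V a" "smooth_on V b" "\<And>x. x \<notin> K \<Longrightarrow> a x = 0" for a b
    using that by (intro integrable_smooth_expi[OF V(1) _ _ K]) auto
  have "fourier (\<lambda>x. w x * diff_op_net m A u \<epsilon> x) \<xi>
     = (LINT x|lborel. (\<Sum>\<alpha> | mi_len \<alpha> \<le> m. ?a \<alpha> x * ((- \<i>) ^ length (mi_list \<alpha>) * partials (mi_list \<alpha>) (u \<epsilon>) x) * expi \<xi> x))"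
    unfolding fourier_eq diff_op_net_def
    by (simp add: sum_distrib_left sum_distrib_right mult_ac length_mi_list mderiv_eq_partials)
  also have "\<dots> = (\<Sum>\<alpha> | mi_len \<alpha> \<le> m. fourier (\<lambda>x. ?a \<alpha> x * ((- \<i>) ^ length (mi_list \<alpha>) * partials (mi_list \<alpha>) (u \<epsilon>) x)) \<xi>)"
    unfolding fourier_eq
    by (rule Bochner_Integration.integral_sum, rule cont) (use aw w(2) V in \<open>auto intro!: smooth_on_intros\<close>)
  also have "\<dots> = (\<Sum>\<alpha> | mi_len \<alpha> \<le> m. fourier (\<lambda>x. fold (xi_minus_D \<xi>) (mi_list \<alpha>) (?a \<alpha>) x * u \<epsilon> x) \<xi>)"
    by (rule sum.cong[OF refl], rule fourier_D[OF V K aw aw0]) auto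
  also have "\<dots> = (LINT x|lborel. (\<Sum>\<alpha> | mi_len \<alpha> \<le> m. fold (xi_minus_D \<xi>) (mi_list \<alpha>) (?a \<alpha>) x * u \<epsilon> x * expi \<xi> x))"
    unfolding fourier_eq
    by (rule Bochner_Integration.integral_sum[symmetric], rule cont) (use aw aw0 foldsm fold0 V in auto)
  also have "\<dots> = fourier (\<lambda>x. amplitude_op m A \<epsilon> \<xi> w x * u \<epsilon> x) \<xi>"
    unfolding fourier_eq
  proof (rule Bochner_Integration.integral_cong[OF refl])
    fix x
    have "(\<Sum>\<alpha> | mi_len \<alpha> \<le> m. fold (xi_minus_D \<xi>) (mi_list \<alpha>) (?a \<alpha>) x) = amplitude_op m A \<epsilon> \<xi> w x"
    proof (cases "x \<in> K")
      case True
      then have x: "x \<in> V" using K by auto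
      have "(\<Sum>\<alpha> | mi_len \<alpha> \<le> m. fold (xi_minus_D \<xi>) (mi_list \<alpha>) (?a \<alpha>) x)
         = (\<Sum>\<alpha> | mi_len \<alpha> \<le> m. \<Sum>\<gamma> | mi_len \<gamma> \<le> m. of_real (mbinom \<alpha> \<gamma> \<xi>) * (\<i> ^ mi_len \<gamma> * mderiv \<gamma> (?a \<alpha>) x))"
      proof (rule sum.cong[OF refl])
        fix \<alpha> :: "'a multi_index" assume "\<alpha> \<in> {\<alpha>. mi_len \<alpha> \<le> m}"
        then have "smooth_on V (?a \<alpha>)" "length (mi_list \<alpha>) \<le> m" using aw by (auto simp: length_mi_list)
        from fold_xi_minus_D[OF V(1) this(1) x this(2), of \<xi>]
        show "fold (xi_minus_D \<xi>) (mi_list \<alpha>) (?a \<alpha>) x = (\<Sum>\<gamma> | mi_len \<gamma> \<le> m. of_real (mbinom \<alpha> \<gamma> \<xi>) * (\<i> ^ mi_len \<gamma> * mderiv \<gamma> (?a \<alpha>) x))"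
          unfolding count_mi_list_fun .
      qed
      also have "\<dots> = (\<Sum>\<gamma> | mi_len \<gamma> \<le> m. \<Sum>\<alpha> | mi_len \<alpha> \<le> m. of_real (mbinom \<alpha> \<gamma> \<xi>) * (\<i> ^ mi_len \<gamma> * mderiv \<gamma> (?a \<alpha>) x))"
        by (rule sum.swap)
      also have "\<dots> = amplitude_op m A \<epsilon> \<xi> w x"
        unfolding amplitude_op_def
      proof (rule sum.cong[OF refl])
        fix \<gamma> :: "'a multi_index"
        have eq: "(\<lambda>y. mderiv \<gamma> (\<lambda>\<eta>. op_symbol m A \<epsilon> y \<eta>) \<xi> * w y)
          = (\<lambda>y. \<Sum>\<alpha> | mi_len \<alpha> \<le> m. (of_real (mfact \<gamma>) * of_real (mbinom \<alpha> \<gamma> \<xi>)) * ?a \<alpha> y)"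
          unfolding mderiv_op_symbol by (simp add: sum_distrib_left sum_distrib_right mult_ac)
        have "mderiv \<gamma> (\<lambda>y. mderiv \<gamma> (\<lambda>\<eta>. op_symbol m A \<epsilon> y \<eta>) \<xi> * w y) x
           = (\<Sum>\<alpha> | mi_len \<alpha> \<le> m. mderiv \<gamma> (\<lambda>y. (of_real (mfact \<gamma>) * of_real (mbinom \<alpha> \<gamma> \<xi>)) * ?a \<alpha> y) x)"
          unfolding eq unfolding mderiv_eq_partials
          by (rule partials_sum[OF V(1) _ x]) (use aw V(1) in \<open>auto intro!: smooth_on_mult[OF V(1) smooth_on_const[OF V(1)]]\<close>)
        also have "\<dots> = (\<Sum>\<alpha> | mi_len \<alpha> \<le> m. (of_real (mfact \<gamma>) * of_real (mbinom \<alpha> \<gamma> \<xi>)) * mderiv \<gamma> (?a \<alpha>) x)"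
          unfolding mderiv_eq_partials
          by (intro sum.cong[OF refl] partials_cmult[OF V(1) _ x]) (use aw in auto)
        finally have e2: "mderiv \<gamma> (\<lambda>y. mderiv \<gamma> (\<lambda>\<eta>. op_symbol m A \<epsilon> y \<eta>) \<xi> * w y) x
          = of_real (mfact \<gamma>) * (\<Sum>\<alpha> | mi_len \<alpha> \<le> m. of_real (mbinom \<alpha> \<gamma> \<xi>) * mderiv \<gamma> (?a \<alpha>) x)"
          by (simp add: sum_distrib_left mult_ac)
        show "(\<Sum>\<alpha> | mi_len \<alpha> \<le> m. of_real (mbinom \<alpha> \<gamma> \<xi>) * (\<i> ^ mi_len \<gamma> * mderiv \<gamma> (?a \<alpha>) x))
          = (\<i> ^ mi_len \<gamma> / of_real (mfact \<gamma>)) * mderiv \<gamma> (\<lambda>y. mderiv \<gamma> (\<lambda>\<eta>. op_symbol m A \<epsilon> y \<eta>) \<xi> * w y) x"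
          unfolding e2 using mfact_pos[of \<gamma>] by (simp add: sum_distrib_left mult_ac)
      qed
      finally show ?thesis .
    next
      case False
      have "mderiv \<gamma> (\<lambda>y. mderiv \<gamma> (\<lambda>\<eta>. op_symbol m A \<epsilon> y \<eta>) \<xi> * w y) x = 0" for \<gamma>
        unfolding mderiv_eq_partials by (rule partials_off_support[OF cl _ False]) (simp add: w(2))
      then show ?thesis using fold0[OF False] aw0 by (simp add: amplitude_op_def)
    qed
    then show "(\<Sum>\<alpha> | mi_len \<alpha> \<le> m. fold (xi_minus_D \<xi>) (mi_list \<alpha>) (?a \<alpha>) x * u \<epsilon> x * expi \<xi> x) = amplitude_op m A \<epsilon> \<xi> w x * u \<epsilon> x * expi \<xi> x"
      by (simp add: sum_distrib_right[symmetric])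
  qed
  finally show ?thesis .
qed

section \<open>Cutoff functions\<close>

text \<open>The derivatives of \<open>e\<^sup>-\<^sup>1\<^sup>/\<^sup>t\<close>, extended by \<open>0\<close>, are combinations of the functions
  \<open>t\<^sup>-\<^sup>k e\<^sup>-\<^sup>1\<^sup>/\<^sup>t\<close>; the whole family is treated at once.\<close>

definition flat_exp :: "nat \<Rightarrow> real \<Rightarrow> real" where
  "flat_exp k t = (if t > 0 then inverse t ^ k * exp (- inverse t) else 0)"

lemma flat_exp_tendsto_0: "(flat_exp k \<longlongrightarrow> 0) (at 0)"
proof (rule filterlim_split_at)
  show "(flat_exp k \<longlongrightarrow> 0) (at_left 0)"
    by (rule tendsto_eventually) (simp add: flat_exp_def eventually_at_filter)
  have "((\<lambda>x::real. x ^ k / exp x) \<longlongrightarrow> 0) at_top" by (rule tendsto_power_div_exp_0)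
  from filterlim_compose[OF this filterlim_inverse_at_top_right]
  have "((\<lambda>t::real. inverse t ^ k / exp (inverse t)) \<longlongrightarrow> 0) (at_right 0)" .
  then show "(flat_exp k \<longlongrightarrow> 0) (at_right 0)"
    by (rule Lim_transform_eventually)
       (simp add: flat_exp_def eventually_at_filter exp_minus divide_inverse)
qed

lemma DERIV_flat_exp: "(flat_exp k has_real_derivative flat_exp (k + 2) t - of_nat k * flat_exp (k + 1) t) (at t)"
proof -
  consider "t > 0" | "t < 0" | "t = 0" by linarith
  then show ?thesis
  proof cases
    case 1
    have "((\<lambda>t. inverse t ^ k * exp (- inverse t)) has_real_derivative
        (of_nat k * (inverse t ^ (k - 1) * - (inverse t * inverse t))) * exp (- inverse t)
          + inverse t ^ k * (exp (- inverse t) * (inverse t * inverse t))) (at t)"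
      using 1 by (auto intro!: derivative_eq_intros simp: power2_eq_square)
    moreover have e: "of_nat k * (inverse t ^ (k - 1) * - (inverse t * inverse t)) = - of_nat k * inverse t ^ (k + 1)"
      by (cases k) (simp_all add: algebra_simps)
    ultimately have "((\<lambda>t. inverse t ^ k * exp (- inverse t)) has_real_derivative
        flat_exp (k + 2) t - of_nat k * flat_exp (k + 1) t) (at t)"
      unfolding e using 1 by (simp add: flat_exp_def power_add power2_eq_square algebra_simps)
    then show ?thesis
      by (rule has_field_derivative_transform_within_open[of _ _ _ "{0<..}"]) (use 1 in \<open>auto simp: flat_exp_def\<close>)
  next
    case 2
    have "((\<lambda>t. 0) has_real_derivative 0) (at t)" by simp
    then have "(flat_exp k has_real_derivative 0) (at t)"
      by (rule has_field_derivative_transform_within_open[of _ _ _ "{..<0}"]) (use 2 in \<open>auto simp: flat_exp_def\<close>)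
    then show ?thesis using 2 by (simp add: flat_exp_def)
  next
    case 3
    have "((\<lambda>h. (flat_exp k (0 + h) - flat_exp k 0) / h) \<longlongrightarrow> 0) (at 0)"
      by (rule Lim_transform_eventually[OF flat_exp_tendsto_0[of "Suc k"]])
         (simp add: flat_exp_def eventually_at_filter divide_inverse)
    then have "(flat_exp k has_real_derivative 0) (at 0)" by (simp add: DERIV_def)
    then show ?thesis using 3 by (simp add: flat_exp_def)
  qed
qed

text \<open>All \<open>j\<close> are treated at once, since the derivative of \<open>flat_exp j\<close> is a combination of
  \<open>flat_exp (j + 1)\<close> and \<open>flat_exp (j + 2)\<close>.\<close>

lemma smooth_on_flat_exp:
  fixes a :: "real^'n::finite"
  shows "smooth_on UNIV (\<lambda>x. of_real (flat_exp j (s + c * ((x - a) \<bullet> (x - a)))))"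
proof -
  let ?p = "\<lambda>x. s + c * ((x - a) \<bullet> (x - a))"
  let ?q = "\<lambda>j i x. of_real (flat_exp (j + 2) (?p x)) * of_real (2 * c * (x $ i - a $ i))
             + of_real (- of_nat j) * (of_real (flat_exp (j + 1) (?p x)) * of_real (2 * c * (x $ i - a $ i))) :: complex"
  have cont: "continuous_on UNIV (\<lambda>x. complex_of_real (flat_exp j (?p x)))" for j
  proof -
    have "continuous_on UNIV (flat_exp j)"
      by (rule DERIV_continuous_on[where D = "\<lambda>t. flat_exp (j + 2) t - of_nat j * flat_exp (j + 1) t"])
         (use DERIV_flat_exp has_field_derivative_at_within in blast)
    then have "continuous_on UNIV (\<lambda>x. flat_exp j (?p x))"
      by (rule continuous_on_compose2) (auto intro!: continuous_intros)
    then show ?thesis by (intro continuous_intros)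
  qed
  have part: "has_partial (\<lambda>x. of_real (flat_exp j (?p x))) i (?q j i x) x" for i x j
  proof -
    have "((\<lambda>t. ?p (x + t *\<^sub>R axis i 1)) has_real_derivative 2 * c * (x $ i - a $ i)) (at 0)"
    proof -
      have e: "?p (x + t *\<^sub>R axis i 1) = s + c * ((x - a) \<bullet> (x - a) + 2 * t * (x $ i - a $ i) + t * t)" for t
        by (simp add: inner_diff_left inner_diff_right inner_add_left inner_add_right inner_axis inner_axis' algebra_simps)
      show ?thesis unfolding e by (auto intro!: derivative_eq_intros)
    qed
    from DERIV_chain2[OF DERIV_flat_exp this, of j]
    have d: "((\<lambda>t. flat_exp j (?p (x + t *\<^sub>R axis i 1))) has_real_derivative
        (flat_exp (j + 2) (?p x) - of_nat j * flat_exp (j + 1) (?p x)) * (2 * c * (x $ i - a $ i))) (at 0)"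
      by simp
    have e: "?q j i x = of_real ((flat_exp (j + 2) (?p x) - of_nat j * flat_exp (j + 1) (?p x)) * (2 * c * (x $ i - a $ i)))"
      by (simp add: algebra_simps)
    show ?thesis unfolding e by (rule has_vector_derivative_of_real[OF d])
  qed
  have lin: "Ck k UNIV (\<lambda>x. of_real (2 * c * (x $ i - a $ i)))" for k i
  proof -
    have "smooth_on UNIV (\<lambda>x. of_real (2 * c) * (of_real (x $ i) - of_real (a $ i)))"
      by (intro smooth_on_intros smooth_on_coordinate) auto
    then show ?thesis by (simp add: smooth_on_iff_Ck)
  qed
  have "\<forall>j. Ck k UNIV (\<lambda>x. of_real (flat_exp j (?p x)))" for k
  proof (induction k)
    case 0
    then show ?case using cont by simp
  next
    case (Suc k)
    show ?case
    proof
      fix j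
      show "Ck (Suc k) UNIV (\<lambda>x. of_real (flat_exp j (?p x)))"
        by (rule Ck_SucI[OF open_UNIV cont part])
           (intro Ck_add Ck_mult Ck_const lin open_UNIV Suc[rule_format])
    qed
  qed
  then show ?thesis by (simp add: smooth_on_iff_Ck)
qed

text \<open>The quotient \<open>F1 / (F1 + F2)\<close>, where \<open>F1\<close> is positive exactly where \<open>|x - a| < s\<close> and \<open>F2\<close>
  exactly where \<open>|x - a| > r\<close>.\<close>

theorem cutoff_exists:
  fixes a :: "real^'n::finite"
  assumes "0 < r" "r < s"
  obtains \<psi> :: "real^'n \<Rightarrow> complex" where "smooth_on UNIV \<psi>"
    "\<And>x. x \<in> cball a r \<Longrightarrow> \<psi> x = 1" "\<And>x. x \<notin> cball a s \<Longrightarrow> \<psi> x = 0"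
proof -
  define F1 F2 :: "real^'n \<Rightarrow> real"
    where "F1 x = flat_exp 0 (s\<^sup>2 + (- 1) * ((x - a) \<bullet> (x - a)))"
      and "F2 x = flat_exp 0 (- r\<^sup>2 + 1 * ((x - a) \<bullet> (x - a)))" for x
  have nn: "flat_exp 0 t \<ge> 0" "flat_exp 0 t > 0 \<longleftrightarrow> t > 0" for t by (auto simp: flat_exp_def)
  have d: "(x - a) \<bullet> (x - a) = (dist a x)\<^sup>2" for x
    unfolding dist_norm norm_minus_commute[of a x] power2_norm_eq_inner ..
  have rs: "r\<^sup>2 < s\<^sup>2" using assms by (intro power_strict_mono) auto
  have pos: "F1 x + F2 x > 0" for x
  proof (cases "(dist a x)\<^sup>2 < s\<^sup>2")
    case True
    then have "F1 x > 0" unfolding F1_def nn(2) d by simp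
    then show ?thesis using nn(1) by (simp add: F2_def add_pos_nonneg)
  next
    case False
    then have "F2 x > 0" unfolding F2_def nn(2) d using rs by simp
    then show ?thesis using nn(1) by (simp add: F1_def add_nonneg_pos)
  qed
  define \<psi> where "\<psi> x = complex_of_real (F1 x) * inverse (of_real (F1 x) + of_real (F2 x))" for x
  have "smooth_on UNIV (\<lambda>x. complex_of_real (F1 x))" "smooth_on UNIV (\<lambda>x. complex_of_real (F2 x))"
    unfolding F1_def F2_def by (rule smooth_on_flat_exp)+
  then have "smooth_on UNIV \<psi>" unfolding \<psi>_def
    by (intro smooth_on_intros smooth_on_inverse) (auto, metis less_irrefl of_real_add of_real_eq_0_iff pos)
  moreover have "\<psi> x = 1" if "x \<in> cball a r" for x
  proof -
    have "(dist a x)\<^sup>2 \<le> r\<^sup>2" using that by (intro power_mono) auto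
    then have "F2 x = 0" unfolding F2_def d by (simp add: flat_exp_def)
    then show ?thesis using pos[of x] by (simp add: \<psi>_def)
  qed
  moreover have "\<psi> x = 0" if "x \<notin> cball a s" for x
  proof -
    have "s\<^sup>2 \<le> (dist a x)\<^sup>2" using that assms by (intro power_mono) auto
    then have "F1 x = 0" unfolding F1_def d by (simp add: flat_exp_def)
    then show ?thesis by (simp add: \<psi>_def)
  qed
  ultimately show thesis by (rule that)
qed

section \<open>Slow scale nets and high frequencies\<close>

text \<open>Slow scale nets with nonnegative values.  Natural exponents suffice, and the case \<open>n = 1\<close>
  contains the polynomial bound.\<close>

definition slow :: "(real \<Rightarrow> real) \<Rightarrow> bool" where
  "slow c \<longleftrightarrow> (\<forall>n::nat. \<forall>\<^sub>F \<epsilon> in at_right 0. 0 \<le> c \<epsilon> \<and> c \<epsilon> ^ n \<le> 1 / \<epsilon>)"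

lemma slow_nonneg: "slow c \<Longrightarrow> \<forall>\<^sub>F \<epsilon> in at_right 0. 0 \<le> c \<epsilon>"
  unfolding slow_def by (drule spec[of _ 0]) (auto elim: eventually_mono)

lemma slow_power_le: "slow c \<Longrightarrow> \<forall>\<^sub>F \<epsilon> in at_right 0. c \<epsilon> ^ n \<le> 1 / \<epsilon>"
  unfolding slow_def by (drule spec[of _ n]) (auto elim: eventually_mono)

lemma slow_const:
  assumes "0 \<le> c" shows "slow (\<lambda>_. c)"
  unfolding slow_def
proof
  fix n :: nat
  have "\<forall>\<^sub>F \<epsilon> in at_right (0::real). 0 < \<epsilon> \<and> \<epsilon> < 1 / (c ^ n + 1)"
    unfolding eventually_at_right_field using assms by (intro exI[of _ "1 / (c ^ n + 1)"]) (auto simp: add_nonneg_pos)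
  then show "\<forall>\<^sub>F \<epsilon> in at_right 0. 0 \<le> c \<and> c ^ n \<le> 1 / \<epsilon>"
  proof eventually_elim
    case (elim \<epsilon>)
    have "0 \<le> c ^ n" using assms by simp
    then have "\<epsilon> * (c ^ n + 1) < 1" using elim by (simp add: pos_less_divide_eq)
    then have "c ^ n * \<epsilon> \<le> 1" using elim by (simp add: algebra_simps)
    then show ?case using elim assms by (simp add: pos_le_divide_eq)
  qed
qed

lemma slow_mult:
  assumes "slow a" "slow b" shows "slow (\<lambda>\<epsilon>. a \<epsilon> * b \<epsilon>)"
  unfolding slow_def
proof
  fix n :: nat
  show "\<forall>\<^sub>F \<epsilon> in at_right 0. 0 \<le> a \<epsilon> * b \<epsilon> \<and> (a \<epsilon> * b \<epsilon>) ^ n \<le> 1 / \<epsilon>"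
    using assms(1)[unfolded slow_def, rule_format, of "2 * n"] assms(2)[unfolded slow_def, rule_format, of "2 * n"]
      eventually_at_right_less[of 0]
  proof eventually_elim
    case (elim \<epsilon>)
    have "((a \<epsilon> * b \<epsilon>) ^ n)\<^sup>2 = a \<epsilon> ^ (2 * n) * b \<epsilon> ^ (2 * n)"
      by (simp add: power_mult_distrib power_mult[symmetric] mult.commute)
    also have "\<dots> \<le> (1 / \<epsilon>) * (1 / \<epsilon>)" using elim by (intro mult_mono) auto
    also have "\<dots> = (1 / \<epsilon>)\<^sup>2" by (simp add: power2_eq_square)
    finally have "(a \<epsilon> * b \<epsilon>) ^ n \<le> 1 / \<epsilon>" by (rule power2_le_imp_le) (use elim in simp)
    then show ?case using elim by simp
  qed
qed

lemma slow_max: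
  assumes "slow a" "slow b" shows "slow (\<lambda>\<epsilon>. max (a \<epsilon>) (b \<epsilon>))"
  unfolding slow_def
proof
  fix n :: nat
  show "\<forall>\<^sub>F \<epsilon> in at_right 0. 0 \<le> max (a \<epsilon>) (b \<epsilon>) \<and> max (a \<epsilon>) (b \<epsilon>) ^ n \<le> 1 / \<epsilon>"
    using assms(1)[unfolded slow_def, rule_format, of n] assms(2)[unfolded slow_def, rule_format, of n]
    by eventually_elim (auto simp: max_def)
qed

lemma slow_mono:
  assumes "slow b" "\<forall>\<^sub>F \<epsilon> in at_right 0. 0 \<le> a \<epsilon> \<and> a \<epsilon> \<le> b \<epsilon>" shows "slow a"
  unfolding slow_def
proof
  fix n :: nat
  show "\<forall>\<^sub>F \<epsilon> in at_right 0. 0 \<le> a \<epsilon> \<and> a \<epsilon> ^ n \<le> 1 / \<epsilon>"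
    using assms(1)[unfolded slow_def, rule_format, of n] assms(2)
  proof eventually_elim
    case (elim \<epsilon>)
    then have "a \<epsilon> ^ n \<le> b \<epsilon> ^ n" by (intro power_mono) auto
    then show ?case using elim by auto
  qed
qed

lemma slow_add:
  assumes "slow a" "slow b" shows "slow (\<lambda>\<epsilon>. a \<epsilon> + b \<epsilon>)"
proof (rule slow_mono)
  show "slow (\<lambda>\<epsilon>. 2 * max (a \<epsilon>) (b \<epsilon>))" by (intro slow_mult slow_const slow_max assms) simp
  show "\<forall>\<^sub>F \<epsilon> in at_right 0. 0 \<le> a \<epsilon> + b \<epsilon> \<and> a \<epsilon> + b \<epsilon> \<le> 2 * max (a \<epsilon>) (b \<epsilon>)"
    using slow_nonneg[OF assms(1)] slow_nonneg[OF assms(2)] by eventually_elim auto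
qed

lemma pos_slow_scale_imp_slow:
  assumes "pos_slow_scale r" shows "slow r"
  unfolding slow_def
proof
  fix n :: nat
  obtain e where e: "e > 0" "\<And>\<epsilon>. \<epsilon> \<in> {0<..<e} \<Longrightarrow> norm (r \<epsilon>) powr real n \<le> 1 / \<epsilon>"
    using assms unfolding pos_slow_scale_def slow_scale_def by (meson of_nat_0_le_iff)
  have "0 \<le> r \<epsilon> \<and> r \<epsilon> ^ n \<le> 1 / \<epsilon>" if "0 < \<epsilon>" "\<epsilon> < min e 1" for \<epsilon>
  proof -
    have "r \<epsilon> > 0" using assms that unfolding pos_slow_scale_def by auto
    then show ?thesis using e(2)[of \<epsilon>] that by (simp add: powr_realpow)
  qed
  then show "\<forall>\<^sub>F \<epsilon> in at_right 0. 0 \<le> r \<epsilon> \<and> r \<epsilon> ^ n \<le> 1 / \<epsilon>"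
    unfolding eventually_at_right_field using e(1) by (intro exI[of _ "min e 1"]) auto
qed

text \<open>Pairs \<open>(\<epsilon>, \<xi>)\<close> with \<open>\<epsilon>\<close> small and \<open>\<xi> \<in> \<Gamma>\<close> beyond a slow scale radius.  A filter,
  because finitely many slow scale radii have a common slow scale upper bound.\<close>

definition high_freq :: "(real ^ 'n::finite) set \<Rightarrow> (real \<times> (real ^ 'n)) filter" where
  "high_freq \<Gamma> = Abs_filter (\<lambda>P. \<exists>\<sigma>. slow \<sigma> \<and> (\<forall>\<^sub>F \<epsilon> in at_right 0. \<forall>\<xi>\<in>\<Gamma>. \<sigma> \<epsilon> \<le> norm \<xi> \<longrightarrow> P (\<epsilon>, \<xi>)))"

lemma eventually_high_freq:
  "eventually P (high_freq \<Gamma>) \<longleftrightarrow>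
     (\<exists>\<sigma>. slow \<sigma> \<and> (\<forall>\<^sub>F \<epsilon> in at_right 0. \<forall>\<xi>\<in>\<Gamma>. \<sigma> \<epsilon> \<le> norm \<xi> \<longrightarrow> P (\<epsilon>, \<xi>)))"
  unfolding high_freq_def
proof (rule eventually_Abs_filter, rule is_filter.intro)
  show "\<exists>\<sigma>. slow \<sigma> \<and> (\<forall>\<^sub>F \<epsilon> in at_right 0. \<forall>\<xi>\<in>\<Gamma>. \<sigma> \<epsilon> \<le> norm \<xi> \<longrightarrow> True)"
    using slow_const[of 0] by auto
next
  fix P Q assume "\<exists>\<sigma>. slow \<sigma> \<and> (\<forall>\<^sub>F \<epsilon> in at_right 0. \<forall>\<xi>\<in>\<Gamma>. \<sigma> \<epsilon> \<le> norm \<xi> \<longrightarrow> P (\<epsilon>, \<xi>))"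
    "\<exists>\<sigma>. slow \<sigma> \<and> (\<forall>\<^sub>F \<epsilon> in at_right 0. \<forall>\<xi>\<in>\<Gamma>. \<sigma> \<epsilon> \<le> norm \<xi> \<longrightarrow> Q (\<epsilon>, \<xi>))"
  then obtain \<sigma> \<tau> where "slow \<sigma>" "slow \<tau>"
    and ev: "\<forall>\<^sub>F \<epsilon> in at_right 0. \<forall>\<xi>\<in>\<Gamma>. \<sigma> \<epsilon> \<le> norm \<xi> \<longrightarrow> P (\<epsilon>, \<xi>)"
      "\<forall>\<^sub>F \<epsilon> in at_right 0. \<forall>\<xi>\<in>\<Gamma>. \<tau> \<epsilon> \<le> norm \<xi> \<longrightarrow> Q (\<epsilon>, \<xi>)" by blast
  then have "slow (\<lambda>\<epsilon>. max (\<sigma> \<epsilon>) (\<tau> \<epsilon>))" by (intro slow_max)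
  moreover have "\<forall>\<^sub>F \<epsilon> in at_right 0. \<forall>\<xi>\<in>\<Gamma>. max (\<sigma> \<epsilon>) (\<tau> \<epsilon>) \<le> norm \<xi> \<longrightarrow> P (\<epsilon>, \<xi>) \<and> Q (\<epsilon>, \<xi>)"
    using ev by eventually_elim auto
  ultimately show "\<exists>\<sigma>. slow \<sigma> \<and> (\<forall>\<^sub>F \<epsilon> in at_right 0. \<forall>\<xi>\<in>\<Gamma>. \<sigma> \<epsilon> \<le> norm \<xi> \<longrightarrow> P (\<epsilon>, \<xi>) \<and> Q (\<epsilon>, \<xi>))"
    by blast
next
  fix P Q assume "\<forall>z. P z \<longrightarrow> Q z" "\<exists>\<sigma>. slow \<sigma> \<and> (\<forall>\<^sub>F \<epsilon> in at_right 0. \<forall>\<xi>\<in>\<Gamma>. \<sigma> \<epsilon> \<le> norm \<xi> \<longrightarrow> P (\<epsilon>, \<xi>))"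
  then show "\<exists>\<sigma>. slow \<sigma> \<and> (\<forall>\<^sub>F \<epsilon> in at_right 0. \<forall>\<xi>\<in>\<Gamma>. \<sigma> \<epsilon> \<le> norm \<xi> \<longrightarrow> Q (\<epsilon>, \<xi>))"
    by (auto elim!: eventually_mono)
qed

lemma eventually_high_freq_fst:
  "\<forall>\<^sub>F \<epsilon> in at_right 0. P \<epsilon> \<Longrightarrow> \<forall>\<^sub>F z in high_freq \<Gamma>. P (fst z)"
  unfolding eventually_high_freq using slow_const[of 0] by (auto elim!: eventually_mono)

lemma eventually_high_freq_cone: "\<forall>\<^sub>F z in high_freq \<Gamma>. snd z \<in> \<Gamma>"
  unfolding eventually_high_freq using slow_const[of 0] by auto

lemma eventually_high_freq_pos: "\<forall>\<^sub>F z in high_freq \<Gamma>. 0 < fst z \<and> fst z < 1"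
  by (rule eventually_high_freq_fst) (auto simp: eventually_at_right_field intro: exI[of _ 1])

section \<open>Slow scale symbols\<close>

text \<open>In a pair \<open>z = (\<epsilon>, \<xi>)\<close> the first component is the parameter and the second the frequency.\<close>

abbreviation freq :: "real \<times> (real ^ 'n::finite) \<Rightarrow> real" where
  "freq z \<equiv> 1 + norm (snd z)"

lemma one_plus_norm [simp]: "0 < 1 + norm x" "1 + norm x \<noteq> 0" "0 \<le> 1 + norm x" "1 \<le> 1 + norm x"
  for x :: "'a::real_normed_vector"
  using norm_ge_zero[of x] by linarith+

text \<open>The weight \<open>W\<close> may depend on \<open>x\<close>.  This is what makes the reciprocal of a symbol \<open>f\<close> with
  weight \<open>|f|\<close> a symbol again, with weight \<open>1/|f|\<close>: the lower bound on \<open>|f|\<close> enters only when this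
  weight is estimated.\<close>

definition slow_bound ::
  "(real ^ 'n::finite) set \<Rightarrow> (real ^ 'n) set \<Rightarrow> (real \<times> (real ^ 'n) \<Rightarrow> real ^ 'n \<Rightarrow> real) \<Rightarrow>
   (real \<times> (real ^ 'n) \<Rightarrow> real ^ 'n \<Rightarrow> complex) \<Rightarrow> bool" where
  "slow_bound \<Gamma> V W f \<longleftrightarrow>
     (\<exists>c. slow c \<and> (\<forall>\<^sub>F z in high_freq \<Gamma>. \<forall>x\<in>V. norm (f z x) \<le> c (fst z) * W z x))"

lemma slow_bound_trans:
  assumes "slow_bound \<Gamma> V W f" "\<forall>\<^sub>F z in high_freq \<Gamma>. \<forall>x\<in>V. norm (g z x) \<le> norm (f z x) \<and> W z x \<le> W' z x"
  shows "slow_bound \<Gamma> V W' g"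
proof -
  obtain c where c: "slow c" "\<forall>\<^sub>F z in high_freq \<Gamma>. \<forall>x\<in>V. norm (f z x) \<le> c (fst z) * W z x"
    using assms(1) unfolding slow_bound_def by blast
  have "\<forall>\<^sub>F z in high_freq \<Gamma>. \<forall>x\<in>V. norm (g z x) \<le> c (fst z) * W' z x"
    using c(2) assms(2) eventually_high_freq_fst[OF slow_nonneg[OF c(1)]]
    by eventually_elim (meson mult_left_mono order_trans)
  with c(1) show ?thesis unfolding slow_bound_def by blast
qed

lemma slow_bound_add:
  assumes "slow_bound \<Gamma> V W f" "slow_bound \<Gamma> V W g"
  shows "slow_bound \<Gamma> V W (\<lambda>z x. f z x + g z x)"
proof -
  obtain c where c: "slow c" "\<forall>\<^sub>F z in high_freq \<Gamma>. \<forall>x\<in>V. norm (f z x) \<le> c (fst z) * W z x"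
    using assms(1) unfolding slow_bound_def by blast
  obtain d where d: "slow d" "\<forall>\<^sub>F z in high_freq \<Gamma>. \<forall>x\<in>V. norm (g z x) \<le> d (fst z) * W z x"
    using assms(2) unfolding slow_bound_def by blast
  have "\<forall>\<^sub>F z in high_freq \<Gamma>. \<forall>x\<in>V. norm (f z x + g z x) \<le> (c (fst z) + d (fst z)) * W z x"
    using c(2) d(2)
    by eventually_elim (unfold distrib_right, meson add_mono norm_triangle_le)
  with slow_add[OF c(1) d(1)] show ?thesis unfolding slow_bound_def by blast
qed

lemma slow_bound_mult:
  assumes "slow_bound \<Gamma> V W1 f" "slow_bound \<Gamma> V W2 g"
  shows "slow_bound \<Gamma> V (\<lambda>z x. W1 z x * W2 z x) (\<lambda>z x. f z x * g z x)"
proof -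
  obtain c where c: "slow c" "\<forall>\<^sub>F z in high_freq \<Gamma>. \<forall>x\<in>V. norm (f z x) \<le> c (fst z) * W1 z x"
    using assms(1) unfolding slow_bound_def by blast
  obtain d where d: "slow d" "\<forall>\<^sub>F z in high_freq \<Gamma>. \<forall>x\<in>V. norm (g z x) \<le> d (fst z) * W2 z x"
    using assms(2) unfolding slow_bound_def by blast
  have "\<forall>\<^sub>F z in high_freq \<Gamma>. \<forall>x\<in>V. norm (f z x * g z x) \<le> (c (fst z) * d (fst z)) * (W1 z x * W2 z x)"
    using c(2) d(2)
  proof eventually_elim
    case (elim z)
    show ?case
    proof
      fix x assume "x \<in> V"
      then have "norm (f z x) * norm (g z x) \<le> (c (fst z) * W1 z x) * (d (fst z) * W2 z x)"
        using elim by (intro mult_mono) (auto intro: order_trans[OF norm_ge_zero])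
      then show "norm (f z x * g z x) \<le> (c (fst z) * d (fst z)) * (W1 z x * W2 z x)"
        by (simp add: norm_mult mult_ac)
    qed
  qed
  with slow_mult[OF c(1) d(1)] show ?thesis unfolding slow_bound_def by blast
qed

lemma slow_bound_const:
  assumes "\<And>z x. x \<in> V \<Longrightarrow> norm (f z x) \<le> B" shows "slow_bound \<Gamma> V (\<lambda>z x. 1) f"
proof -
  have "norm (f z x) \<le> max B 0 * 1" if "x \<in> V" for z x using assms[OF that, of z] by simp
  then show ?thesis unfolding slow_bound_def using slow_const[of "max B 0"]
    by (intro exI[of _ "\<lambda>_. max B 0"]) auto
qed

text \<open>Each derivative costs a factor \<open>(1 + |\<xi>|)\<^sup>\<delta>\<close>.  The recursion on the order \<open>k\<close> reduces every
  closure property to the product, sum or quotient rule for one derivative.\<close>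

primrec slow_symbol ::
  "real \<Rightarrow> (real ^ 'n::finite) set \<Rightarrow> (real ^ 'n) set \<Rightarrow> nat \<Rightarrow> (real \<times> (real ^ 'n) \<Rightarrow> real ^ 'n \<Rightarrow> real) \<Rightarrow>
   (real \<times> (real ^ 'n) \<Rightarrow> real ^ 'n \<Rightarrow> complex) \<Rightarrow> bool" where
  "slow_symbol \<delta> \<Gamma> V 0 W f \<longleftrightarrow> (\<forall>\<^sub>F z in high_freq \<Gamma>. smooth_on V (f z)) \<and> slow_bound \<Gamma> V W f"
| "slow_symbol \<delta> \<Gamma> V (Suc k) W f \<longleftrightarrow> (\<forall>\<^sub>F z in high_freq \<Gamma>. smooth_on V (f z)) \<and> slow_bound \<Gamma> V W f \<and>
     (\<forall>i. slow_symbol \<delta> \<Gamma> V k (\<lambda>z x. W z x * freq z powr \<delta>) (\<lambda>z. pderiv_at i (f z)))"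

lemma slow_symbol_smooth: "slow_symbol \<delta> \<Gamma> V k W f \<Longrightarrow> \<forall>\<^sub>F z in high_freq \<Gamma>. smooth_on V (f z)"
  by (cases k) simp_all

lemma slow_symbol_bound: "slow_symbol \<delta> \<Gamma> V k W f \<Longrightarrow> slow_bound \<Gamma> V W f"
  by (cases k) simp_all

lemma slow_symbol_pderiv:
  "slow_symbol \<delta> \<Gamma> V (Suc k) W f \<Longrightarrow> slow_symbol \<delta> \<Gamma> V k (\<lambda>z x. W z x * freq z powr \<delta>) (\<lambda>z. pderiv_at i (f z))"
  by simp

lemma slow_symbol_Suc_le: "slow_symbol \<delta> \<Gamma> V (Suc k) W f \<Longrightarrow> slow_symbol \<delta> \<Gamma> V k W f"
  by (induction k arbitrary: W f) auto

text \<open>The induction pattern for the closure properties.\<close>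

lemma slow_symbol_SucI:
  assumes "slow_symbol \<delta> \<Gamma> V k W f"
    "\<And>i. slow_symbol \<delta> \<Gamma> V k (\<lambda>z x. W z x * freq z powr \<delta>) (\<lambda>z. pderiv_at i (f z))"
  shows "slow_symbol \<delta> \<Gamma> V (Suc k) W f"
  using slow_symbol_smooth[OF assms(1)] slow_symbol_bound[OF assms(1)] assms(2) by simp

lemma slow_symbol_cong:
  assumes V: "open V"
  shows "slow_symbol \<delta> \<Gamma> V k W f \<Longrightarrow> \<forall>\<^sub>F z in high_freq \<Gamma>. \<forall>x\<in>V. f z x = g z x \<Longrightarrow> slow_symbol \<delta> \<Gamma> V k W g"
proof (induction k arbitrary: W f g)
  case 0
  have "\<forall>\<^sub>F z in high_freq \<Gamma>. smooth_on V (g z)"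
    using slow_symbol_smooth[OF 0(1)] 0(2) by eventually_elim (use smooth_on_cong[OF V] in blast)
  moreover have "slow_bound \<Gamma> V W g"
    by (rule slow_bound_trans[OF slow_symbol_bound[OF 0(1)]]) (use 0(2) in eventually_elim, simp)
  ultimately show ?case by simp
next
  case (Suc k)
  have "\<forall>\<^sub>F z in high_freq \<Gamma>. \<forall>x\<in>V. pderiv_at i (f z) x = pderiv_at i (g z) x" for i
    using Suc.prems(2) by eventually_elim (use pderiv_at_cong_open[OF V] in blast)
  from Suc.IH[OF slow_symbol_pderiv[OF Suc.prems(1)] this] Suc.IH[OF slow_symbol_Suc_le[OF Suc.prems(1)] Suc.prems(2)]
  show ?case by (intro slow_symbol_SucI)
qed

lemma slow_symbol_weight_mono:
  "slow_symbol \<delta> \<Gamma> V k W f \<Longrightarrow> \<forall>\<^sub>F z in high_freq \<Gamma>. \<forall>x\<in>V. W z x \<le> W' z x \<Longrightarrow> slow_symbol \<delta> \<Gamma> V k W' f"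
proof (induction k arbitrary: W W' f)
  case 0
  then have "slow_bound \<Gamma> V W' f"
    by (intro slow_bound_trans[OF slow_symbol_bound[OF 0(1)]]) (auto elim: eventually_mono)
  then show ?case using slow_symbol_smooth[OF 0(1)] by simp
next
  case (Suc k)
  have "\<forall>\<^sub>F z in high_freq \<Gamma>. \<forall>x\<in>V. W z x * freq z powr \<delta> \<le> W' z x * freq z powr \<delta>"
    using Suc.prems(2) by eventually_elim (simp add: mult_right_mono)
  from Suc.IH[OF slow_symbol_pderiv[OF Suc.prems(1)] this] Suc.IH[OF slow_symbol_Suc_le[OF Suc.prems(1)] Suc.prems(2)]
  show ?case by (intro slow_symbol_SucI)
qed

lemma slow_symbol_add:
  assumes V: "open V"
  shows "slow_symbol \<delta> \<Gamma> V k W f \<Longrightarrow> slow_symbol \<delta> \<Gamma> V k W g \<Longrightarrow> slow_symbol \<delta> \<Gamma> V k W (\<lambda>z x. f z x + g z x)"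
proof (induction k arbitrary: W f g)
  case 0
  have "\<forall>\<^sub>F z in high_freq \<Gamma>. smooth_on V (\<lambda>x. f z x + g z x)"
    using slow_symbol_smooth[OF 0(1)] slow_symbol_smooth[OF 0(2)] by eventually_elim (intro smooth_on_add V)
  then show ?case using slow_bound_add[OF slow_symbol_bound[OF 0(1)] slow_symbol_bound[OF 0(2)]] by simp
next
  case (Suc k)
  show ?case
  proof (rule slow_symbol_SucI)
    show "slow_symbol \<delta> \<Gamma> V k W (\<lambda>z x. f z x + g z x)"
      by (rule Suc.IH[OF slow_symbol_Suc_le[OF Suc.prems(1)] slow_symbol_Suc_le[OF Suc.prems(2)]])
    show "slow_symbol \<delta> \<Gamma> V k (\<lambda>z x. W z x * freq z powr \<delta>) (\<lambda>z. pderiv_at i (\<lambda>x. f z x + g z x))" for i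
      by (rule slow_symbol_cong[OF V Suc.IH[OF slow_symbol_pderiv[where i = i, OF Suc.prems(1)] slow_symbol_pderiv[where i = i, OF Suc.prems(2)]]])
         (use slow_symbol_smooth[OF Suc.prems(1)] slow_symbol_smooth[OF Suc.prems(2)] in eventually_elim, simp add: pderiv_at_add)
  qed
qed

lemma slow_symbol_mult:
  assumes V: "open V"
  shows "slow_symbol \<delta> \<Gamma> V k W1 f \<Longrightarrow> slow_symbol \<delta> \<Gamma> V k W2 g \<Longrightarrow>
    slow_symbol \<delta> \<Gamma> V k (\<lambda>z x. W1 z x * W2 z x) (\<lambda>z x. f z x * g z x)"
proof (induction k arbitrary: f g W1 W2)
  case 0
  have "\<forall>\<^sub>F z in high_freq \<Gamma>. smooth_on V (\<lambda>x. f z x * g z x)"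
    using slow_symbol_smooth[OF 0(1)] slow_symbol_smooth[OF 0(2)] by eventually_elim (intro smooth_on_mult V)
  then show ?case using slow_bound_mult[OF slow_symbol_bound[OF 0(1)] slow_symbol_bound[OF 0(2)]] by simp
next
  case (Suc k)
  note k = slow_symbol_Suc_le[OF Suc.prems(1)] slow_symbol_Suc_le[OF Suc.prems(2)]
  show ?case
  proof (rule slow_symbol_SucI[OF Suc.IH[OF k]])
    fix i
    let ?W = "\<lambda>z x. W1 z x * W2 z x * freq z powr \<delta>"
    have 1: "slow_symbol \<delta> \<Gamma> V k ?W (\<lambda>z x. pderiv_at i (f z) x * g z x)"
      using Suc.IH[OF slow_symbol_pderiv[OF Suc.prems(1)] k(2), of i] by (simp add: mult_ac)
    have 2: "slow_symbol \<delta> \<Gamma> V k ?W (\<lambda>z x. f z x * pderiv_at i (g z) x)"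
      using Suc.IH[OF k(1) slow_symbol_pderiv[OF Suc.prems(2)], of i] by (simp add: mult_ac)
    show "slow_symbol \<delta> \<Gamma> V k ?W (\<lambda>z. pderiv_at i (\<lambda>x. f z x * g z x))"
      by (rule slow_symbol_cong[OF V slow_symbol_add[OF V 1 2]])
         (use slow_symbol_smooth[OF k(1)] slow_symbol_smooth[OF k(2)] in eventually_elim, simp add: pderiv_at_mult)
  qed
qed

text \<open>Functions of \<open>x\<close> alone are symbols of weight \<open>1\<close>, because \<open>\<delta> \<ge> 0\<close>.\<close>

lemma slow_symbol_fixed:
  assumes "0 \<le> \<delta>" "\<And>is. bounded (partials is f ` V)" "smooth_on V f"
  shows "slow_symbol \<delta> \<Gamma> V k (\<lambda>z x. 1) (\<lambda>z. f)"
  using assms(2,3)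
proof (induction k arbitrary: f)
  case 0
  obtain B where "\<And>x. x \<in> V \<Longrightarrow> norm (f x) \<le> B" using 0(1)[of "[]"] by (auto simp: bounded_iff)
  then show ?case using 0(2) slow_bound_const[of V "\<lambda>z. f" B] by simp
next
  case (Suc k)
  have "slow_symbol \<delta> \<Gamma> V k (\<lambda>z x. 1) (\<lambda>z. pderiv_at i f)" for i
    using Suc.prems by (intro Suc.IH smooth_on_pderiv) (auto simp: partials_snoc[symmetric])
  then have "slow_symbol \<delta> \<Gamma> V k (\<lambda>z x. 1 * freq z powr \<delta>) (\<lambda>z. pderiv_at i f)" for i
    by (rule slow_symbol_weight_mono) (use assms(1) in \<open>simp add: ge_one_powr_ge_zero\<close>)
  then show ?case using Suc.prems by (intro slow_symbol_SucI Suc.IH)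
qed

lemma slow_symbol_cmult:
  assumes V: "open V" and f: "slow_symbol \<delta> \<Gamma> V k W f"
  shows "slow_symbol \<delta> \<Gamma> V k W (\<lambda>z x. c * f z x)"
  using f
proof (induction k arbitrary: W f)
  case 0
  have "slow_bound \<Gamma> V (\<lambda>z x. 1 * W z x) (\<lambda>z x. c * f z x)"
    by (intro slow_bound_mult slow_symbol_bound[OF 0] slow_bound_const) (rule order_refl)
  moreover have "\<forall>\<^sub>F z in high_freq \<Gamma>. smooth_on V (\<lambda>x. c * f z x)"
    using slow_symbol_smooth[OF 0] by eventually_elim (intro smooth_on_mult smooth_on_const V)
  ultimately show ?case by simp
next
  case (Suc k)
  show ?case
  proof (rule slow_symbol_SucI[OF Suc.IH[OF slow_symbol_Suc_le[OF Suc.prems]]])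
    show "slow_symbol \<delta> \<Gamma> V k (\<lambda>z x. W z x * freq z powr \<delta>) (\<lambda>z. pderiv_at i (\<lambda>x. c * f z x))" for i
      by (rule slow_symbol_cong[OF V Suc.IH[OF slow_symbol_pderiv[where i = i, OF Suc.prems]]])
         (use slow_symbol_smooth[OF Suc.prems] in eventually_elim, simp add: pderiv_at_cmult)
  qed
qed

lemma slow_symbol_sum:
  assumes "open V" "\<And>z x. 0 \<le> W z x" "\<And>a. a \<in> S \<Longrightarrow> slow_symbol \<delta> \<Gamma> V k W (f a)"
  shows "slow_symbol \<delta> \<Gamma> V k W (\<lambda>z x. \<Sum>a\<in>S. f a z x)"
proof -
  have zero: "slow_symbol \<delta> \<Gamma> V k W (\<lambda>z x. 0)"
    using assms(2)
  proof (induction k arbitrary: W)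
    case 0
    then show ?case using slow_const[of 0] by (auto simp: slow_bound_def smooth_on_const assms(1))
  next
    case (Suc k)
    then show ?case by (intro slow_symbol_SucI) (auto simp: pderiv_at_const[abs_def])
  qed
  show ?thesis
    using assms(3) by (induction S rule: infinite_finite_induct) (auto intro: zero slow_symbol_add assms(1))
qed

text \<open>The derivative \<open>- \<partial>f / f\<^sup>2\<close> has weight \<open>|f| \<langle>\<xi>\<rangle>^\<delta> / |f|\<^sup>2\<close>, which is \<open>\<langle>\<xi>\<rangle>^\<delta>\<close> times the
  weight of \<open>1 / f\<close>.\<close>

lemma slow_symbol_inverse:
  assumes V: "open V" and nz: "\<forall>\<^sub>F z in high_freq \<Gamma>. \<forall>x\<in>V. f z x \<noteq> 0"
  shows "slow_symbol \<delta> \<Gamma> V k (\<lambda>z x. norm (f z x)) f \<Longrightarrow>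
    slow_symbol \<delta> \<Gamma> V k (\<lambda>z x. inverse (norm (f z x))) (\<lambda>z x. inverse (f z x))"
proof (induction k)
  case 0
  have "\<forall>\<^sub>F z in high_freq \<Gamma>. smooth_on V (\<lambda>x. inverse (f z x))"
    using slow_symbol_smooth[OF 0] nz by eventually_elim (use smooth_on_inverse[OF V] in blast)
  then show ?case unfolding slow_symbol.simps slow_bound_def using slow_const[of 1]
    by (intro conjI exI[of _ "\<lambda>_. 1"]) (auto simp: norm_inverse)
next
  case (Suc k)
  have IH: "slow_symbol \<delta> \<Gamma> V k (\<lambda>z x. inverse (norm (f z x))) (\<lambda>z x. inverse (f z x))"
    by (rule Suc.IH[OF slow_symbol_Suc_le[OF Suc.prems]])
  show ?case
  proof (rule slow_symbol_SucI[OF IH])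
    fix i
    have "slow_symbol \<delta> \<Gamma> V k (\<lambda>z x. (norm (f z x) * freq z powr \<delta>) * (inverse (norm (f z x)) * inverse (norm (f z x))))
       (\<lambda>z x. - 1 * (pderiv_at i (f z) x * (inverse (f z x) * inverse (f z x))))"
      by (intro slow_symbol_cmult[OF V] slow_symbol_mult[OF V] IH slow_symbol_pderiv Suc.prems)
    then have "slow_symbol \<delta> \<Gamma> V k (\<lambda>z x. inverse (norm (f z x)) * freq z powr \<delta>)
       (\<lambda>z x. - 1 * (pderiv_at i (f z) x * (inverse (f z x) * inverse (f z x))))"
      by (rule slow_symbol_weight_mono) (rule eventually_mono[OF nz], simp add: field_simps)
    then show "slow_symbol \<delta> \<Gamma> V k (\<lambda>z x. inverse (norm (f z x)) * freq z powr \<delta>) (\<lambda>z. pderiv_at i (\<lambda>x. inverse (f z x)))"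
      by (rule slow_symbol_cong[OF V])
         (use slow_symbol_smooth[OF Suc.prems] nz in eventually_elim, simp add: pderiv_at_inverse)
  qed
qed

lemma slow_symbol_partials:
  "slow_symbol \<delta> \<Gamma> V (k + length js) W f \<Longrightarrow>
   slow_symbol \<delta> \<Gamma> V k (\<lambda>z x. W z x * freq z powr (\<delta> * real (length js))) (\<lambda>z. partials js (f z))"
proof (induction js arbitrary: k)
  case (Cons j js)
  then have "slow_symbol \<delta> \<Gamma> V (Suc k + length js) W f" by simp
  from slow_symbol_pderiv[OF Cons.IH[OF this], of j] show ?case
    by (simp add: partials_Cons distrib_left powr_add mult_ac)
qed simp

lemma slow_symbolI:
  assumes "\<forall>\<^sub>F z in high_freq \<Gamma>. smooth_on V (f z)"
    "\<And>is. slow_bound \<Gamma> V (\<lambda>z x. W z x * freq z powr (\<delta> * real (length is))) (\<lambda>z. partials is (f z))"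
  shows "slow_symbol \<delta> \<Gamma> V k W f"
  using assms
proof (induction k arbitrary: W f)
  case 0
  then show ?case using 0(2)[of "[]"] by simp
next
  case (Suc k)
  show ?case
  proof (rule slow_symbol_SucI[OF Suc.IH[OF Suc.prems]])
    fix i
    show "slow_symbol \<delta> \<Gamma> V k (\<lambda>z x. W z x * freq z powr \<delta>) (\<lambda>z. pderiv_at i (f z))"
    proof (rule Suc.IH)
      show "\<forall>\<^sub>F z in high_freq \<Gamma>. smooth_on V (pderiv_at i (f z))"
        using Suc.prems(1) by eventually_elim (rule smooth_on_pderiv)
      show "slow_bound \<Gamma> V (\<lambda>z x. W z x * freq z powr \<delta> * freq z powr (\<delta> * real (length is))) (\<lambda>z. partials is (pderiv_at i (f z)))" for "is"
        using Suc.prems(2)[of "is @ [i]"] by (simp add: partials_snoc distrib_left powr_add mult_ac)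
    qed
  qed
qed

section \<open>Rapid decay\<close>

definition rapidly_decreasing :: "(real ^ 'n::finite) set \<Rightarrow> (real \<Rightarrow> real ^ 'n \<Rightarrow> complex) \<Rightarrow> bool" where
  "rapidly_decreasing \<Gamma> F \<longleftrightarrow>
     (\<exists>N. \<forall>l::nat. \<forall>\<^sub>F \<epsilon> in at_right 0. \<forall>\<xi>\<in>\<Gamma>. norm (F \<epsilon> \<xi>) * (1 + norm \<xi>) ^ l \<le> \<epsilon> powr (- N))"

lemma eventually_at_right_0_small: "0 < e \<Longrightarrow> \<forall>\<^sub>F \<epsilon> in at_right (0::real). 0 < \<epsilon> \<and> \<epsilon> < e"
  unfolding eventually_at_right_field by auto

lemma slow_le_inverse: "slow c \<Longrightarrow> \<forall>\<^sub>F \<epsilon> in at_right 0. c \<epsilon> \<le> 1 / \<epsilon>"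
  using slow_power_le[of c 1] by simp

text \<open>How slow scale factors disappear: one power of \<open>1/\<epsilon>\<close> pays for any of them.\<close>

lemma mult_powr_absorb:
  fixes \<epsilon> c N :: real
  assumes "0 < \<epsilon>" "c \<le> 1 / \<epsilon>"
  shows "c * \<epsilon> powr (- N) \<le> \<epsilon> powr (- (N + 1))"
proof -
  have "c * \<epsilon> powr (- N) \<le> 1 / \<epsilon> * \<epsilon> powr (- N)" by (rule mult_right_mono[OF assms(2)]) simp
  also have "1 / \<epsilon> = \<epsilon> powr (- 1)" using assms(1) by (simp add: powr_minus_divide)
  also have "\<epsilon> powr (- 1) * \<epsilon> powr (- N) = \<epsilon> powr (- (N + 1))"
  proof -
    have "- 1 + - N = - (N + 1)" by simp
    then show ?thesis by (simp only: powr_add[symmetric])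
  qed
  finally show ?thesis .
qed

text \<open>The constants \<open>C\<close> depend on \<open>l\<close> but are absorbed by one factor \<open>1/\<epsilon>\<close>, so that the
  exponent remains independent of \<open>l\<close>.\<close>

lemma rapidly_decreasing_iff:
  "rapidly_decreasing \<Gamma> F \<longleftrightarrow> (\<exists>N::real. \<forall>l::nat. \<exists>C>0. \<exists>\<epsilon>\<^sub>0>0. \<forall>\<xi>\<in>\<Gamma>. \<forall>\<epsilon>\<in>{0<..<\<epsilon>\<^sub>0}.
     norm (F \<epsilon> \<xi>) \<le> C * \<epsilon> powr (- N) * (1 + norm \<xi>) powr (- real l))"
proof -
  have conv: "a \<le> b * (1 + norm \<xi>) powr (- real l) \<longleftrightarrow> a * (1 + norm \<xi>) ^ l \<le> b" for a b l and \<xi> :: "real^'a"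
    by (simp add: powr_minus powr_realpow field_simps)
  show ?thesis
  proof
    assume "rapidly_decreasing \<Gamma> F"
    then obtain N where N: "\<And>l::nat. \<forall>\<^sub>F \<epsilon> in at_right 0. \<forall>\<xi>\<in>\<Gamma>. norm (F \<epsilon> \<xi>) * (1 + norm \<xi>) ^ l \<le> \<epsilon> powr (- N)"
      unfolding rapidly_decreasing_def by blast
    show "\<exists>N::real. \<forall>l::nat. \<exists>C>0. \<exists>\<epsilon>\<^sub>0>0. \<forall>\<xi>\<in>\<Gamma>. \<forall>\<epsilon>\<in>{0<..<\<epsilon>\<^sub>0}.
     norm (F \<epsilon> \<xi>) \<le> C * \<epsilon> powr (- N) * (1 + norm \<xi>) powr (- real l)"
    proof (rule exI[of _ N], rule allI)
      fix l
      obtain e where "e > 0" "\<And>\<epsilon>. 0 < \<epsilon> \<Longrightarrow> \<epsilon> < e \<Longrightarrow> \<forall>\<xi>\<in>\<Gamma>. norm (F \<epsilon> \<xi>) * (1 + norm \<xi>) ^ l \<le> \<epsilon> powr (- N)"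
        using N[of l] unfolding eventually_at_right_field by (elim exE conjE) blast
      then show "\<exists>C>0. \<exists>\<epsilon>\<^sub>0>0. \<forall>\<xi>\<in>\<Gamma>. \<forall>\<epsilon>\<in>{0<..<\<epsilon>\<^sub>0}. norm (F \<epsilon> \<xi>) \<le> C * \<epsilon> powr (- N) * (1 + norm \<xi>) powr (- real l)"
        unfolding conv by (intro exI[of _ 1] conjI exI[of _ e]) auto
    qed
  next
    assume "\<exists>N::real. \<forall>l::nat. \<exists>C>0. \<exists>\<epsilon>\<^sub>0>0. \<forall>\<xi>\<in>\<Gamma>. \<forall>\<epsilon>\<in>{0<..<\<epsilon>\<^sub>0}.
     norm (F \<epsilon> \<xi>) \<le> C * \<epsilon> powr (- N) * (1 + norm \<xi>) powr (- real l)"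
    then obtain N where N: "\<And>l::nat. \<exists>C>0. \<exists>\<epsilon>\<^sub>0>0. \<forall>\<xi>\<in>\<Gamma>. \<forall>\<epsilon>\<in>{0<..<\<epsilon>\<^sub>0}.
     norm (F \<epsilon> \<xi>) \<le> C * \<epsilon> powr (- N) * (1 + norm \<xi>) powr (- real l)" by blast
    show "rapidly_decreasing \<Gamma> F"
      unfolding rapidly_decreasing_def
    proof (intro exI[of _ "N + 1"] allI)
      fix l
      obtain C e where C: "C > 0" "e > 0" "\<And>\<xi> \<epsilon>. \<xi> \<in> \<Gamma> \<Longrightarrow> \<epsilon> \<in> {0<..<e} \<Longrightarrow>
          norm (F \<epsilon> \<xi>) * (1 + norm \<xi>) ^ l \<le> C * \<epsilon> powr (- N)"
        using N[of l] unfolding conv by (elim exE conjE) blast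
      show "\<forall>\<^sub>F \<epsilon> in at_right 0. \<forall>\<xi>\<in>\<Gamma>. norm (F \<epsilon> \<xi>) * (1 + norm \<xi>) ^ l \<le> \<epsilon> powr (- (N + 1))"
        using eventually_at_right_0_small[OF C(2)] slow_le_inverse[OF slow_const[OF less_imp_le[OF C(1)]]]
      proof eventually_elim
        case (elim \<epsilon>)
        then have "C * \<epsilon> powr (- N) \<le> \<epsilon> powr (- (N + 1))" by (intro mult_powr_absorb) auto
        then show ?case using C(3)[of _ \<epsilon>] elim by fastforce
      qed
    qed
  qed
qed

lemma microlocally_regular_net_iff:
  "microlocally_regular_net \<Omega> u x \<xi> \<longleftrightarrow>
     (\<exists>U \<Gamma>. open U \<and> U \<subseteq> \<Omega> \<and> x \<in> U \<and> open_cone \<Gamma> \<and> \<xi> \<in> \<Gamma> \<and>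
       (\<forall>\<phi>\<in>test_functions U. rapidly_decreasing \<Gamma> (\<lambda>\<epsilon>. fourier (\<lambda>x. \<phi> x * u \<epsilon> x))))"
  unfolding microlocally_regular_net_def rapidly_decreasing_iff ..

text \<open>Below a slow scale radius any power of \<open>1 + |\<xi>|\<close> is at most \<open>1/\<epsilon>\<close>, so decay has to be
  shown at high frequencies only.\<close>

lemma rapidly_decreasing_high_freqI:
  assumes bd: "\<forall>\<^sub>F \<epsilon> in at_right 0. \<forall>\<xi>. norm (F \<epsilon> \<xi>) \<le> \<epsilon> powr (- M)"
    and hf: "\<And>l::nat. \<forall>\<^sub>F z in high_freq \<Gamma>. norm (F (fst z) (snd z)) * freq z ^ l \<le> fst z powr (- N)"
  shows "rapidly_decreasing \<Gamma> F"
  unfolding rapidly_decreasing_def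
proof (intro exI[of _ "max (M + 1) N"] allI)
  fix l
  obtain \<sigma> where \<sigma>: "slow \<sigma>"
    "\<forall>\<^sub>F \<epsilon> in at_right 0. \<forall>\<xi>\<in>\<Gamma>. \<sigma> \<epsilon> \<le> norm \<xi> \<longrightarrow> norm (F \<epsilon> \<xi>) * (1 + norm \<xi>) ^ l \<le> \<epsilon> powr (- N)"
    using hf[of l] unfolding eventually_high_freq by auto
  have "slow (\<lambda>\<epsilon>. 1 + \<sigma> \<epsilon>)" by (intro slow_add slow_const \<sigma>) simp
  then have "\<forall>\<^sub>F \<epsilon> in at_right 0. (1 + \<sigma> \<epsilon>) ^ l \<le> 1 / \<epsilon>" by (rule slow_power_le)
  then show "\<forall>\<^sub>F \<epsilon> in at_right 0. \<forall>\<xi>\<in>\<Gamma>. norm (F \<epsilon> \<xi>) * (1 + norm \<xi>) ^ l \<le> \<epsilon> powr (- max (M + 1) N)"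
    using \<sigma>(2) bd eventually_at_right_0_small[of 1, simplified]
  proof eventually_elim
    case (elim \<epsilon>)
    have mono: "\<epsilon> powr (- a) \<le> \<epsilon> powr (- b)" if "a \<le> b" for a b
      using elim that by (simp add: powr_le_cancel_iff powr_mono_both' less_imp_le powr_mono')
    show ?case
    proof
      fix \<xi> assume "\<xi> \<in> \<Gamma>"
      show "norm (F \<epsilon> \<xi>) * (1 + norm \<xi>) ^ l \<le> \<epsilon> powr (- max (M + 1) N)"
      proof (cases "\<sigma> \<epsilon> \<le> norm \<xi>")
        case True
        then show ?thesis using elim(2) \<open>\<xi> \<in> \<Gamma>\<close> mono[of N "max (M + 1) N"] by force
      next
        case False
        then have "(1 + norm \<xi>) ^ l \<le> (1 + \<sigma> \<epsilon>) ^ l" by (intro power_mono) auto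
        then have "(1 + norm \<xi>) ^ l \<le> 1 / \<epsilon>" using elim(1) by linarith
        then have "norm (F \<epsilon> \<xi>) * (1 + norm \<xi>) ^ l \<le> \<epsilon> powr (- M) * (1 / \<epsilon>)"
          using elim(3) by (intro mult_mono) auto
        also have "\<dots> \<le> \<epsilon> powr (- (M + 1))"
          using mult_powr_absorb[of \<epsilon> "1 / \<epsilon>" M] elim by (simp add: mult.commute)
        also have "\<dots> \<le> \<epsilon> powr (- max (M + 1) N)" by (rule mono) simp
        finally show ?thesis .
      qed
    qed
  qed
qed

section \<open>Cones\<close>

lemma open_cone_Int: "open_cone A \<Longrightarrow> open_cone B \<Longrightarrow> open_cone (A \<inter> B)"
  unfolding open_cone_def by auto

text \<open>If the ball of radius \<open>r\<close> around the direction of \<open>\<xi>\<^sub>1\<close> lies in \<open>\<Gamma>\<close>, then \<open>\<Gamma>'\<close> consists of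
  the directions at distance less than \<open>r/2\<close>.  By homogeneity, a point outside \<open>\<Gamma>\<close> has distance at
  least \<open>r/2 |\<xi>|\<close> from \<open>\<xi> \<in> \<Gamma>'\<close>.\<close>

lemma open_cone_shrink:
  fixes \<Gamma> :: "(real^'n::finite) set"
  assumes "open_cone \<Gamma>" "\<xi>\<^sub>1 \<in> \<Gamma>"
  obtains \<Gamma>' c where "open_cone \<Gamma>'" "\<xi>\<^sub>1 \<in> \<Gamma>'" "\<Gamma>' \<subseteq> \<Gamma>" "0 < c" "c \<le> 1 / 2"
    "\<And>\<xi> \<eta>. \<xi> \<in> \<Gamma>' \<Longrightarrow> \<eta> \<notin> \<Gamma> \<Longrightarrow> c * norm \<xi> \<le> norm (\<xi> - \<eta>)"
proof -
  have ne: "\<xi>\<^sub>1 \<noteq> 0" using assms unfolding open_cone_def by auto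
  have scale: "t *\<^sub>R \<xi> \<in> \<Gamma>" if "\<xi> \<in> \<Gamma>" "t > 0" for \<xi> t using assms(1) that unfolding open_cone_def by blast
  have "sgn \<xi>\<^sub>1 \<in> \<Gamma>" unfolding sgn_div_norm using scale[OF assms(2)] ne by simp
  then obtain r0 where r0: "r0 > 0" "ball (sgn \<xi>\<^sub>1) r0 \<subseteq> \<Gamma>"
    using assms(1) open_contains_ball unfolding open_cone_def by blast
  define r where "r = min r0 1"
  have r: "r > 0" "r \<le> 1" "ball (sgn \<xi>\<^sub>1) r \<subseteq> \<Gamma>" using r0 by (auto simp: r_def)
  define \<Gamma>' where "\<Gamma>' = {\<xi>. \<xi> \<noteq> 0 \<and> dist (sgn \<xi>\<^sub>1) (sgn \<xi>) < r / 2}"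
  have near: "\<eta> \<in> \<Gamma>" if "\<xi> \<in> \<Gamma>'" "norm (\<xi> - \<eta>) < r / 2 * norm \<xi>" for \<xi> \<eta>
  proof -
    have "\<xi> \<noteq> 0" using that by (simp add: \<Gamma>'_def)
    have "dist (sgn \<xi>) (\<eta> /\<^sub>R norm \<xi>) = norm (\<xi> - \<eta>) / norm \<xi>"
      by (simp add: dist_norm sgn_div_norm scaleR_diff_right[symmetric] divide_inverse mult.commute)
    also have "\<dots> < r / 2" using that(2) \<open>\<xi> \<noteq> 0\<close> by (simp add: pos_divide_less_eq)
    finally have "dist (sgn \<xi>\<^sub>1) (\<eta> /\<^sub>R norm \<xi>) < r"
      using that(1) dist_triangle[of "sgn \<xi>\<^sub>1" "\<eta> /\<^sub>R norm \<xi>" "sgn \<xi>"] unfolding \<Gamma>'_def by auto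
    then have "\<eta> /\<^sub>R norm \<xi> \<in> \<Gamma>" using r(3) by auto
    from scale[OF this, of "norm \<xi>"] show ?thesis using \<open>\<xi> \<noteq> 0\<close> by simp
  qed
  have "open \<Gamma>'"
  proof -
    have "continuous_on (- {0}) (\<lambda>\<xi>::real^'n. dist (sgn \<xi>\<^sub>1) (sgn \<xi>))"
      by (intro continuous_intros) auto
    then have "open ((- {0}) \<inter> (\<lambda>\<xi>. dist (sgn \<xi>\<^sub>1) (sgn \<xi>)) -` {..<r/2})"
      by (intro continuous_open_preimage) auto
    also have "(- {0}) \<inter> (\<lambda>\<xi>. dist (sgn \<xi>\<^sub>1) (sgn \<xi>)) -` {..<r/2} = \<Gamma>'" by (auto simp: \<Gamma>'_def)
    finally show ?thesis .
  qed
  then have "open_cone \<Gamma>'"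
    unfolding open_cone_def by (auto simp: \<Gamma>'_def sgn_scaleR)
  moreover have "\<xi>\<^sub>1 \<in> \<Gamma>'" using ne r by (simp add: \<Gamma>'_def)
  moreover have "\<Gamma>' \<subseteq> \<Gamma>"
  proof
    fix \<xi> assume "\<xi> \<in> \<Gamma>'"
    then show "\<xi> \<in> \<Gamma>" by (rule near) (use \<open>\<xi> \<in> \<Gamma>'\<close> r in \<open>auto simp: \<Gamma>'_def\<close>)
  qed
  moreover have "r / 2 * norm \<xi> \<le> norm (\<xi> - \<eta>)" if "\<xi> \<in> \<Gamma>'" "\<eta> \<notin> \<Gamma>" for \<xi> \<eta>
    using near[OF that(1)] that(2) by force
  ultimately show thesis using r by (intro that[of \<Gamma>' "r / 2"]) auto
qed

section \<open>Symbols paired with microlocally regular nets\<close>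

lemma finite_lists_length_le_UNIV: "finite {is :: 'n::finite list. length is \<le> k}"
  using finite_lists_length_le[of "UNIV :: 'n set" k] by simp

text \<open>There are finitely many derivatives of bounded order, and slow scale nets are closed under
  finite sums.\<close>

lemma slow_symbol_uniform_bound:
  assumes f: "\<And>k. slow_symbol \<delta> \<Gamma> V k W f" and W0: "\<And>z x. 0 \<le> W z x"
  obtains c where "slow c" "\<forall>\<^sub>F z in high_freq \<Gamma>. \<forall>is. length is \<le> k \<longrightarrow> (\<forall>x\<in>V.
        norm (partials is (f z) x) \<le> c (fst z) * (W z x * freq z powr (\<delta> * real (length is))))"
proof -
  let ?B = "\<lambda>c is z. \<forall>x\<in>V. norm (partials is (f z) x) \<le> c (fst z) * (W z x * freq z powr (\<delta> * real (length is)))"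
  have "\<exists>c. slow c \<and> (\<forall>\<^sub>F z in high_freq \<Gamma>. \<forall>is\<in>S. ?B c is z)" if "finite S" for S
    using that
  proof (induction S rule: finite_induct)
    case empty
    then show ?case using slow_const[of 0] by auto
  next
    case (insert js S)
    then obtain c where c: "slow c" "\<forall>\<^sub>F z in high_freq \<Gamma>. \<forall>is\<in>S. ?B c is z" by auto
    obtain d where d: "slow d" "\<forall>\<^sub>F z in high_freq \<Gamma>. ?B d js z"
      using slow_symbol_bound[OF slow_symbol_partials[OF f]] unfolding slow_bound_def by blast
    have "\<forall>\<^sub>F z in high_freq \<Gamma>. \<forall>is\<in>insert js S. ?B (\<lambda>\<epsilon>. c \<epsilon> + d \<epsilon>) is z"
      using c(2) d(2) eventually_high_freq_fst[OF slow_nonneg[OF c(1)]] eventually_high_freq_fst[OF slow_nonneg[OF d(1)]]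
    proof eventually_elim
      case (elim z)
      have up: "N \<le> (c (fst z) + d (fst z)) * B" if "N \<le> c (fst z) * B \<or> N \<le> d (fst z) * B" "0 \<le> B" for N B
      proof -
        have "0 \<le> c (fst z) * B" "0 \<le> d (fst z) * B" using elim(3,4) that(2) by auto
        then show ?thesis using that(1) by (auto simp: distrib_right)
      qed
      show ?case using elim(1,2) W0 by (intro ballI up) auto
    qed
    with slow_add[OF c(1) d(1)] show ?case by blast
  qed
  from this[OF finite_lists_length_le_UNIV[of k]] show thesis using that by auto
qed

text \<open>In \<open>fourier_product_decay\<close>, the \<open>k + n\<close> derivatives of the symbol that produce the decay
  of its transform cost \<open>\<langle>\<xi>\<rangle>^{\<delta>(k + n)}\<close> and gain \<open>\<langle>\<xi>\<rangle>^{-k}\<close>, so a large \<open>k\<close> wins because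
  \<open>\<delta> < 1\<close>; the decay of \<open>h\<close> in the cone is available to any order \<open>l'\<close>.  The constants depend on
  \<open>k\<close> and \<open>l'\<close> through slow scale nets only, which add \<open>1\<close> to the exponent of \<open>1/\<epsilon>\<close>.\<close>

theorem symbol_pairing_decay:
  fixes g :: "real \<times> (real ^ 'n::finite) \<Rightarrow> real ^ 'n \<Rightarrow> complex" and h :: "real \<Rightarrow> real ^ 'n \<Rightarrow> complex"
  assumes V: "open V" "compact K" "K \<subseteq> V" and \<delta>: "0 \<le> \<delta>" "\<delta> < 1"
    and g: "\<And>k. slow_symbol \<delta> \<Gamma>' V k W g"
    and W0: "\<And>z x. 0 \<le> W z x"
    and W: "\<forall>\<^sub>F z in high_freq \<Gamma>'. \<forall>x\<in>V. W z x \<le> fst z powr (- q) * freq z powr d"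
    and supp: "\<forall>\<^sub>F z in high_freq \<Gamma>'. \<forall>x. x \<notin> K \<longrightarrow> g z x = 0"
    and h: "\<forall>\<^sub>F \<epsilon> in at_right 0. integrable lborel (h \<epsilon>)"
    and hB: "\<forall>\<^sub>F \<epsilon> in at_right 0. \<forall>\<eta>. norm (fourier (h \<epsilon>) \<eta>) \<le> \<epsilon> powr (- M)"
    and hA: "\<And>l::nat. \<forall>\<^sub>F \<epsilon> in at_right 0. \<forall>\<eta>\<in>\<Gamma>. norm (fourier (h \<epsilon>) \<eta>) * (1 + norm \<eta>) ^ l \<le> \<epsilon> powr (- N)"
    and c: "0 < c" "c \<le> 1 / 2" "\<And>\<xi> \<eta>. \<xi> \<in> \<Gamma>' \<Longrightarrow> \<eta> \<notin> \<Gamma> \<Longrightarrow> c * norm \<xi> \<le> norm (\<xi> - \<eta>)"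
  shows "\<forall>\<^sub>F z in high_freq \<Gamma>'. norm (fourier (\<lambda>x. g z x * h (fst z) x) (snd z)) * freq z ^ l
      \<le> fst z powr (- (q + max M N + 1))"
proof -
  (* The order of decay that makes a function of the frequency integrable. *)
  define n where "n = 2 * CARD('n)"
  define vol where "vol = measure lborel K"
  define I where "I = (LINT \<zeta>|lborel. 1 / (1 + norm (\<zeta> :: real^'n)) ^ n)"
  have I: "0 \<le> I" unfolding I_def by (intro Bochner_Integration.integral_nonneg) auto
  have vol: "0 \<le> vol" by (simp add: vol_def)
  obtain k where k: "real l + d + \<delta> * n \<le> (1 - \<delta>) * real k"
  proof -
    obtain k where "(real l + d + \<delta> * n) / (1 - \<delta>) \<le> real k" using real_arch_simple by blast
    then show thesis using \<delta> by (intro that[of k]) (simp add: divide_le_eq mult.commute)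
  qed
  obtain l' where l': "real l + d + \<delta> * n \<le> real l'" using real_arch_simple by blast
  obtain s where s: "slow s" "\<forall>\<^sub>F z in high_freq \<Gamma>'. \<forall>is. length is \<le> k + n \<longrightarrow> (\<forall>x\<in>V.
        norm (partials is (g z) x) \<le> s (fst z) * (W z x * freq z powr (\<delta> * real (length is))))"
    using slow_symbol_uniform_bound[OF g W0] by blast
  let ?a = "real (CARD('n) + 1)"
  define C where "C = I * (?a ^ (k + n) * vol / c ^ k + ?a ^ n * vol * 2 ^ l')"
  have C: "0 \<le> C" using I vol c(1) by (simp add: C_def)
  have slowC: "slow (\<lambda>\<epsilon>. C * s \<epsilon>)" by (intro slow_mult slow_const C s)
  show ?thesis
    using s(2) W supp slow_symbol_smooth[OF g[of 0]] eventually_high_freq_cone[of \<Gamma>'] eventually_high_freq_pos[of \<Gamma>']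
      eventually_high_freq_fst[OF h] eventually_high_freq_fst[OF hB] eventually_high_freq_fst[OF hA[of l']]
      eventually_high_freq_fst[OF slow_nonneg[OF s(1)]] eventually_high_freq_fst[OF slow_le_inverse[OF slowC]]
  proof eventually_elim
    case (elim z)
    obtain \<epsilon> \<xi> where z: "z = (\<epsilon>, \<xi>)" by (cases z)
    note e = elim[unfolded z fst_conv snd_conv]
    let ?J = "1 + norm \<xi>"
    have \<epsilon>: "0 < \<epsilon>" "\<epsilon> < 1" using e(6) by auto
    have sm: "smooth_on UNIV (g (\<epsilon>, \<xi>))"
      by (rule smooth_on_extend_zero[OF V(1) compact_imp_closed[OF V(2)] V(3) e(4)]) (use e(3) in blast)
    define B where "B j = s \<epsilon> * (\<epsilon> powr (- q) * ?J powr (d + \<delta> * real j))" for j :: nat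
    have B0: "0 \<le> B j" for j using e(10) by (simp add: B_def)
    have gb: "norm (partials is (g (\<epsilon>, \<xi>)) x) \<le> B j" if "length is \<le> j" "j \<le> k + n" "x \<in> K" for "is" x j
    proof -
      have x: "x \<in> V" using that(3) V(3) by auto
      have "norm (partials is (g (\<epsilon>, \<xi>)) x) \<le> s \<epsilon> * (W (\<epsilon>, \<xi>) x * ?J powr (\<delta> * real (length is)))"
        using e(1) that(1,2) x by simp
      also have "\<dots> \<le> s \<epsilon> * ((\<epsilon> powr (- q) * ?J powr d) * ?J powr (\<delta> * real j))"
      proof (intro mult_left_mono mult_mono)
        show "W (\<epsilon>, \<xi>) x \<le> \<epsilon> powr (- q) * ?J powr d" using e(2) x by simp
        show "?J powr (\<delta> * real (length is)) \<le> ?J powr (\<delta> * real j)"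
          using that(1) \<delta> by (intro powr_mono mult_left_mono) auto
      qed (use e(10) in auto)
      also have "\<dots> = B j" by (simp add: B_def powr_add mult.assoc)
      finally show ?thesis .
    qed
    have dec: "norm (fourier (g (\<epsilon>, \<xi>)) \<zeta>) * (1 + norm \<zeta>) ^ j \<le> ?a ^ j * vol * B j" if "j \<le> k + n" for j \<zeta>
      unfolding vol_def by (rule fourier_decay[OF sm V(2)]) (use e(3) gb that B0 in auto)
    have "norm (fourier (\<lambda>x. g (\<epsilon>, \<xi>) x * h \<epsilon> x) \<xi>)
      \<le> I * ((?a ^ (k + n) * vol * B (k + n)) * \<epsilon> powr (- M) / (c * ?J) ^ k
          + (?a ^ n * vol * B n) * (\<epsilon> powr (- N) * 2 ^ l' / ?J ^ l'))"
      unfolding I_def n_def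
    proof (rule fourier_product_decay[OF smooth_on_imp_continuous[OF sm] V(2) _ e(7), where \<Gamma> = \<Gamma>])
      show "g (\<epsilon>, \<xi>) x = 0" if "x \<notin> K" for x using e(3) that by blast
      show "norm (fourier (g (\<epsilon>, \<xi>)) \<zeta>) * (1 + norm \<zeta>) ^ (2 * CARD('n)) \<le> ?a ^ (2 * CARD('n)) * vol * B (2 * CARD('n))" for \<zeta>
        using dec[of n] by (simp add: n_def)
      show "norm (fourier (g (\<epsilon>, \<xi>)) \<zeta>) * (1 + norm \<zeta>) ^ (k + 2 * CARD('n)) \<le> ?a ^ (k + 2 * CARD('n)) * vol * B (k + 2 * CARD('n))" for \<zeta>
        using dec[of "k + n"] by (simp add: n_def)
    qed (use e c in auto)
    then have "norm (fourier (\<lambda>x. g (\<epsilon>, \<xi>) x * h \<epsilon> x) \<xi>) * ?J ^ l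
      \<le> I * ((?a ^ (k + n) * vol * B (k + n)) * \<epsilon> powr (- M) / (c * ?J) ^ k
          + (?a ^ n * vol * B n) * (\<epsilon> powr (- N) * 2 ^ l' / ?J ^ l')) * ?J ^ l"
      by (rule mult_right_mono) simp
    also have "\<dots> = I * ((?a ^ (k + n) * vol / c ^ k) * (B (k + n) * \<epsilon> powr (- M) * ?J ^ l / ?J ^ k)
          + (?a ^ n * vol * 2 ^ l') * (B n * \<epsilon> powr (- N) * ?J ^ l / ?J ^ l'))"
    proof -
      have alg: "I * ((p * b) * m / (c * J) ^ k + (r * b') * (m' * t / J ^ l')) * J ^ l
          = I * ((p / c ^ k) * (b * m * J ^ l / J ^ k) + (r * t) * (b' * m' * J ^ l / J ^ l'))"
        for p b m J r b' m' t :: real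
        by (simp add: power_mult_distrib distrib_left distrib_right mult_ac)
      show ?thesis by (rule alg)
    qed
    also have "\<dots> \<le> I * ((?a ^ (k + n) * vol / c ^ k) * (s \<epsilon> * \<epsilon> powr (- (q + max M N)))
          + (?a ^ n * vol * 2 ^ l') * (s \<epsilon> * \<epsilon> powr (- (q + max M N))))"
    proof -
      have mono: "\<epsilon> powr (- a) \<le> \<epsilon> powr (- b)" if "a \<le> b" for a b
        using \<epsilon> that by (simp add: powr_mono')
      have est: "B j * \<epsilon> powr (- a) * ?J ^ l / ?J ^ i \<le> s \<epsilon> * \<epsilon> powr (- (q + max M N))"
        if "a \<le> max M N" "d + \<delta> * real j + real l \<le> real i" for a i j
      proof -
        have "B j * \<epsilon> powr (- a) * ?J ^ l / ?J ^ i = s \<epsilon> * (\<epsilon> powr (- q) * \<epsilon> powr (- a)) * ?J powr (d + \<delta> * real j + real l - real i)"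
          by (simp add: B_def powr_realpow[symmetric] powr_add powr_diff)
        also have "\<dots> = s \<epsilon> * \<epsilon> powr (- (q + a)) * ?J powr (d + \<delta> * real j + real l - real i)"
          by (simp add: powr_add[symmetric])
        also have "\<dots> \<le> s \<epsilon> * \<epsilon> powr (- (q + max M N)) * 1"
        proof (intro mult_mono mult_nonneg_nonneg)
          show "?J powr (d + \<delta> * real j + real l - real i) \<le> 1"
            using that(2) powr_mono[of "d + \<delta> * real j + real l - real i" 0 ?J] by simp
          show "\<epsilon> powr (- (q + a)) \<le> \<epsilon> powr (- (q + max M N))" using that(1) by (intro mono) auto
        qed (use e(10) in auto)
        finally show ?thesis by simp
      qed
      have 1: "d + \<delta> * real (k + n) + real l \<le> real k" using k by (simp add: algebra_simps)
      have 2: "d + \<delta> * real n + real l \<le> real l'" using l' by (simp add: algebra_simps)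
      show ?thesis
        by (intro mult_left_mono[OF _ I] add_mono mult_left_mono est 1 2) (use vol c in auto)
    qed
    also have "\<dots> = (C * s \<epsilon>) * \<epsilon> powr (- (q + max M N))"
      by (simp add: C_def algebra_simps)
    also have "\<dots> \<le> \<epsilon> powr (- (q + max M N + 1))"
      by (rule mult_powr_absorb[OF \<epsilon>(1) e(11)])
    finally show ?case by (simp add: z)
  qed
qed

section \<open>Moderate and negligible nets\<close>

text \<open>Constants are not mentioned, since each of them costs one power of \<open>\<epsilon>\<close>; the supremum over
  \<open>K\<close> is replaced by a bound at every point.\<close>

definition growth :: "(real ^ 'n::finite) set \<Rightarrow> 'n list \<Rightarrow> 'n net \<Rightarrow> real \<Rightarrow> bool" where
  "growth K is u p \<longleftrightarrow> (\<forall>\<^sub>F \<epsilon> in at_right 0. \<forall>x\<in>K. norm (partials is (u \<epsilon>) x) \<le> \<epsilon> powr p)"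

lemma eventually_unit_interval: "\<forall>\<^sub>F \<epsilon> in at_right (0::real). \<epsilon> \<in> {0<..1}"
  using eventually_at_right_0_small[of 1] by (auto elim: eventually_mono)

lemma growth_mono:
  assumes "growth K is u p" "q \<le> p"
  shows "growth K is u q"
  using assms(1) eventually_unit_interval unfolding growth_def
proof eventually_elim
  case (elim \<epsilon>)
  then have "\<epsilon> powr p \<le> \<epsilon> powr q" using assms(2) by (intro powr_mono') auto
  then show ?case using elim by force
qed

lemma bigo_SUP_imp_growth:
  assumes \<Omega>: "open \<Omega>" and u: "\<And>\<epsilon>. \<epsilon> \<in> {0<..1} \<Longrightarrow> smooth_on \<Omega> (u \<epsilon>)" and K: "compact K" "K \<subseteq> \<Omega>"
    and O: "(\<lambda>\<epsilon>. SUP x\<in>K. norm (mderiv \<alpha> (u \<epsilon>) x)) \<in> O[at_right 0](\<lambda>\<epsilon>. \<epsilon> powr p)"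
  shows "growth K (mi_list \<alpha>) u (p - 1)"
proof -
  obtain c where c: "c > 0" "\<forall>\<^sub>F \<epsilon> in at_right 0. norm (SUP x\<in>K. norm (mderiv \<alpha> (u \<epsilon>) x)) \<le> c * norm (\<epsilon> powr p)"
    using O by (elim landau_o.bigE)
  show ?thesis
    unfolding growth_def
    using c(2) eventually_unit_interval slow_le_inverse[OF slow_const[OF less_imp_le[OF c(1)]]]
  proof eventually_elim
    case (elim \<epsilon>)
    have "continuous_on K (\<lambda>x. norm (mderiv \<alpha> (u \<epsilon>) x))"
      by (intro continuous_intros continuous_on_subset[OF smooth_on_imp_continuous[OF smooth_on_mderiv[OF u[OF elim(2)]]] K(2)])
    then have bdd: "bdd_above ((\<lambda>x. norm (mderiv \<alpha> (u \<epsilon>) x)) ` K)"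
      by (intro bounded_imp_bdd_above compact_imp_bounded compact_continuous_image K(1))
    show ?case
    proof
      fix x assume "x \<in> K"
      then have "norm (mderiv \<alpha> (u \<epsilon>) x) \<le> (SUP x\<in>K. norm (mderiv \<alpha> (u \<epsilon>) x))" by (rule cSUP_upper[OF _ bdd])
      also have "\<dots> \<le> c * \<epsilon> powr p" using elim(1) by (simp add: abs_le_iff)
      also have "\<dots> \<le> \<epsilon> powr (p - 1)" using mult_powr_absorb[of \<epsilon> c "- p"] elim(2,3) by simp
      finally show "norm (partials (mi_list \<alpha>) (u \<epsilon>) x) \<le> \<epsilon> powr (p - 1)" by (simp add: mderiv_eq_partials)
    qed
  qed
qed

lemma growth_imp_bigo_SUP:
  assumes "growth K (mi_list \<alpha>) u p" "K \<noteq> {}"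
  shows "(\<lambda>\<epsilon>. SUP x\<in>K. norm (mderiv \<alpha> (u \<epsilon>) x)) \<in> O[at_right 0](\<lambda>\<epsilon>. \<epsilon> powr p)"
proof (rule landau_o.bigI[of 1])
  show "\<forall>\<^sub>F \<epsilon> in at_right 0. norm (SUP x\<in>K. norm (mderiv \<alpha> (u \<epsilon>) x)) \<le> 1 * norm (\<epsilon> powr p)"
    using assms(1) unfolding growth_def
  proof eventually_elim
    case (elim \<epsilon>)
    obtain x where "x \<in> K" using assms(2) by auto
    have le: "norm (mderiv \<alpha> (u \<epsilon>) y) \<le> \<epsilon> powr p" if "y \<in> K" for y using elim that by (simp add: mderiv_eq_partials)
    then have "bdd_above ((\<lambda>x. norm (mderiv \<alpha> (u \<epsilon>) x)) ` K)" by (intro bdd_aboveI2)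
    then have "0 \<le> (SUP x\<in>K. norm (mderiv \<alpha> (u \<epsilon>) x))"
      using cSUP_upper[OF \<open>x \<in> K\<close>] norm_ge_zero order_trans by blast
    moreover have "(SUP x\<in>K. norm (mderiv \<alpha> (u \<epsilon>) x)) \<le> \<epsilon> powr p"
      by (rule cSUP_least[OF assms(2) le])
    ultimately show ?case by simp
  qed
qed simp

lemma growth_perm:
  assumes "open \<Omega>" "\<And>\<epsilon>. \<epsilon> \<in> {0<..1} \<Longrightarrow> smooth_on \<Omega> (u \<epsilon>)" "K \<subseteq> \<Omega>" "growth K (mi_list (count (mset is))) u p"
  shows "growth K is u p"
  using assms(4) eventually_unit_interval unfolding growth_def
proof eventually_elim
  case (elim \<epsilon>)
  show ?case
  proof
    fix x assume "x \<in> K"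
    then show "norm (partials is (u \<epsilon>) x) \<le> \<epsilon> powr p"
      using elim(1) partials_eq_mderiv[OF assms(1) assms(2)[OF elim(2)], of x "is"] assms(3) by (auto simp: mderiv_eq_partials)
  qed
qed

text \<open>By the symmetry of mixed derivatives, the growth conditions on multi-indices extend to
  iterated partial derivatives in any order; in this form they are stable under products.\<close>

lemma moderate_iff:
  assumes "open \<Omega>"
  shows "u \<in> moderate \<Omega> \<longleftrightarrow> (\<forall>\<epsilon>\<in>{0<..1}. smooth_on \<Omega> (u \<epsilon>)) \<and> (\<forall>K is. compact K \<longrightarrow> K \<subseteq> \<Omega> \<longrightarrow> (\<exists>p. growth K is u p))"
proof
  assume u: "u \<in> moderate \<Omega>"
  then have sm: "\<And>\<epsilon>. \<epsilon> \<in> {0<..1} \<Longrightarrow> smooth_on \<Omega> (u \<epsilon>)" by (auto simp: moderate_def)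
  have "\<exists>p. growth K is u p" if K: "compact K" "K \<subseteq> \<Omega>" for K "is"
  proof (cases "K = {}")
    case False
    then obtain p where "(\<lambda>\<epsilon>. SUP x\<in>K. norm (mderiv (count (mset is)) (u \<epsilon>) x)) \<in> O[at_right 0](\<lambda>\<epsilon>. \<epsilon> powr (- p))"
      using u K unfolding moderate_def by blast
    then have "growth K (mi_list (count (mset is))) u (- p - 1)"
      by (intro bigo_SUP_imp_growth[OF assms _ K] sm)
    then show ?thesis using growth_perm[where u = u, OF assms _ K(2)] sm by blast
  qed (simp add: growth_def)
  with sm show "(\<forall>\<epsilon>\<in>{0<..1}. smooth_on \<Omega> (u \<epsilon>)) \<and> (\<forall>K is. compact K \<longrightarrow> K \<subseteq> \<Omega> \<longrightarrow> (\<exists>p. growth K is u p))" by blast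
next
  assume *: "(\<forall>\<epsilon>\<in>{0<..1}. smooth_on \<Omega> (u \<epsilon>)) \<and> (\<forall>K is. compact K \<longrightarrow> K \<subseteq> \<Omega> \<longrightarrow> (\<exists>p. growth K is u p))"
  have "\<exists>p\<ge>0. (\<lambda>\<epsilon>. SUP x\<in>K. norm (mderiv \<alpha> (u \<epsilon>) x)) \<in> O[at_right 0](\<lambda>\<epsilon>. \<epsilon> powr (- p))"
    if K: "compact K" "K \<noteq> {}" "K \<subseteq> \<Omega>" for K \<alpha>
  proof -
    obtain p where "growth K (mi_list \<alpha>) u p" using * K by blast
    then have "growth K (mi_list \<alpha>) u (- max 0 (- p))" by (rule growth_mono) auto
    from growth_imp_bigo_SUP[OF this K(2)] show ?thesis by (intro exI[of _ "max 0 (- p)"]) auto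
  qed
  then show "u \<in> moderate \<Omega>" using * by (auto simp: moderate_def)
qed

lemma negligible_nets_iff:
  assumes "open \<Omega>"
  shows "u \<in> negligible_nets \<Omega> \<longleftrightarrow> (\<forall>\<epsilon>\<in>{0<..1}. smooth_on \<Omega> (u \<epsilon>)) \<and> (\<forall>K is. compact K \<longrightarrow> K \<subseteq> \<Omega> \<longrightarrow> (\<forall>p. growth K is u p))"
proof
  assume u: "u \<in> negligible_nets \<Omega>"
  then have sm: "\<And>\<epsilon>. \<epsilon> \<in> {0<..1} \<Longrightarrow> smooth_on \<Omega> (u \<epsilon>)" by (auto simp: negligible_nets_def)
  have "growth K is u p" if K: "compact K" "K \<subseteq> \<Omega>" for K "is" p
  proof (cases "K = {}")
    case False
    have "(\<lambda>\<epsilon>. SUP x\<in>K. norm (mderiv (count (mset is)) (u \<epsilon>) x)) \<in> O[at_right 0](\<lambda>\<epsilon>. \<epsilon> powr (max 0 (p + 1)))"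
      using u K False unfolding negligible_nets_def by simp
    from growth_perm[OF assms sm K(2) bigo_SUP_imp_growth[OF assms sm K this]]
    have "growth K is u (max 0 (p + 1) - 1)" by blast
    then show ?thesis by (rule growth_mono) auto
  qed (simp add: growth_def)
  with sm show "(\<forall>\<epsilon>\<in>{0<..1}. smooth_on \<Omega> (u \<epsilon>)) \<and> (\<forall>K is. compact K \<longrightarrow> K \<subseteq> \<Omega> \<longrightarrow> (\<forall>p. growth K is u p))" by blast
next
  assume "(\<forall>\<epsilon>\<in>{0<..1}. smooth_on \<Omega> (u \<epsilon>)) \<and> (\<forall>K is. compact K \<longrightarrow> K \<subseteq> \<Omega> \<longrightarrow> (\<forall>p. growth K is u p))"
  then show "u \<in> negligible_nets \<Omega>"
    unfolding negligible_nets_def by (auto intro: growth_imp_bigo_SUP)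
qed

lemma moderate_smooth: "u \<in> moderate \<Omega> \<Longrightarrow> \<epsilon> \<in> {0<..1} \<Longrightarrow> smooth_on \<Omega> (u \<epsilon>)"
  by (auto simp: moderate_def)

lemma negligible_smooth: "u \<in> negligible_nets \<Omega> \<Longrightarrow> \<epsilon> \<in> {0<..1} \<Longrightarrow> smooth_on \<Omega> (u \<epsilon>)"
  by (auto simp: negligible_nets_def)

lemma negligible_imp_moderate: "open \<Omega> \<Longrightarrow> u \<in> negligible_nets \<Omega> \<Longrightarrow> u \<in> moderate \<Omega>"
  by (auto simp: moderate_iff negligible_nets_iff)

lemma growth_add:
  assumes \<Omega>: "open \<Omega>" "K \<subseteq> \<Omega>" and u: "\<And>\<epsilon>. \<epsilon> \<in> {0<..1} \<Longrightarrow> smooth_on \<Omega> (u \<epsilon>)" and v: "\<And>\<epsilon>. \<epsilon> \<in> {0<..1} \<Longrightarrow> smooth_on \<Omega> (v \<epsilon>)"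
    and "growth K is u p" "growth K is v p"
  shows "growth K is (\<lambda>\<epsilon> x. u \<epsilon> x + v \<epsilon> x) (p - 1)"
  using assms(5,6) eventually_unit_interval slow_le_inverse[OF slow_const[of 2, simplified]] unfolding growth_def
proof eventually_elim
  case (elim \<epsilon>)
  show ?case
  proof
    fix x assume "x \<in> K"
    then have x: "x \<in> \<Omega>" using \<Omega> by auto
    have "norm (partials is (\<lambda>x. u \<epsilon> x + v \<epsilon> x) x) \<le> norm (partials is (u \<epsilon>) x) + norm (partials is (v \<epsilon>) x)"
      unfolding partials_add[OF \<Omega>(1) u[OF elim(3)] v[OF elim(3)] x] by (rule norm_triangle_ineq)
    also have "\<dots> \<le> 2 * \<epsilon> powr p" using elim(1,2) \<open>x \<in> K\<close> by force
    also have "\<dots> \<le> \<epsilon> powr (p - 1)" using mult_powr_absorb[of \<epsilon> 2 "- p"] elim(3,4) by simp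
    finally show "norm (partials is (\<lambda>x. u \<epsilon> x + v \<epsilon> x) x) \<le> \<epsilon> powr (p - 1)" .
  qed
qed

lemma growth_cong:
  assumes "open \<Omega>" "K \<subseteq> \<Omega>" "\<And>\<epsilon> x. \<epsilon> \<in> {0<..1} \<Longrightarrow> x \<in> \<Omega> \<Longrightarrow> u \<epsilon> x = v \<epsilon> x" "growth K is u p"
  shows "growth K is v p"
  using assms(4) eventually_unit_interval unfolding growth_def
proof eventually_elim
  case (elim \<epsilon>)
  show ?case
  proof
    fix x assume "x \<in> K"
    then have "partials is (u \<epsilon>) x = partials is (v \<epsilon>) x"
      using assms(2) by (intro partials_cong_open[OF assms(1) assms(3)[OF elim(2)]]) auto
    then show "norm (partials is (v \<epsilon>) x) \<le> \<epsilon> powr p" using elim(1) \<open>x \<in> K\<close> by force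
  qed
qed

lemma growth_mult_Nil:
  assumes "growth K [] u p" "growth K [] v q"
  shows "growth K [] (\<lambda>\<epsilon> x. u \<epsilon> x * v \<epsilon> x) (p + q)"
  using assms unfolding growth_def
  by eventually_elim (auto simp: norm_mult powr_add intro!: mult_mono)

lemma growth_pderiv: "growth K is (\<lambda>\<epsilon>. pderiv_at i (u \<epsilon>)) p \<longleftrightarrow> growth K (is @ [i]) u p"
  by (simp add: growth_def partials_snoc)

text \<open>One application of the product rule; the sum of two terms costs one power of \<open>\<epsilon>\<close>.\<close>

lemma growth_mult_step:
  assumes \<Omega>: "open \<Omega>" "K \<subseteq> \<Omega>" and u: "\<And>\<epsilon>. \<epsilon> \<in> {0<..1} \<Longrightarrow> smooth_on \<Omega> (u \<epsilon>)" and v: "\<And>\<epsilon>. \<epsilon> \<in> {0<..1} \<Longrightarrow> smooth_on \<Omega> (v \<epsilon>)"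
    and "growth K is (\<lambda>\<epsilon> x. pderiv_at i (u \<epsilon>) x * v \<epsilon> x) p" "growth K is (\<lambda>\<epsilon> x. u \<epsilon> x * pderiv_at i (v \<epsilon>) x) p"
  shows "growth K (is @ [i]) (\<lambda>\<epsilon> x. u \<epsilon> x * v \<epsilon> x) (p - 1)"
proof -
  have "growth K is (\<lambda>\<epsilon> x. pderiv_at i (u \<epsilon>) x * v \<epsilon> x + u \<epsilon> x * pderiv_at i (v \<epsilon>) x) (p - 1)"
    by (rule growth_add[OF \<Omega> _ _ assms(5,6)]) (use u v \<Omega>(1) in \<open>auto intro!: smooth_on_intros\<close>)
  then have "growth K is (\<lambda>\<epsilon>. pderiv_at i (\<lambda>x. u \<epsilon> x * v \<epsilon> x)) (p - 1)"
    by (rule growth_cong[OF \<Omega>, rotated]) (use u v in \<open>simp add: pderiv_at_mult[of \<Omega>]\<close>)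
  then show ?thesis by (simp add: growth_pderiv)
qed

lemma growth_mult_moderate:
  assumes \<Omega>: "open \<Omega>" "K \<subseteq> \<Omega>"
  shows "(\<And>\<epsilon>. \<epsilon> \<in> {0<..1} \<Longrightarrow> smooth_on \<Omega> (u \<epsilon>)) \<Longrightarrow> (\<And>\<epsilon>. \<epsilon> \<in> {0<..1} \<Longrightarrow> smooth_on \<Omega> (v \<epsilon>)) \<Longrightarrow>
    (\<And>is. \<exists>p. growth K is u p) \<Longrightarrow> (\<And>is. \<exists>p. growth K is v p) \<Longrightarrow> \<exists>p. growth K is (\<lambda>\<epsilon> x. u \<epsilon> x * v \<epsilon> x) p"
proof (induction "is" arbitrary: u v rule: rev_induct)
  case Nil
  then show ?case using growth_mult_Nil by blast
next
  case (snoc i "is")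
  have 1: "\<exists>p. growth K is (\<lambda>\<epsilon> x. pderiv_at i (u \<epsilon>) x * v \<epsilon> x) p"
    by (rule snoc.IH[of "\<lambda>\<epsilon>. pderiv_at i (u \<epsilon>)" v]) (use snoc.prems in \<open>simp_all add: growth_pderiv smooth_on_pderiv\<close>)
  have 2: "\<exists>p. growth K is (\<lambda>\<epsilon> x. u \<epsilon> x * pderiv_at i (v \<epsilon>) x) p"
    by (rule snoc.IH[of u "\<lambda>\<epsilon>. pderiv_at i (v \<epsilon>)"]) (use snoc.prems in \<open>simp_all add: growth_pderiv smooth_on_pderiv\<close>)
  from 1 2 obtain p q where "growth K is (\<lambda>\<epsilon> x. pderiv_at i (u \<epsilon>) x * v \<epsilon> x) p"
    "growth K is (\<lambda>\<epsilon> x. u \<epsilon> x * pderiv_at i (v \<epsilon>) x) q" by blast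
  then have "growth K is (\<lambda>\<epsilon> x. pderiv_at i (u \<epsilon>) x * v \<epsilon> x) (min p q)"
    "growth K is (\<lambda>\<epsilon> x. u \<epsilon> x * pderiv_at i (v \<epsilon>) x) (min p q)" by (auto elim: growth_mono)
  from growth_mult_step[OF \<Omega> snoc.prems(1,2) this] show ?case by blast
qed

lemma growth_mult_negligible:
  assumes \<Omega>: "open \<Omega>" "K \<subseteq> \<Omega>"
  shows "(\<And>\<epsilon>. \<epsilon> \<in> {0<..1} \<Longrightarrow> smooth_on \<Omega> (u \<epsilon>)) \<Longrightarrow> (\<And>\<epsilon>. \<epsilon> \<in> {0<..1} \<Longrightarrow> smooth_on \<Omega> (v \<epsilon>)) \<Longrightarrow>
    (\<And>is p. growth K is u p) \<Longrightarrow> (\<And>is. \<exists>p. growth K is v p) \<Longrightarrow> growth K is (\<lambda>\<epsilon> x. u \<epsilon> x * v \<epsilon> x) q"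
proof (induction "is" arbitrary: u v q rule: rev_induct)
  case (Nil u v q)
  obtain p where p: "growth K [] v p" using Nil.prems(4) by blast
  show ?case using growth_mult_Nil[OF Nil.prems(3)[of "[]" "q - p"] p] by simp
next
  case (snoc i "is" u v q)
  have 1: "growth K is (\<lambda>\<epsilon> x. pderiv_at i (u \<epsilon>) x * v \<epsilon> x) (q + 1)"
    by (rule snoc.IH[of "\<lambda>\<epsilon>. pderiv_at i (u \<epsilon>)" v]) (use snoc.prems in \<open>simp_all add: growth_pderiv smooth_on_pderiv\<close>)
  have 2: "growth K is (\<lambda>\<epsilon> x. u \<epsilon> x * pderiv_at i (v \<epsilon>) x) (q + 1)"
    by (rule snoc.IH[of u "\<lambda>\<epsilon>. pderiv_at i (v \<epsilon>)"]) (use snoc.prems in \<open>simp_all add: growth_pderiv smooth_on_pderiv\<close>)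
  from growth_mult_step[OF \<Omega> snoc.prems(1,2) 1 2] show ?case by simp
qed

lemma moderate_mult:
  assumes "open \<Omega>" "u \<in> moderate \<Omega>" "v \<in> moderate \<Omega>"
  shows "(\<lambda>\<epsilon> x. u \<epsilon> x * v \<epsilon> x) \<in> moderate \<Omega>"
  using assms growth_mult_moderate[OF assms(1), of _ u v] unfolding moderate_iff[OF assms(1)]
  by (auto intro!: smooth_on_mult)

lemma negligible_mult:
  assumes "open \<Omega>" "u \<in> negligible_nets \<Omega>" "v \<in> moderate \<Omega>"
  shows "(\<lambda>\<epsilon> x. u \<epsilon> x * v \<epsilon> x) \<in> negligible_nets \<Omega>"
  using assms growth_mult_negligible[OF assms(1), of _ u v] unfolding moderate_iff[OF assms(1)] negligible_nets_iff[OF assms(1)]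
  by (auto intro!: smooth_on_mult)

lemma moderate_add:
  assumes "open \<Omega>" "u \<in> moderate \<Omega>" "v \<in> moderate \<Omega>"
  shows "(\<lambda>\<epsilon> x. u \<epsilon> x + v \<epsilon> x) \<in> moderate \<Omega>"
  unfolding moderate_iff[OF assms(1)]
proof (intro conjI ballI allI impI)
  fix K :: "(real^'a) set" and "is" assume K: "compact K" "K \<subseteq> \<Omega>"
  obtain p q where "growth K is u p" "growth K is v q" using assms K unfolding moderate_iff[OF assms(1)] by blast
  then have "growth K is u (min p q)" "growth K is v (min p q)" by (auto elim: growth_mono)
  from growth_add[OF assms(1) K(2) moderate_smooth[OF assms(2)] moderate_smooth[OF assms(3)] this]
  show "\<exists>p. growth K is (\<lambda>\<epsilon> x. u \<epsilon> x + v \<epsilon> x) p" by blast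
qed (intro smooth_on_add assms(1) moderate_smooth[OF assms(2)] moderate_smooth[OF assms(3)])

lemma negligible_add:
  assumes "open \<Omega>" "u \<in> negligible_nets \<Omega>" "v \<in> negligible_nets \<Omega>"
  shows "(\<lambda>\<epsilon> x. u \<epsilon> x + v \<epsilon> x) \<in> negligible_nets \<Omega>"
  unfolding negligible_nets_iff[OF assms(1)]
proof (intro conjI ballI allI impI)
  fix K :: "(real^'a) set" and "is" p assume K: "compact K" "K \<subseteq> \<Omega>"
  have "growth K is u (p + 1)" "growth K is v (p + 1)" using assms K unfolding negligible_nets_iff[OF assms(1)] by blast+
  from growth_add[OF assms(1) K(2) negligible_smooth[OF assms(2)] negligible_smooth[OF assms(3)] this]
  show "growth K is (\<lambda>\<epsilon> x. u \<epsilon> x + v \<epsilon> x) p" by simp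
qed (intro smooth_on_add assms(1) negligible_smooth[OF assms(2)] negligible_smooth[OF assms(3)])

lemma moderate_fixed:
  assumes "open \<Omega>" "smooth_on \<Omega> f" shows "(\<lambda>\<epsilon>. f) \<in> moderate \<Omega>"
  unfolding moderate_iff[OF assms(1)]
proof (intro conjI ballI allI impI)
  fix K "is" assume K: "compact K" "K \<subseteq> \<Omega>"
  have "bounded (partials is f ` K)"
    by (intro compact_imp_bounded compact_continuous_image K(1) continuous_on_subset[OF smooth_on_imp_continuous[OF smooth_on_partials[OF assms(2)]] K(2)])
  then obtain B where B: "B > 0" "\<And>x. x \<in> K \<Longrightarrow> norm (partials is f x) \<le> B" by (auto simp: bounded_pos)
  have "growth K is (\<lambda>\<epsilon>. f) (- 1)"
    unfolding growth_def using eventually_unit_interval slow_le_inverse[OF slow_const[OF less_imp_le[OF B(1)]]]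
  proof eventually_elim
    case (elim \<epsilon>)
    have "B \<le> \<epsilon> powr (- 1)" using mult_powr_absorb[of \<epsilon> B 0] elim by simp
    then show ?case using B(2) order_trans by blast
  qed
  then show "\<exists>p. growth K is (\<lambda>\<epsilon>. f) p" by blast
qed (rule assms(2))

lemma zero_negligible: "open \<Omega> \<Longrightarrow> (\<lambda>\<epsilon> x. 0) \<in> negligible_nets \<Omega>"
  by (simp add: negligible_nets_iff growth_def partials_zero smooth_on_const)

lemma moderate_sum:
  assumes "open \<Omega>" "\<And>a. a \<in> S \<Longrightarrow> f a \<in> moderate \<Omega>"
  shows "(\<lambda>\<epsilon> x. \<Sum>a\<in>S. f a \<epsilon> x) \<in> moderate \<Omega>"
  using assms(2)
  by (induction S rule: infinite_finite_induct)
     (auto intro: moderate_add[OF assms(1)] moderate_fixed[OF assms(1) smooth_on_const[OF assms(1)]])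

lemma negligible_sum:
  assumes "open \<Omega>" "\<And>a. a \<in> S \<Longrightarrow> f a \<in> negligible_nets \<Omega>"
  shows "(\<lambda>\<epsilon> x. \<Sum>a\<in>S. f a \<epsilon> x) \<in> negligible_nets \<Omega>"
  using assms(2)
  by (induction S rule: infinite_finite_induct) (auto intro: negligible_add[OF assms(1)] zero_negligible[OF assms(1)])

lemma moderate_mderiv:
  assumes "open \<Omega>" "u \<in> moderate \<Omega>" shows "(\<lambda>\<epsilon>. mderiv \<alpha> (u \<epsilon>)) \<in> moderate \<Omega>"
proof -
  have "growth K is (\<lambda>\<epsilon>. mderiv \<alpha> (u \<epsilon>)) p \<longleftrightarrow> growth K (is @ mi_list \<alpha>) u p" for K "is" p
    by (simp add: growth_def mderiv_eq_partials partials_append)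
  then show ?thesis using assms by (auto simp: moderate_iff[OF assms(1)] intro!: smooth_on_mderiv)
qed

lemma negligible_uminus:
  assumes "open \<Omega>" "u \<in> negligible_nets \<Omega>" shows "(\<lambda>\<epsilon> x. - u \<epsilon> x) \<in> negligible_nets \<Omega>"
  using negligible_mult[OF assms moderate_fixed[OF assms(1) smooth_on_const[OF assms(1), of "- 1"]]] by simp

lemma moderate_diff_op_term:
  assumes "open \<Omega>" "u \<in> moderate \<Omega>"
  shows "(\<lambda>\<epsilon> x. c * mderiv \<alpha> (u \<epsilon>) x) \<in> moderate \<Omega>"
  by (intro moderate_mult moderate_mderiv assms moderate_fixed[OF assms(1) smooth_on_const[OF assms(1)]])

lemma diff_op_net_moderate:
  assumes "open \<Omega>" "\<And>\<alpha>. mi_len \<alpha> \<le> m \<Longrightarrow> A \<alpha> \<in> moderate \<Omega>" "u \<in> moderate \<Omega>"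
  shows "diff_op_net m A u \<in> moderate \<Omega>"
  unfolding diff_op_net_def
  by (intro moderate_sum moderate_mult[OF assms(1)] assms moderate_diff_op_term) auto

lemma diff_op_net_diff_negligible:
  assumes "open \<Omega>" "\<And>\<alpha>. mi_len \<alpha> \<le> m \<Longrightarrow> (\<lambda>\<epsilon> x. A \<alpha> \<epsilon> x - A' \<alpha> \<epsilon> x) \<in> negligible_nets \<Omega>" "u \<in> moderate \<Omega>"
  shows "(\<lambda>\<epsilon> x. diff_op_net m A u \<epsilon> x - diff_op_net m A' u \<epsilon> x) \<in> negligible_nets \<Omega>"
proof -
  have "(\<lambda>\<epsilon> x. \<Sum>\<alpha> | mi_len \<alpha> \<le> m. (A \<alpha> \<epsilon> x - A' \<alpha> \<epsilon> x) * ((- \<i>) ^ mi_len \<alpha> * mderiv \<alpha> (u \<epsilon>) x)) \<in> negligible_nets \<Omega>"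
    by (intro negligible_sum negligible_mult[OF assms(1)] assms moderate_diff_op_term) auto
  then show ?thesis unfolding diff_op_net_def by (simp add: left_diff_distrib sum_subtractf)
qed

section \<open>Localised Fourier transforms of moderate nets\<close>

lemma test_functions_support:
  assumes "\<phi> \<in> test_functions U"
  obtains K where "compact K" "K \<subseteq> U" "\<And>x. x \<notin> K \<Longrightarrow> \<phi> x = 0" "smooth_on UNIV \<phi>"
  using assms unfolding test_functions_def
  by (intro that[of "closure {x. \<phi> x \<noteq> 0}"]) (auto dest: contra_subsetD[OF closure_subset])

lemma smooth_on_test_mult:
  assumes "open \<Omega>" "smooth_on \<Omega> f" "smooth_on UNIV \<phi>" "compact K" "K \<subseteq> \<Omega>" "\<And>x. x \<notin> K \<Longrightarrow> \<phi> x = 0"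
  shows "smooth_on UNIV (\<lambda>x. \<phi> x * f x)"
  by (rule smooth_on_extend_zero[OF assms(1) compact_imp_closed[OF assms(4)] assms(5)])
     (use assms smooth_on_subset[OF assms(3)] in \<open>auto intro!: smooth_on_mult\<close>)

lemma moderate_test_integrable:
  assumes "open \<Omega>" "f \<in> moderate \<Omega>" "\<phi> \<in> test_functions \<Omega>"
  shows "\<forall>\<^sub>F \<epsilon> in at_right 0. integrable lborel (\<lambda>x. \<phi> x * f \<epsilon> x)"
proof -
  obtain K where K: "compact K" "K \<subseteq> \<Omega>" "\<And>x. x \<notin> K \<Longrightarrow> \<phi> x = 0" "smooth_on UNIV \<phi>"
    using test_functions_support[OF assms(3)] by blast
  show ?thesis using eventually_unit_interval
  proof eventually_elim
    case (elim \<epsilon>)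
    have "smooth_on UNIV (\<lambda>x. \<phi> x * f \<epsilon> x)"
      by (rule smooth_on_test_mult[OF assms(1) moderate_smooth[OF assms(2) elim] K(4,1,2)]) (rule K(3))
    then show ?case
      by (intro integrable_compact_support[OF K(1)] smooth_on_imp_continuous) (auto simp: K(3))
  qed
qed

lemma moderate_test_bound:
  assumes "open \<Omega>" "f \<in> moderate \<Omega>" "compact K" "K \<subseteq> \<Omega>" "\<And>x. x \<notin> K \<Longrightarrow> \<phi> x = 0" "continuous_on UNIV \<phi>"
  obtains M where "\<forall>\<^sub>F \<epsilon> in at_right 0. \<forall>\<xi>. norm (fourier (\<lambda>x. \<phi> x * f \<epsilon> x) \<xi>) \<le> \<epsilon> powr (- M)"
proof -
  obtain p where p: "growth K [] f p" using assms unfolding moderate_iff[OF assms(1)] by blast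
  have "bounded (\<phi> ` K)"
    by (intro compact_imp_bounded compact_continuous_image assms(3) continuous_on_subset[OF assms(6)]) auto
  then obtain B where B: "B > 0" "\<And>x. x \<in> K \<Longrightarrow> norm (\<phi> x) \<le> B" by (auto simp: bounded_pos)
  let ?C = "B * measure lborel K"
  have "0 \<le> ?C" using B(1) by simp
  have "\<forall>\<^sub>F \<epsilon> in at_right 0. \<forall>\<xi>. norm (fourier (\<lambda>x. \<phi> x * f \<epsilon> x) \<xi>) \<le> \<epsilon> powr (- (- p + 1))"
    using p[unfolded growth_def] eventually_unit_interval slow_le_inverse[OF slow_const[OF \<open>0 \<le> ?C\<close>]]
  proof eventually_elim
    case (elim \<epsilon>)
    show ?case
    proof
      fix \<xi>
      have "norm (fourier (\<lambda>x. \<phi> x * f \<epsilon> x) \<xi>) \<le> (B * \<epsilon> powr p) * measure lborel K"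
        by (rule norm_fourier_le[OF assms(3)]) (use assms(5) B elim(1) in \<open>auto simp: norm_mult intro!: mult_mono\<close>)
      also have "\<dots> \<le> \<epsilon> powr (- (- p + 1))" using mult_powr_absorb[of \<epsilon> ?C "- p"] elim(2,3) by (simp add: mult_ac)
      finally show "norm (fourier (\<lambda>x. \<phi> x * f \<epsilon> x) \<xi>) \<le> \<epsilon> powr (- (- p + 1))" .
    qed
  qed
  then show thesis by (rule that)
qed

lemma negligible_rapidly_decreasing:
  assumes "open \<Omega>" "d \<in> negligible_nets \<Omega>" "\<phi> \<in> test_functions \<Omega>"
  shows "\<forall>\<^sub>F \<epsilon> in at_right 0. \<forall>\<xi>. norm (fourier (\<lambda>x. \<phi> x * d \<epsilon> x) \<xi>) * (1 + norm \<xi>) ^ l \<le> \<epsilon> powr (- 1)"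
proof -
  obtain K where K: "compact K" "K \<subseteq> \<Omega>" "\<And>x. x \<notin> K \<Longrightarrow> \<phi> x = 0" "smooth_on UNIV \<phi>"
    using test_functions_support[OF assms(3)] by blast
  have "(\<lambda>\<epsilon> x. d \<epsilon> x * \<phi> x) \<in> negligible_nets \<Omega>"
    by (rule negligible_mult[OF assms(1,2)]) (rule moderate_fixed[OF assms(1) smooth_on_subset[OF K(4)]], simp)
  then have "growth K is (\<lambda>\<epsilon> x. \<phi> x * d \<epsilon> x) 0" for "is"
    using K(1,2) unfolding negligible_nets_iff[OF assms(1)] by (simp add: mult.commute)
  then have ev: "\<forall>\<^sub>F \<epsilon> in at_right 0. \<forall>is\<in>{is. length is \<le> l}. \<forall>x\<in>K. norm (partials is (\<lambda>x. \<phi> x * d \<epsilon> x) x) \<le> \<epsilon> powr 0"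
    by (intro eventually_ball_finite finite_lists_length_le_UNIV) (auto simp: growth_def)
  let ?C = "real (CARD('a) + 1) ^ l * measure lborel K"
  have C: "0 \<le> ?C" by simp
  show ?thesis
    using ev eventually_unit_interval slow_le_inverse[OF slow_const[OF C]]
  proof eventually_elim
    case (elim \<epsilon>)
    have sm: "smooth_on UNIV (\<lambda>x. \<phi> x * d \<epsilon> x)"
      by (rule smooth_on_test_mult[OF assms(1) negligible_smooth[OF assms(2) elim(2)] K(4,1,2)]) (rule K(3))
    show ?case
    proof
      fix \<xi>
      have "norm (fourier (\<lambda>x. \<phi> x * d \<epsilon> x) \<xi>) * (1 + norm \<xi>) ^ l \<le> ?C * 1"
        by (rule fourier_decay[OF sm K(1)]) (use K(3) elim(1,2) in auto)
      also have "\<dots> \<le> \<epsilon> powr (- 1)" using mult_powr_absorb[of \<epsilon> ?C 0] elim(2,3) by simp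
      finally show "norm (fourier (\<lambda>x. \<phi> x * d \<epsilon> x) \<xi>) * (1 + norm \<xi>) ^ l \<le> \<epsilon> powr (- 1)" .
    qed
  qed
qed

lemma test_functions_mono: "U \<subseteq> U' \<Longrightarrow> test_functions U \<subseteq> test_functions U'"
  by (auto simp: test_functions_def)

text \<open>A negligible difference, cut off by a test function, has a transform which decays rapidly in
  all directions, with the same power of \<open>\<epsilon>\<close> for every order of decay.\<close>

lemma microlocally_regular_net_cong:
  assumes \<Omega>: "open \<Omega>" and v: "v \<in> moderate \<Omega>" and w: "w \<in> moderate \<Omega>"
    and d: "(\<lambda>\<epsilon> x. w \<epsilon> x - v \<epsilon> x) \<in> negligible_nets \<Omega>"
    and reg: "microlocally_regular_net \<Omega> v x \<xi>"
  shows "microlocally_regular_net \<Omega> w x \<xi>"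
proof -
  obtain U \<Gamma> where U: "open U" "U \<subseteq> \<Omega>" "x \<in> U" "open_cone \<Gamma>" "\<xi> \<in> \<Gamma>"
    and r: "\<And>\<phi>. \<phi> \<in> test_functions U \<Longrightarrow> rapidly_decreasing \<Gamma> (\<lambda>\<epsilon>. fourier (\<lambda>x. \<phi> x * v \<epsilon> x))"
    using reg unfolding microlocally_regular_net_iff by blast
  have "rapidly_decreasing \<Gamma> (\<lambda>\<epsilon>. fourier (\<lambda>x. \<phi> x * w \<epsilon> x))" if ph: "\<phi> \<in> test_functions U" for \<phi>
  proof -
    have \<phi>: "\<phi> \<in> test_functions \<Omega>" using ph test_functions_mono[OF U(2)] by auto
    obtain N where N: "\<And>l::nat. \<forall>\<^sub>F \<epsilon> in at_right 0. \<forall>\<xi>\<in>\<Gamma>. norm (fourier (\<lambda>x. \<phi> x * v \<epsilon> x) \<xi>) * (1 + norm \<xi>) ^ l \<le> \<epsilon> powr (- N)"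
      using r[OF ph] unfolding rapidly_decreasing_def by blast
    show ?thesis unfolding rapidly_decreasing_def
    proof (intro exI[of _ "max N 1 + 1"] allI)
      fix l :: nat
      have two: "\<forall>\<^sub>F \<epsilon> in at_right (0::real). 2 \<le> 1 / \<epsilon>" by (rule slow_le_inverse[OF slow_const]) simp
      show "\<forall>\<^sub>F \<epsilon> in at_right 0. \<forall>\<xi>\<in>\<Gamma>. norm (fourier (\<lambda>x. \<phi> x * w \<epsilon> x) \<xi>) * (1 + norm \<xi>) ^ l \<le> \<epsilon> powr (- (max N 1 + 1))"
        using N[of l] negligible_rapidly_decreasing[OF \<Omega> d \<phi>, of l] eventually_unit_interval two
          moderate_test_integrable[OF \<Omega> v \<phi>] moderate_test_integrable[OF \<Omega> negligible_imp_moderate[OF \<Omega> d] \<phi>]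
      proof eventually_elim
        case (elim \<epsilon>)
        have mono: "\<epsilon> powr (- a) \<le> \<epsilon> powr (- max N 1)" if "a \<le> max N 1" for a
          using elim(3) that by (intro powr_mono') auto
        show ?case
        proof
          fix \<xi> assume "\<xi> \<in> \<Gamma>"
          have e: "integrable lborel (\<lambda>x. f x * expi \<xi> x)" if "integrable lborel f" for f
            using that by (rule Bochner_Integration.integrable_bound) (use that in \<open>auto simp: norm_mult borel_measurable_integrable\<close>)
          have "fourier (\<lambda>x. \<phi> x * w \<epsilon> x) \<xi> = (LINT x|lborel. \<phi> x * v \<epsilon> x * expi \<xi> x + \<phi> x * (w \<epsilon> x - v \<epsilon> x) * expi \<xi> x)"
            unfolding fourier_eq by (simp add: algebra_simps)
          also have "\<dots> = fourier (\<lambda>x. \<phi> x * v \<epsilon> x) \<xi> + fourier (\<lambda>x. \<phi> x * (w \<epsilon> x - v \<epsilon> x)) \<xi>"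
            unfolding fourier_eq by (rule Bochner_Integration.integral_add[OF e[OF elim(5)] e[OF elim(6)]])
          finally have "norm (fourier (\<lambda>x. \<phi> x * w \<epsilon> x) \<xi>) * (1 + norm \<xi>) ^ l
             \<le> (norm (fourier (\<lambda>x. \<phi> x * v \<epsilon> x) \<xi>) + norm (fourier (\<lambda>x. \<phi> x * (w \<epsilon> x - v \<epsilon> x)) \<xi>)) * (1 + norm \<xi>) ^ l"
            by (simp add: norm_triangle_ineq mult_right_mono)
          also have "\<dots> \<le> \<epsilon> powr (- max N 1) + \<epsilon> powr (- max N 1)"
            unfolding distrib_right
            using elim(1,2) \<open>\<xi> \<in> \<Gamma>\<close> mono[of N] mono[of 1] by (intro add_mono) (auto intro: order_trans)
          also have "\<dots> = 2 * \<epsilon> powr (- max N 1)" by simp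
          also have "\<dots> \<le> \<epsilon> powr (- (max N 1 + 1))" using elim(3,4) by (intro mult_powr_absorb) auto
          finally show "norm (fourier (\<lambda>x. \<phi> x * w \<epsilon> x) \<xi>) * (1 + norm \<xi>) ^ l \<le> \<epsilon> powr (- (max N 1 + 1))" .
        qed
      qed
    qed
  qed
  then show ?thesis using U unfolding microlocally_regular_net_iff by blast
qed

section \<open>The symbol of the operator\<close>

lemma mderiv_0: "mderiv (\<lambda>i. 0) f = f"
proof -
  have "length (mi_list (\<lambda>i::'a. 0)) = 0" unfolding length_mi_list by (simp add: mi_len_def)
  then show ?thesis by (simp add: mderiv_eq_partials)
qed

abbreviation symbol_at :: "nat \<Rightarrow> ('n::finite multi_index \<Rightarrow> 'n net) \<Rightarrow> real \<times> (real ^ 'n) \<Rightarrow> real ^ 'n \<Rightarrow> complex" where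
  "symbol_at m A z y \<equiv> op_symbol m A (fst z) y (snd z)"

abbreviation symbol_deriv_at ::
  "nat \<Rightarrow> ('n::finite multi_index \<Rightarrow> 'n net) \<Rightarrow> 'n multi_index \<Rightarrow> real \<times> (real ^ 'n) \<Rightarrow> real ^ 'n \<Rightarrow> complex" where
  "symbol_deriv_at m A \<gamma> z y \<equiv> mderiv \<gamma> (\<lambda>\<eta>. op_symbol m A (fst z) y \<eta>) (snd z)"

definition symbol_estimates ::
  "nat \<Rightarrow> ('n::finite multi_index \<Rightarrow> 'n net) \<Rightarrow> real \<Rightarrow> real \<Rightarrow> (real ^ 'n) set \<Rightarrow> (real ^ 'n) set \<Rightarrow> bool" where
  "symbol_estimates m A \<delta> \<rho> \<Gamma> K \<longleftrightarrow> (\<forall>\<alpha>. \<exists>s r \<epsilon>\<^sub>\<alpha>. pos_slow_scale s \<and> pos_slow_scale r \<and> \<epsilon>\<^sub>\<alpha> > 0 \<and>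
        (\<forall>\<beta>. mi_len \<beta> \<le> m \<longrightarrow>
          (\<forall>\<epsilon>. 0 < \<epsilon> \<and> \<epsilon> < \<epsilon>\<^sub>\<alpha> \<longrightarrow> (\<forall>x\<in>K. \<forall>\<xi>\<in>\<Gamma>. norm \<xi> \<ge> r \<epsilon> \<longrightarrow>
            norm (op_symbol_deriv m A \<alpha> \<beta> \<epsilon> x \<xi>)
              \<le> s \<epsilon> * norm (op_symbol m A \<epsilon> x \<xi>)
                  * (1 + norm \<xi>) powr (\<delta> * real (mi_len \<alpha>) - \<rho> * real (mi_len \<beta>))))))"

text \<open>The estimates on mixed derivatives in terms of slow scale symbols: in \<open>x\<close>, the derivative
  \<open>\<partial>\<^sub>\<xi>^\<gamma> P\<close> is a symbol whose weight is \<open>|P|\<close> itself, reduced by \<open>\<langle>\<xi>\<rangle>^{-\<rho>|\<gamma>|}\<close>.\<close>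

definition symbol_derivs_slow ::
  "nat \<Rightarrow> ('n::finite multi_index \<Rightarrow> 'n net) \<Rightarrow> real \<Rightarrow> real \<Rightarrow> (real ^ 'n) set \<Rightarrow> (real ^ 'n) set \<Rightarrow> bool" where
  "symbol_derivs_slow m A \<delta> \<rho> \<Gamma> V \<longleftrightarrow> (\<forall>\<gamma> k. mi_len \<gamma> \<le> m \<longrightarrow>
     slow_symbol \<delta> \<Gamma> V k (\<lambda>z x. norm (symbol_at m A z x) * freq z powr (- \<rho> * real (mi_len \<gamma>))) (symbol_deriv_at m A \<gamma>))"

lemma symbol_estimates_imp_slow:
  fixes A :: "'n::finite multi_index \<Rightarrow> 'n net"
  assumes V: "open V" "V \<subseteq> K" and \<Gamma>: "\<Gamma>' \<subseteq> \<Gamma>"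
    and sm: "\<And>\<alpha> \<epsilon>. mi_len \<alpha> \<le> m \<Longrightarrow> \<epsilon> \<in> {0<..1} \<Longrightarrow> smooth_on V (A \<alpha> \<epsilon>)"
    and est: "symbol_estimates m A \<delta> \<rho> \<Gamma> K"
  shows "symbol_derivs_slow m A \<delta> \<rho> \<Gamma>' V"
  unfolding symbol_derivs_slow_def
proof (intro allI impI)
  fix \<gamma> :: "'n multi_index" and k assume \<gamma>: "mi_len \<gamma> \<le> m"
  have sms: "smooth_on V (\<lambda>y. mderiv \<gamma> (\<lambda>\<eta>. op_symbol m A \<epsilon> y \<eta>) \<xi>)" if "\<epsilon> \<in> {0<..1}" for \<epsilon> \<xi>
    using sm that by (intro smooth_on_op_symbol_deriv V) auto
  show "slow_symbol \<delta> \<Gamma>' V k (\<lambda>z x. norm (symbol_at m A z x) * freq z powr (- \<rho> * real (mi_len \<gamma>))) (symbol_deriv_at m A \<gamma>)"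
  proof (rule slow_symbolI)
    show "\<forall>\<^sub>F z in high_freq \<Gamma>'. smooth_on V (symbol_deriv_at m A \<gamma> z)"
      using eventually_high_freq_fst[OF eventually_unit_interval] by eventually_elim (rule sms)
    fix "is" :: "'n list"
    obtain s r e where s: "pos_slow_scale s" "pos_slow_scale r" "e > 0"
      and b0: "\<And>\<beta> \<epsilon> x \<xi>. mi_len \<beta> \<le> m \<Longrightarrow> 0 < \<epsilon> \<Longrightarrow> \<epsilon> < e \<Longrightarrow> x \<in> K \<Longrightarrow> \<xi> \<in> \<Gamma> \<Longrightarrow> r \<epsilon> \<le> norm \<xi> \<Longrightarrow>
         norm (op_symbol_deriv m A (count (mset is)) \<beta> \<epsilon> x \<xi>)
                \<le> s \<epsilon> * norm (op_symbol m A \<epsilon> x \<xi>)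
                    * (1 + norm \<xi>) powr (\<delta> * real (mi_len (count (mset is))) - \<rho> * real (mi_len \<beta>))"
      using est[unfolded symbol_estimates_def, rule_format, of "count (mset is)"] by (elim exE conjE) metis
    have "\<forall>\<^sub>F z in high_freq \<Gamma>'. \<forall>x\<in>V. norm (partials is (symbol_deriv_at m A \<gamma> z) x)
        \<le> s (fst z) * (norm (symbol_at m A z x) * freq z powr (- \<rho> * real (mi_len \<gamma>)) * freq z powr (\<delta> * real (length is)))"
      unfolding eventually_high_freq
    proof (rule exI[of _ r], rule conjI[OF pos_slow_scale_imp_slow[OF s(2)]])
      show "\<forall>\<^sub>F \<epsilon> in at_right 0. \<forall>\<xi>\<in>\<Gamma>'. r \<epsilon> \<le> norm \<xi> \<longrightarrow> (\<forall>x\<in>V. norm (partials is (symbol_deriv_at m A \<gamma> (\<epsilon>, \<xi>)) x)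
        \<le> s (fst (\<epsilon>, \<xi>)) * (norm (symbol_at m A (\<epsilon>, \<xi>) x) * freq (\<epsilon>, \<xi>) powr (- \<rho> * real (mi_len \<gamma>)) * freq (\<epsilon>, \<xi>) powr (\<delta> * real (length is))))"
        using eventually_at_right_0_small[OF s(3)] eventually_unit_interval
      proof eventually_elim
        case (elim \<epsilon>)
        show ?case
        proof (intro ballI impI)
          fix \<xi> x assume \<xi>: "\<xi> \<in> \<Gamma>'" "r \<epsilon> \<le> norm \<xi>" and x: "x \<in> V"
          have "norm (op_symbol_deriv m A (count (mset is)) \<gamma> \<epsilon> x \<xi>)
             \<le> s \<epsilon> * norm (op_symbol m A \<epsilon> x \<xi>) * (1 + norm \<xi>) powr (\<delta> * real (length is) - \<rho> * real (mi_len \<gamma>))"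
            using b0[OF \<gamma>] elim(1) \<xi> x V(2) \<Gamma> unfolding mi_len_count by blast
          then show "norm (partials is (symbol_deriv_at m A \<gamma> (\<epsilon>, \<xi>)) x)
             \<le> s (fst (\<epsilon>, \<xi>)) * (norm (symbol_at m A (\<epsilon>, \<xi>) x) * freq (\<epsilon>, \<xi>) powr (- \<rho> * real (mi_len \<gamma>)) * freq (\<epsilon>, \<xi>) powr (\<delta> * real (length is)))"
            unfolding op_symbol_deriv_def fst_conv snd_conv partials_eq_mderiv[OF V(1) sms[OF elim(2)] x]
            by (simp add: powr_diff powr_minus_divide)
        qed
      qed
    qed
    with pos_slow_scale_imp_slow[OF s(1)]
    show "slow_bound \<Gamma>' V (\<lambda>z x. norm (symbol_at m A z x) * freq z powr (- \<rho> * real (mi_len \<gamma>)) * freq z powr (\<delta> * real (length is)))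
        (\<lambda>z. partials is (symbol_deriv_at m A \<gamma> z))"
      unfolding slow_bound_def by blast
  qed
qed

lemma op_symbol_moderate:
  fixes A :: "'n::finite multi_index \<Rightarrow> 'n net"
  assumes \<Omega>: "open \<Omega>" and A: "\<And>\<alpha>. mi_len \<alpha> \<le> m \<Longrightarrow> A \<alpha> \<in> moderate \<Omega>" and K: "compact K" "K \<subseteq> \<Omega>"
  obtains q where "\<forall>\<^sub>F \<epsilon> in at_right 0. \<forall>x\<in>K. \<forall>\<xi>. norm (op_symbol m A \<epsilon> x \<xi>) \<le> \<epsilon> powr (- q) * (1 + norm \<xi>) powr real m"
proof -
  let ?S = "{\<alpha> :: 'n multi_index. mi_len \<alpha> \<le> m}"
  have "\<forall>\<alpha>\<in>?S. \<exists>p. growth K [] (A \<alpha>) p" using A K unfolding moderate_iff[OF \<Omega>] by blast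
  then obtain p where p: "\<And>\<alpha>. \<alpha> \<in> ?S \<Longrightarrow> growth K [] (A \<alpha>) (p \<alpha>)" by metis
  define q where "q = (\<Sum>\<alpha>\<in>?S. \<bar>p \<alpha>\<bar>)"
  have "growth K [] (A \<alpha>) (- q)" if "\<alpha> \<in> ?S" for \<alpha>
  proof (rule growth_mono[OF p[OF that]])
    have "\<bar>p \<alpha>\<bar> \<le> q" unfolding q_def by (rule member_le_sum[OF that]) (auto simp: finite_mi_len)
    then show "- q \<le> p \<alpha>" by linarith
  qed
  then have ev: "\<forall>\<^sub>F \<epsilon> in at_right 0. \<forall>\<alpha>\<in>?S. \<forall>x\<in>K. norm (A \<alpha> \<epsilon> x) \<le> \<epsilon> powr (- q)"
    by (intro eventually_ball_finite finite_mi_len) (auto simp: growth_def)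
  have mp: "\<bar>mpower \<xi> \<alpha>\<bar> \<le> (1 + norm \<xi>) ^ m" if "mi_len \<alpha> \<le> m" for \<xi> :: "real^'n" and \<alpha>
  proof -
    have "\<bar>mpower \<xi> \<alpha>\<bar> = (\<Prod>i\<in>UNIV. \<bar>\<xi> $ i\<bar> ^ \<alpha> i)" by (simp add: mpower_def abs_prod power_abs)
    also have "\<dots> \<le> (\<Prod>i\<in>UNIV. (1 + norm \<xi>) ^ \<alpha> i)"
      by (intro prod_mono) (auto intro!: power_mono order_trans[OF component_le_norm_cart])
    also have "\<dots> = (1 + norm \<xi>) ^ mi_len \<alpha>" by (simp add: power_sum mi_len_def)
    also have "\<dots> \<le> (1 + norm \<xi>) ^ m" using that by (intro power_increasing) auto
    finally show ?thesis .
  qed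
  have "\<forall>\<^sub>F \<epsilon> in at_right 0. \<forall>x\<in>K. \<forall>\<xi>. norm (op_symbol m A \<epsilon> x \<xi>) \<le> \<epsilon> powr (- (q + 1)) * (1 + norm \<xi>) powr real m"
    using ev eventually_unit_interval slow_le_inverse[OF slow_const[of "real (card ?S)"], OF of_nat_0_le_iff]
  proof eventually_elim
    case (elim \<epsilon>)
    show ?case
    proof (intro ballI allI)
      fix x and \<xi> :: "real^'n" assume x: "x \<in> K"
      have "norm (op_symbol m A \<epsilon> x \<xi>) \<le> (\<Sum>\<alpha>\<in>?S. norm (A \<alpha> \<epsilon> x * of_real (mpower \<xi> \<alpha>)))"
        unfolding op_symbol_def by (rule norm_sum)
      also have "\<dots> \<le> (\<Sum>\<alpha>\<in>?S. \<epsilon> powr (- q) * (1 + norm \<xi>) ^ m)"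
        using elim(1) x mp by (intro sum_mono) (auto simp: norm_mult intro!: mult_mono)
      also have "\<dots> = (real (card ?S) * \<epsilon> powr (- q)) * (1 + norm \<xi>) ^ m" by simp
      also have "\<dots> \<le> \<epsilon> powr (- (q + 1)) * (1 + norm \<xi>) ^ m"
        using elim(2,3) by (intro mult_right_mono mult_powr_absorb) auto
      finally show "norm (op_symbol m A \<epsilon> x \<xi>) \<le> \<epsilon> powr (- (q + 1)) * (1 + norm \<xi>) powr real m"
        by (simp add: powr_realpow)
    qed
  qed
  then show thesis by (rule that)
qed

text \<open>The derivatives of \<open>P\<close> in \<open>\<xi>\<close> gain \<open>\<rho>|\<gamma>|\<close> powers of \<open>\<langle>\<xi>\<rangle>\<close>, and the outer derivatives in
  \<open>x\<close> lose \<open>\<delta>|\<gamma>|\<close> of them.\<close>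

lemma amplitude_term_slow:
  assumes V: "open V" and P: "symbol_derivs_slow m A \<delta> \<rho> \<Gamma> V" "mi_len \<gamma> \<le> m" and w: "\<And>k. slow_symbol \<delta> \<Gamma> V k W w"
  shows "slow_symbol \<delta> \<Gamma> V k (\<lambda>z x. norm (symbol_at m A z x) * W z x * freq z powr (- (\<rho> - \<delta>) * real (mi_len \<gamma>)))
     (\<lambda>z x. c * mderiv \<gamma> (\<lambda>y. symbol_deriv_at m A \<gamma> z y * w z y) x)"
proof -
  let ?n = "real (mi_len \<gamma>)"
  have "slow_symbol \<delta> \<Gamma> V (k + length (mi_list \<gamma>)) (\<lambda>z x. norm (symbol_at m A z x) * freq z powr (- \<rho> * ?n) * W z x)
     (\<lambda>z y. symbol_deriv_at m A \<gamma> z y * w z y)"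
    using P unfolding symbol_derivs_slow_def by (intro slow_symbol_mult[OF V _ w]) blast
  from slow_symbol_cmult[OF V slow_symbol_partials[OF this], of c]
  have "slow_symbol \<delta> \<Gamma> V k (\<lambda>z x. norm (symbol_at m A z x) * freq z powr (- \<rho> * ?n) * W z x * freq z powr (\<delta> * ?n))
     (\<lambda>z x. c * mderiv \<gamma> (\<lambda>y. symbol_deriv_at m A \<gamma> z y * w z y) x)"
    by (simp only: length_mi_list mderiv_eq_partials)
  moreover have e: "norm (symbol_at m A z x) * freq z powr (- \<rho> * ?n) * W z x * freq z powr (\<delta> * ?n)
     = norm (symbol_at m A z x) * W z x * freq z powr (- (\<rho> - \<delta>) * ?n)" for z x
  proof -
    have "- (\<rho> - \<delta>) * ?n = - \<rho> * ?n + \<delta> * ?n" by (simp add: algebra_simps)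
    then show ?thesis by (simp only: powr_add mult_ac)
  qed
  ultimately show ?thesis
    by (elim slow_symbol_weight_mono) (intro always_eventually allI ballI eq_refl e)
qed

lemma amplitude_op_off_support:
  assumes "closed K" "\<And>x. x \<notin> K \<Longrightarrow> w x = 0" "x \<notin> K"
  shows "amplitude_op m A \<epsilon> \<xi> w x = 0"
  unfolding amplitude_op_def mderiv_eq_partials
  by (rule sum.neutral) (simp add: partials_off_support[OF assms(1) _ assms(3)] assms(2))

lemma freq_powr_le_1: "a \<le> 0 \<Longrightarrow> freq z powr a \<le> 1"
  using powr_mono[of a 0 "freq z"] by simp

lemma amplitude_op_slow:
  assumes V: "open V" and "\<delta> < \<rho>" and P: "symbol_derivs_slow m A \<delta> \<rho> \<Gamma> V" and w: "\<And>k. slow_symbol \<delta> \<Gamma> V k (\<lambda>z x. 1) w"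
  shows "slow_symbol \<delta> \<Gamma> V k (\<lambda>z x. norm (symbol_at m A z x)) (\<lambda>z. amplitude_op m A (fst z) (snd z) (w z))"
  unfolding amplitude_op_def
proof (rule slow_symbol_sum[OF V])
  fix \<gamma> :: "'a multi_index" assume "\<gamma> \<in> {\<gamma>. mi_len \<gamma> \<le> m}"
  then have \<gamma>: "mi_len \<gamma> \<le> m" by simp
  show "slow_symbol \<delta> \<Gamma> V k (\<lambda>z x. norm (symbol_at m A z x))
     (\<lambda>z x. \<i> ^ mi_len \<gamma> / of_real (mfact \<gamma>) * mderiv \<gamma> (\<lambda>y. symbol_deriv_at m A \<gamma> z y * w z y) x)"
  proof (rule slow_symbol_weight_mono[OF amplitude_term_slow[OF V P \<gamma> w]], intro always_eventually allI ballI)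
    fix z :: "real \<times> (real^'a)" and x
    have "freq z powr (- (\<rho> - \<delta>) * real (mi_len \<gamma>)) \<le> 1"
      using assms(2) by (intro freq_powr_le_1) (simp add: mult_nonpos_nonneg)
    from mult_left_mono[OF this norm_ge_zero[of "symbol_at m A z x"]]
    show "norm (symbol_at m A z x) * 1 * freq z powr (- (\<rho> - \<delta>) * real (mi_len \<gamma>)) \<le> norm (symbol_at m A z x)"
      by simp
  qed
qed simp

section \<open>Localisation\<close>

text \<open>Near a point where \<open>f\<close> is microlocally regular there is one cut-off \<open>\<psi>\<close> that serves all
  amplitudes supported in the ball of radius \<open>r\<close>: there \<open>\<psi> = 1\<close>, so \<open>f\<close> may be replaced by
  \<open>\<psi> f\<close>, whose transform decays in \<open>\<Gamma>\<^sub>1\<close>.  Frequencies in \<open>\<Gamma>'\<close> stay away from the complement of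
  \<open>\<Gamma>\<^sub>1\<close>, as \<open>symbol_pairing_decay\<close> requires.\<close>

lemma microlocal_localisation:
  fixes f :: "'n::finite net"
  assumes \<Omega>: "open \<Omega>" and f: "f \<in> moderate \<Omega>" and U: "open U" "U \<subseteq> \<Omega>" "x\<^sub>1 \<in> U" and \<Gamma>: "open_cone \<Gamma>" "\<xi>\<^sub>1 \<in> \<Gamma>"
    and reg: "microlocally_regular_net \<Omega> f x\<^sub>1 \<xi>\<^sub>1"
  obtains r s \<psi> \<Gamma>' c \<Gamma>\<^sub>1 M N where "0 < r" "r < s" "cball x\<^sub>1 s \<subseteq> U" "\<And>x. x \<in> cball x\<^sub>1 r \<Longrightarrow> \<psi> x = 1"
    "open_cone \<Gamma>'" "\<xi>\<^sub>1 \<in> \<Gamma>'" "\<Gamma>' \<subseteq> \<Gamma>" "0 < c" "c \<le> 1 / 2"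
    "\<And>\<xi> \<eta>. \<xi> \<in> \<Gamma>' \<Longrightarrow> \<eta> \<notin> \<Gamma>\<^sub>1 \<Longrightarrow> c * norm \<xi> \<le> norm (\<xi> - \<eta>)"
    "\<forall>\<^sub>F \<epsilon> in at_right 0. integrable lborel (\<lambda>x. \<psi> x * f \<epsilon> x)"
    "\<forall>\<^sub>F \<epsilon> in at_right 0. \<forall>\<eta>. norm (fourier (\<lambda>x. \<psi> x * f \<epsilon> x) \<eta>) \<le> \<epsilon> powr (- M)"
    "\<And>l::nat. \<forall>\<^sub>F \<epsilon> in at_right 0. \<forall>\<eta>\<in>\<Gamma>\<^sub>1. norm (fourier (\<lambda>x. \<psi> x * f \<epsilon> x) \<eta>) * (1 + norm \<eta>) ^ l \<le> \<epsilon> powr (- N)"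
proof -
  obtain U1 \<Gamma>0 where U1: "open U1" "U1 \<subseteq> \<Omega>" "x\<^sub>1 \<in> U1" "open_cone \<Gamma>0" "\<xi>\<^sub>1 \<in> \<Gamma>0"
    and dec: "\<And>\<phi>. \<phi> \<in> test_functions U1 \<Longrightarrow> rapidly_decreasing \<Gamma>0 (\<lambda>\<epsilon>. fourier (\<lambda>x. \<phi> x * f \<epsilon> x))"
    using reg unfolding microlocally_regular_net_iff by blast
  have "open (U \<inter> U1)" "x\<^sub>1 \<in> U \<inter> U1" using U U1 by auto
  then obtain s where s: "s > 0" "cball x\<^sub>1 s \<subseteq> U \<inter> U1" unfolding open_contains_cball by blast
  define r where "r = s / 2"
  have r: "0 < r" "r < s" using s by (auto simp: r_def)
  obtain \<psi> :: "real^'n \<Rightarrow> complex" where \<psi>: "smooth_on UNIV \<psi>" "\<And>x. x \<in> cball x\<^sub>1 r \<Longrightarrow> \<psi> x = 1" "\<And>x. x \<notin> cball x\<^sub>1 s \<Longrightarrow> \<psi> x = 0"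
    using cutoff_exists[OF r, of x\<^sub>1] by blast
  have "closure {x. \<psi> x \<noteq> 0} \<subseteq> cball x\<^sub>1 s" by (rule closure_minimal) (use \<psi>(3) in blast, simp)
  then have \<psi>t: "\<psi> \<in> test_functions U1" "\<psi> \<in> test_functions \<Omega>"
    using s \<psi>(1) U1(2) compact_closure bounded_subset[OF bounded_cball] unfolding test_functions_def
    by (auto simp: compact_eq_bounded_closed)
  have "open_cone (\<Gamma> \<inter> \<Gamma>0)" "\<xi>\<^sub>1 \<in> \<Gamma> \<inter> \<Gamma>0" using \<Gamma> U1 by (auto intro: open_cone_Int)
  from open_cone_shrink[OF this] obtain \<Gamma>' c where \<Gamma>': "open_cone \<Gamma>'" "\<xi>\<^sub>1 \<in> \<Gamma>'" "\<Gamma>' \<subseteq> \<Gamma> \<inter> \<Gamma>0" "0 < c" "c \<le> 1 / 2"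
    "\<And>\<xi> \<eta>. \<xi> \<in> \<Gamma>' \<Longrightarrow> \<eta> \<notin> \<Gamma> \<inter> \<Gamma>0 \<Longrightarrow> c * norm \<xi> \<le> norm (\<xi> - \<eta>)" by blast
  obtain M where M: "\<forall>\<^sub>F \<epsilon> in at_right 0. \<forall>\<eta>. norm (fourier (\<lambda>x. \<psi> x * f \<epsilon> x) \<eta>) \<le> \<epsilon> powr (- M)"
    using moderate_test_bound[OF \<Omega> f compact_cball _ \<psi>(3) smooth_on_imp_continuous[OF \<psi>(1)]] s U by blast
  obtain N where N: "\<And>l::nat. \<forall>\<^sub>F \<epsilon> in at_right 0. \<forall>\<eta>\<in>\<Gamma>0. norm (fourier (\<lambda>x. \<psi> x * f \<epsilon> x) \<eta>) * (1 + norm \<eta>) ^ l \<le> \<epsilon> powr (- N)"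
    using dec[OF \<psi>t(1)] unfolding rapidly_decreasing_def by blast
  show thesis
  proof (rule that[OF r _ \<psi>(2) \<Gamma>'(1,2) _ \<Gamma>'(4,5) _ moderate_test_integrable[OF \<Omega> f \<psi>t(2)] M N])
    show "c * norm \<xi> \<le> norm (\<xi> - \<eta>)" if "\<xi> \<in> \<Gamma>'" "\<eta> \<notin> \<Gamma>0" for \<xi> \<eta> using \<Gamma>'(6) that by blast
  qed (use s \<Gamma>'(3) in auto)
qed

lemma fourier_product_cutoff:
  assumes "\<And>x. x \<notin> K \<Longrightarrow> g x = 0" "\<And>x. x \<in> K \<Longrightarrow> \<psi> x = 1"
  shows "fourier (\<lambda>x. g x * f x) = fourier (\<lambda>x. g x * (\<psi> x * f x))"
proof -
  have "(\<lambda>x. g x * f x) = (\<lambda>x. g x * (\<psi> x * f x))"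
  proof
    show "g x * f x = g x * (\<psi> x * f x)" for x using assms by (cases "x \<in> K") auto
  qed
  then show ?thesis by (rule arg_cong)
qed

section \<open>The parametrix\<close>

text \<open>With \<open>T\<close> the transpose acting on amplitudes, \<open>T(v/P) = v - R v\<close>; the remainder \<open>R v\<close>
  collects the terms of \<open>T\<close> with at least one \<open>\<xi>\<close>-derivative of the symbol.\<close>

definition remainder_op ::
    "nat \<Rightarrow> ('n::finite multi_index \<Rightarrow> 'n net) \<Rightarrow> real \<times> (real ^ 'n) \<Rightarrow> (real ^ 'n \<Rightarrow> complex) \<Rightarrow> real ^ 'n \<Rightarrow> complex" where
  "remainder_op m A z v x = - (\<Sum>\<gamma> \<in> {\<gamma>. mi_len \<gamma> \<le> m} - {\<lambda>i. 0}.
     (\<i> ^ mi_len \<gamma> / of_real (mfact \<gamma>)) *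
       mderiv \<gamma> (\<lambda>y. symbol_deriv_at m A \<gamma> z y * (v y * inverse (symbol_at m A z y))) x)"

lemma amplitude_op_quotient:
  assumes "symbol_at m A z x \<noteq> 0"
  shows "amplitude_op m A (fst z) (snd z) (\<lambda>y. v y * inverse (symbol_at m A z y)) x = v x - remainder_op m A z v x"
proof -
  have z0: "mi_len (\<lambda>i::'a. 0) = 0" by (simp add: mi_len_def)
  have mem: "(\<lambda>i. 0) \<in> {\<gamma> :: 'a multi_index. mi_len \<gamma> \<le> m}" by (simp add: z0)
  show ?thesis
    unfolding amplitude_op_def remainder_op_def
    by (subst sum.remove[OF finite_mi_len mem]) (use assms in \<open>simp add: mderiv_0 mfact_zero z0\<close>)
qed

lemma remainder_op_off_support:
  assumes "closed K" "\<And>x. x \<notin> K \<Longrightarrow> v x = 0" "x \<notin> K"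
  shows "remainder_op m A z v x = 0"
  unfolding remainder_op_def mderiv_eq_partials neg_equal_0_iff_equal
  by (rule sum.neutral) (simp add: partials_off_support[OF assms(1) _ assms(3)] assms(2))

lemma amplitude_op_sum:
  assumes "open V" "\<And>\<alpha>. mi_len \<alpha> \<le> m \<Longrightarrow> smooth_on V (A \<alpha> \<epsilon>)" "\<And>j. j \<in> S \<Longrightarrow> smooth_on V (w j)" "x \<in> V"
  shows "amplitude_op m A \<epsilon> \<xi> (\<lambda>x. \<Sum>j\<in>S. w j x) x = (\<Sum>j\<in>S. amplitude_op m A \<epsilon> \<xi> (w j) x)"
proof -
  have s: "smooth_on V (\<lambda>y. mderiv \<gamma> (\<lambda>\<eta>. op_symbol m A \<epsilon> y \<eta>) \<xi>)" for \<gamma>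
    by (rule smooth_on_op_symbol_deriv[OF assms(1)]) (rule assms(2))
  have "mderiv \<gamma> (\<lambda>y. mderiv \<gamma> (\<lambda>\<eta>. op_symbol m A \<epsilon> y \<eta>) \<xi> * (\<Sum>j\<in>S. w j y)) x
      = (\<Sum>j\<in>S. mderiv \<gamma> (\<lambda>y. mderiv \<gamma> (\<lambda>\<eta>. op_symbol m A \<epsilon> y \<eta>) \<xi> * w j y) x)" for \<gamma>
    unfolding sum_distrib_left mderiv_eq_partials[of \<gamma>]
    by (rule partials_sum[OF assms(1) _ assms(4)])
       (use assms s[of \<gamma>] in \<open>auto intro!: smooth_on_mult simp: mderiv_eq_partials\<close>)
  then show ?thesis unfolding amplitude_op_def
    by (simp add: sum_distrib_left) (rule sum.swap)
qed

text \<open>The weights \<open>|P|\<close> and \<open>1/|P|\<close> cancel, and all terms have \<open>|\<gamma>| \<ge> 1\<close>, so each of them gains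
  at least one factor \<open>\<langle>\<xi>\<rangle>^{-(\<rho>-\<delta>)}\<close>.\<close>

lemma remainder_op_slow:
  assumes V: "open V" and \<delta>\<rho>: "\<delta> < \<rho>" and P: "symbol_derivs_slow m A \<delta> \<rho> \<Gamma> V"
    and inv: "\<And>k. slow_symbol \<delta> \<Gamma> V k (\<lambda>z x. inverse (norm (symbol_at m A z x))) (\<lambda>z x. inverse (symbol_at m A z x))"
    and v: "\<And>k. slow_symbol \<delta> \<Gamma> V k (\<lambda>z x. W z) v" and W: "\<And>z. 0 \<le> W z"
  shows "slow_symbol \<delta> \<Gamma> V k (\<lambda>z x. W z * freq z powr (- (\<rho> - \<delta>))) (\<lambda>z. remainder_op m A z (v z))"
proof -
  let ?P = "symbol_at m A"
  have w: "slow_symbol \<delta> \<Gamma> V k (\<lambda>z x. W z * inverse (norm (?P z x))) (\<lambda>z x. v z x * inverse (?P z x))" for k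
    by (rule slow_symbol_mult[OF V v inv])
  have "slow_symbol \<delta> \<Gamma> V k (\<lambda>z x. W z * freq z powr (- (\<rho> - \<delta>)))
     (\<lambda>z x. \<Sum>\<gamma> \<in> {\<gamma>. mi_len \<gamma> \<le> m} - {\<lambda>i. 0}. (\<i> ^ mi_len \<gamma> / of_real (mfact \<gamma>)) *
       mderiv \<gamma> (\<lambda>y. symbol_deriv_at m A \<gamma> z y * (v z y * inverse (?P z y))) x)"
  proof (rule slow_symbol_sum[OF V])
    fix \<gamma> :: "'a multi_index" assume "\<gamma> \<in> {\<gamma>. mi_len \<gamma> \<le> m} - {\<lambda>i. 0}"
    then have \<gamma>: "mi_len \<gamma> \<le> m" and "\<gamma> \<noteq> (\<lambda>i. 0)" by auto
    then obtain i where "\<gamma> i \<noteq> 0" by auto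
    then have ge1: "1 \<le> mi_len \<gamma>" unfolding mi_len_def by (metis One_nat_def Suc_leI finite iso_tuple_UNIV_I less_one not_less sum_eq_0_iff)
    show "slow_symbol \<delta> \<Gamma> V k (\<lambda>z x. W z * freq z powr (- (\<rho> - \<delta>)))
     (\<lambda>z x. (\<i> ^ mi_len \<gamma> / of_real (mfact \<gamma>)) *
       mderiv \<gamma> (\<lambda>y. symbol_deriv_at m A \<gamma> z y * (v z y * inverse (?P z y))) x)"
    proof (rule slow_symbol_weight_mono[OF amplitude_term_slow[OF V P \<gamma> w]], intro always_eventually allI ballI)
      fix z :: "real \<times> (real^'a)" and x
      have "(\<rho> - \<delta>) * 1 \<le> (\<rho> - \<delta>) * real (mi_len \<gamma>)" using ge1 \<delta>\<rho> by (intro mult_left_mono) auto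
      then have le: "freq z powr (- (\<rho> - \<delta>) * real (mi_len \<gamma>)) \<le> freq z powr (- (\<rho> - \<delta>))"
        by (intro powr_mono) (simp_all add: algebra_simps)
      have le1: "norm (?P z x) * (W z * inverse (norm (?P z x))) \<le> W z"
        using W[of z] by (cases "?P z x = 0") (simp_all add: field_simps)
      show "norm (?P z x) * (W z * inverse (norm (?P z x))) * freq z powr (- (\<rho> - \<delta>) * real (mi_len \<gamma>))
         \<le> W z * freq z powr (- (\<rho> - \<delta>))"
        by (rule mult_mono[OF le1 le]) (use W in auto)
    qed
  qed (use W in auto)
  from slow_symbol_cmult[OF V this, of "- 1"] show ?thesis
    by (simp add: remainder_op_def[abs_def])
qed


lemma iterated_remainder_slow:
  assumes V: "open V" and \<delta>\<rho>: "\<delta> < \<rho>" and P: "symbol_derivs_slow m A \<delta> \<rho> \<Gamma> V"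
    and inv: "\<And>k. slow_symbol \<delta> \<Gamma> V k (\<lambda>z x. inverse (norm (symbol_at m A z x))) (\<lambda>z x. inverse (symbol_at m A z x))"
    and \<phi>: "\<And>k. slow_symbol \<delta> \<Gamma> V k (\<lambda>z x. 1) (\<lambda>z. \<phi>)"
  shows "slow_symbol \<delta> \<Gamma> V k (\<lambda>z x. freq z powr (- (\<rho> - \<delta>) * real j)) (\<lambda>z. (remainder_op m A z ^^ j) \<phi>)"
proof (induction j arbitrary: k)
  case 0
  show ?case using \<phi> by simp
next
  case (Suc j)
  have "slow_symbol \<delta> \<Gamma> V k (\<lambda>z x. freq z powr (- (\<rho> - \<delta>) * real j) * freq z powr (- (\<rho> - \<delta>)))
      (\<lambda>z. remainder_op m A z ((remainder_op m A z ^^ j) \<phi>))"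
    by (rule remainder_op_slow[OF V \<delta>\<rho> P inv Suc.IH]) simp_all
  moreover have "freq z powr (- (\<rho> - \<delta>) * real j) * freq z powr (- (\<rho> - \<delta>)) = freq z powr (- (\<rho> - \<delta>) * real (Suc j))"
    for z :: "real \<times> (real^'a)"
    unfolding powr_add[symmetric] by (simp add: algebra_simps)
  ultimately show ?case by simp
qed

lemma iterated_remainder_off_support:
  assumes "closed K" "\<And>x. x \<notin> K \<Longrightarrow> \<phi> x = 0"
  shows "x \<notin> K \<Longrightarrow> (remainder_op m A z ^^ j) \<phi> x = 0"
proof (induction j arbitrary: x)
  case (Suc j)
  show ?case using remainder_op_off_support[OF assms(1) Suc.IH Suc.prems] by simp
qed (simp add: assms(2))

text \<open>The truncated Neumann series for the inverse of \<open>v \<mapsto> T(v/P) = v - R v\<close>, divided by the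
  symbol.\<close>

definition parametrix ::
    "nat \<Rightarrow> ('n::finite multi_index \<Rightarrow> 'n net) \<Rightarrow> nat \<Rightarrow> (real ^ 'n \<Rightarrow> complex) \<Rightarrow> real \<times> (real ^ 'n) \<Rightarrow> real ^ 'n \<Rightarrow> complex" where
  "parametrix m A J \<phi> z x = (\<Sum>j<J. (remainder_op m A z ^^ j) \<phi> x) * inverse (symbol_at m A z x)"

lemma parametrix_slow:
  assumes V: "open V" and \<delta>\<rho>: "\<delta> < \<rho>" and P: "symbol_derivs_slow m A \<delta> \<rho> \<Gamma> V"
    and inv: "\<And>k. slow_symbol \<delta> \<Gamma> V k (\<lambda>z x. inverse (norm (symbol_at m A z x))) (\<lambda>z x. inverse (symbol_at m A z x))"
    and \<phi>: "\<And>k. slow_symbol \<delta> \<Gamma> V k (\<lambda>z x. 1) (\<lambda>z. \<phi>)"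
  shows "slow_symbol \<delta> \<Gamma> V k (\<lambda>z x. inverse (norm (symbol_at m A z x))) (parametrix m A J \<phi>)"
proof -
  have "slow_symbol \<delta> \<Gamma> V k (\<lambda>z x. 1) (\<lambda>z. (remainder_op m A z ^^ j) \<phi>)" for j
    by (rule slow_symbol_weight_mono[OF iterated_remainder_slow[OF V \<delta>\<rho> P inv \<phi>]])
       (intro always_eventually allI ballI freq_powr_le_1, use \<delta>\<rho> in \<open>simp add: mult_nonpos_nonneg\<close>)
  then have "slow_symbol \<delta> \<Gamma> V k (\<lambda>z x. 1) (\<lambda>z x. \<Sum>j<J. (remainder_op m A z ^^ j) \<phi> x)"
    by (intro slow_symbol_sum V) auto
  from slow_symbol_mult[OF V this inv] show ?thesis by (simp add: parametrix_def[abs_def])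
qed

lemma amplitude_op_parametrix:
  assumes V: "open V" "x \<in> V" and A: "\<And>\<alpha>. mi_len \<alpha> \<le> m \<Longrightarrow> smooth_on V (A \<alpha> (fst z))"
    and nz: "symbol_at m A z x \<noteq> 0" and inv: "smooth_on V (\<lambda>x. inverse (symbol_at m A z x))"
    and R: "\<And>j. j < J \<Longrightarrow> smooth_on V ((remainder_op m A z ^^ j) \<phi>)"
  shows "amplitude_op m A (fst z) (snd z) (parametrix m A J \<phi> z) x = \<phi> x - (remainder_op m A z ^^ J) \<phi> x"
proof -
  let ?R = "\<lambda>j. (remainder_op m A z ^^ j) \<phi>"
  have "parametrix m A J \<phi> z = (\<lambda>x. \<Sum>j<J. ?R j x * inverse (symbol_at m A z x))"
    by (simp add: parametrix_def fun_eq_iff sum_distrib_right)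
  then have "amplitude_op m A (fst z) (snd z) (parametrix m A J \<phi> z) x
      = (\<Sum>j<J. amplitude_op m A (fst z) (snd z) (\<lambda>x. ?R j x * inverse (symbol_at m A z x)) x)"
    by (simp only:) (rule amplitude_op_sum[OF V(1) _ _ V(2)], use A inv R V(1) in \<open>auto intro: smooth_on_mult\<close>)
  also have "\<dots> = (\<Sum>j<J. ?R j x - ?R (Suc j) x)"
    by (simp add: amplitude_op_quotient[OF nz])
  also have "\<dots> = ?R 0 x - ?R J x" by (rule sum_lessThan_telescope')
  finally show ?thesis by simp
qed

text \<open>Here the decay in \<open>\<xi>\<close> comes from the size of the amplitude, not from oscillation.\<close>

lemma decaying_amplitude_fourier:
  assumes K: "compact K" "K \<subseteq> V" "\<And>z x. x \<notin> K \<Longrightarrow> g z x = 0" and v: "growth K [] v (- p)"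
    and g: "slow_bound \<Gamma> V (\<lambda>z x. freq z powr a) g" "a + real l \<le> 0"
  shows "\<forall>\<^sub>F z in high_freq \<Gamma>. norm (fourier (\<lambda>x. g z x * v (fst z) x) (snd z)) * freq z ^ l \<le> fst z powr (- (p + 1))"
proof -
  obtain b where b: "slow b" "\<forall>\<^sub>F z in high_freq \<Gamma>. \<forall>x\<in>V. norm (g z x) \<le> b (fst z) * freq z powr a"
    using g(1) unfolding slow_bound_def by blast
  let ?vol = "measure lborel K"
  have bv: "slow (\<lambda>\<epsilon>. b \<epsilon> * ?vol)" by (intro slow_mult slow_const b) simp
  show ?thesis
    using b(2) eventually_high_freq_fst[OF v[unfolded growth_def]] eventually_high_freq_fst[OF slow_nonneg[OF b(1)]]
      eventually_high_freq_fst[OF slow_le_inverse[OF bv]] eventually_high_freq_pos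
  proof eventually_elim
    case (elim z)
    let ?\<epsilon> = "fst z"
    have "norm (fourier (\<lambda>x. g z x * v ?\<epsilon> x) (snd z)) \<le> (b ?\<epsilon> * freq z powr a * ?\<epsilon> powr (- p)) * ?vol"
    proof (rule norm_fourier_le[OF K(1)])
      fix x assume "x \<in> K"
      then have "norm (g z x) \<le> b ?\<epsilon> * freq z powr a" "norm (v ?\<epsilon> x) \<le> ?\<epsilon> powr (- p)"
        using elim(1,2) K(2) by auto
      then show "norm (g z x * v ?\<epsilon> x) \<le> b ?\<epsilon> * freq z powr a * ?\<epsilon> powr (- p)"
        using elim(3) unfolding norm_mult by (intro mult_mono) auto
    qed (use K(3) elim(3) in auto)
    then have "norm (fourier (\<lambda>x. g z x * v ?\<epsilon> x) (snd z)) * freq z ^ l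
        \<le> (b ?\<epsilon> * freq z powr a * ?\<epsilon> powr (- p)) * ?vol * freq z ^ l"
      by (rule mult_right_mono) simp
    also have "\<dots> = (b ?\<epsilon> * ?vol * ?\<epsilon> powr (- p)) * freq z powr (a + real l)"
      by (simp add: powr_add powr_realpow)
    also have "\<dots> \<le> (b ?\<epsilon> * ?vol * ?\<epsilon> powr (- p)) * 1"
      by (rule mult_left_mono[OF freq_powr_le_1[OF g(2)]]) (use elim(3) in simp)
    also have "\<dots> \<le> ?\<epsilon> powr (- (p + 1))" using mult_powr_absorb[OF _ elim(4), of p] elim(5) by simp
    finally show ?case .
  qed
qed

section \<open>The microlocal equivalence for nets\<close>

locale microlocal_operator =
  fixes \<Omega> U \<Gamma> :: "(real ^ 'n::finite) set" and m :: nat and A :: "'n multi_index \<Rightarrow> 'n net" and \<delta> \<rho> :: real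
  assumes \<Omega>: "open \<Omega>" and A: "\<And>\<alpha>. mi_len \<alpha> \<le> m \<Longrightarrow> A \<alpha> \<in> moderate \<Omega>"
    and U: "open U" "U \<subseteq> \<Omega>" and \<Gamma>: "open_cone \<Gamma>"
    and \<delta>\<rho>: "0 \<le> \<delta>" "\<delta> < \<rho>" "\<rho> \<le> 1"
    and est: "\<And>K. compact K \<Longrightarrow> K \<subseteq> U \<Longrightarrow> symbol_estimates m A \<delta> \<rho> \<Gamma> K"
begin

lemma operator_moderate: "v \<in> moderate \<Omega> \<Longrightarrow> diff_op_net m A v \<in> moderate \<Omega>"
  by (rule diff_op_net_moderate[OF \<Omega>]) (rule A)

lemma coefficients_smooth: "V \<subseteq> \<Omega> \<Longrightarrow> mi_len \<alpha> \<le> m \<Longrightarrow> \<epsilon> \<in> {0<..1} \<Longrightarrow> smooth_on V (A \<alpha> \<epsilon>)"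
  using smooth_on_subset[OF moderate_smooth[OF A]] by blast

lemma ball_in_\<Omega>: "cball x s \<subseteq> U \<Longrightarrow> ball x s \<subseteq> \<Omega>"
  using ball_subset_cball U(2) by blast

lemma symbol_derivs_slow_ball:
  assumes "cball x s \<subseteq> U" "\<Gamma>' \<subseteq> \<Gamma>" shows "symbol_derivs_slow m A \<delta> \<rho> \<Gamma>' (ball x s)"
  by (rule symbol_estimates_imp_slow[OF open_ball ball_subset_cball assms(2) coefficients_smooth[OF ball_in_\<Omega>[OF assms(1)]] est[OF compact_cball assms(1)]])

lemma test_function_slow:
  assumes "smooth_on UNIV \<phi>" shows "slow_symbol \<delta> \<Gamma>' (ball x s) k (\<lambda>z x. 1) (\<lambda>z. \<phi>)"
proof (rule slow_symbol_fixed[OF \<delta>\<rho>(1) _ smooth_on_subset[OF assms]])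
  fix "is"
  have "bounded (partials is \<phi> ` cball x s)"
    by (intro compact_imp_bounded compact_continuous_image compact_cball
          continuous_on_subset[OF smooth_on_imp_continuous[OF smooth_on_partials[OF assms]]]) simp
  then show "bounded (partials is \<phi> ` ball x s)" by (rule bounded_subset) (intro image_mono ball_subset_cball)
qed simp

text \<open>The amplitude \<open>T \<phi>\<close> is a symbol of weight \<open>|P|\<close>, which is bounded by a power of \<open>1/\<epsilon>\<close> times
  \<open>\<langle>\<xi>\<rangle>^m\<close>.\<close>

theorem diff_op_preserves_regularity:
  assumes v: "v \<in> moderate \<Omega>" and pt: "x\<^sub>1 \<in> U" "\<xi>\<^sub>1 \<in> \<Gamma>" and reg: "microlocally_regular_net \<Omega> v x\<^sub>1 \<xi>\<^sub>1"
  shows "microlocally_regular_net \<Omega> (diff_op_net m A v) x\<^sub>1 \<xi>\<^sub>1"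
proof -
  obtain r s \<psi> \<Gamma>' c \<Gamma>\<^sub>1 M N where r: "0 < r" "r < s" and s: "cball x\<^sub>1 s \<subseteq> U" and \<psi>: "\<And>x. x \<in> cball x\<^sub>1 r \<Longrightarrow> \<psi> x = 1"
    and \<Gamma>': "open_cone \<Gamma>'" "\<xi>\<^sub>1 \<in> \<Gamma>'" "\<Gamma>' \<subseteq> \<Gamma>"
    and c: "0 < c" "c \<le> 1 / 2" "\<And>\<xi> \<eta>. \<xi> \<in> \<Gamma>' \<Longrightarrow> \<eta> \<notin> \<Gamma>\<^sub>1 \<Longrightarrow> c * norm \<xi> \<le> norm (\<xi> - \<eta>)"
    and h: "\<forall>\<^sub>F \<epsilon> in at_right 0. integrable lborel (\<lambda>x. \<psi> x * v \<epsilon> x)"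
    and hB: "\<forall>\<^sub>F \<epsilon> in at_right 0. \<forall>\<eta>. norm (fourier (\<lambda>x. \<psi> x * v \<epsilon> x) \<eta>) \<le> \<epsilon> powr (- M)"
    and hA: "\<And>l::nat. \<forall>\<^sub>F \<epsilon> in at_right 0. \<forall>\<eta>\<in>\<Gamma>\<^sub>1. norm (fourier (\<lambda>x. \<psi> x * v \<epsilon> x) \<eta>) * (1 + norm \<eta>) ^ l \<le> \<epsilon> powr (- N)"
    by (rule microlocal_localisation[OF \<Omega> v U pt(1) \<Gamma> pt(2) reg], rule that, assumption+)
  define V where "V = ball x\<^sub>1 s"
  have V: "open V" "V \<subseteq> cball x\<^sub>1 s" "V \<subseteq> \<Omega>" using ball_in_\<Omega>[OF s] by (auto simp: V_def)
  note smA = coefficients_smooth[OF V(3)]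
  have P: "symbol_derivs_slow m A \<delta> \<rho> \<Gamma>' V" unfolding V_def by (rule symbol_derivs_slow_ball[OF s \<Gamma>'(3)])
  obtain q where q: "\<forall>\<^sub>F \<epsilon> in at_right 0. \<forall>x\<in>cball x\<^sub>1 s. \<forall>\<xi>. norm (op_symbol m A \<epsilon> x \<xi>) \<le> \<epsilon> powr (- q) * (1 + norm \<xi>) powr real m"
    by (rule op_symbol_moderate[where A = A and m = m, OF \<Omega> _ compact_cball subset_trans[OF s U(2)]], rule A, assumption, blast)
  note PAv = operator_moderate[OF v]
  have "rapidly_decreasing \<Gamma>' (\<lambda>\<epsilon>. fourier (\<lambda>x. \<phi> x * diff_op_net m A v \<epsilon> x))" if ph: "\<phi> \<in> test_functions (ball x\<^sub>1 r)" for \<phi>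
  proof -
    obtain K where K: "compact K" "K \<subseteq> ball x\<^sub>1 r" "\<And>x. x \<notin> K \<Longrightarrow> \<phi> x = 0" and \<phi>: "smooth_on UNIV \<phi>"
      using test_functions_support[OF ph] by blast
    have KV: "K \<subseteq> V" using K(2) r by (auto simp: V_def)
    have K\<Omega>: "K \<subseteq> \<Omega>" using KV V(3) by auto
    have \<phi>s: "slow_symbol \<delta> \<Gamma>' V k (\<lambda>z x. 1) (\<lambda>z. \<phi>)" for k
      unfolding V_def by (rule test_function_slow[OF \<phi>])
    let ?g = "\<lambda>z. amplitude_op m A (fst z) (snd z) \<phi>"
    have g: "slow_symbol \<delta> \<Gamma>' V k (\<lambda>z x. norm (symbol_at m A z x)) ?g" for k
      by (rule amplitude_op_slow[OF V(1) \<delta>\<rho>(2) P \<phi>s])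
    have g0: "?g z x = 0" if "x \<notin> K" for z x
      by (rule amplitude_op_off_support[OF compact_imp_closed[OF K(1)] K(3) that])
    obtain M' where M': "\<forall>\<^sub>F \<epsilon> in at_right 0. \<forall>\<xi>. norm (fourier (\<lambda>x. \<phi> x * diff_op_net m A v \<epsilon> x) \<xi>) \<le> \<epsilon> powr (- M')"
      by (rule moderate_test_bound[OF \<Omega> PAv K(1) K\<Omega> _ smooth_on_imp_continuous[OF \<phi>]], rule K(3), assumption, blast)
    show ?thesis
    proof (rule rapidly_decreasing_high_freqI[OF M'])
      fix l :: nat
      have "\<forall>\<^sub>F z in high_freq \<Gamma>'. norm (fourier (\<lambda>x. ?g z x * (\<psi> x * v (fst z) x)) (snd z)) * freq z ^ l
        \<le> fst z powr (- (q + max M N + 1))"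
      proof (rule symbol_pairing_decay[OF V(1) K(1) KV \<delta>\<rho>(1) _ g _ _ _ h hB hA c])
        show "\<forall>\<^sub>F z in high_freq \<Gamma>'. \<forall>x\<in>V. norm (symbol_at m A z x) \<le> fst z powr (- q) * freq z powr real m"
          using eventually_high_freq_fst[OF q] by eventually_elim (use V(2) in blast)
      qed (use \<delta>\<rho> g0 in auto)
      then show "\<forall>\<^sub>F z in high_freq \<Gamma>'. norm (fourier (\<lambda>x. \<phi> x * diff_op_net m A v (fst z) x) (snd z)) * freq z ^ l
        \<le> fst z powr (- (q + max M N + 1))"
        using eventually_high_freq_fst[OF eventually_unit_interval]
      proof eventually_elim
        case (elim z)
        have "fourier (\<lambda>x. \<phi> x * diff_op_net m A v (fst z) x) (snd z) = fourier (\<lambda>x. ?g z x * v (fst z) x) (snd z)"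
          by (rule fourier_diff_op[OF V(1) _ K(1) KV _ _ K(3)])
             (use elim(2) smA smooth_on_subset[OF moderate_smooth[OF v] V(3)] smooth_on_subset[OF \<phi>] in auto)
        also have "fourier (\<lambda>x. ?g z x * v (fst z) x) = fourier (\<lambda>x. ?g z x * (\<psi> x * v (fst z) x))"
          by (rule fourier_product_cutoff[OF g0 \<psi>]) (use K(2) in auto)
        finally show ?case using elim(1) by simp
      qed
    qed
  qed
  moreover have "ball x\<^sub>1 r \<subseteq> \<Omega>" using r V(3) by (auto simp: V_def)
  ultimately show ?thesis
    unfolding microlocally_regular_net_iff using r(1) \<Gamma>'(1,2)
    by (intro exI[of _ "ball x\<^sub>1 r"] exI[of _ \<Gamma>']) auto
qed

text \<open>The lower bound on the symbol turns the weight \<open>1/|P|\<close> into a power of \<open>1/\<epsilon>\<close> times a power of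
  \<open>\<langle>\<xi>\<rangle>\<close>.\<close>

lemma elliptic_inverse_bound:
  assumes ell: "\<exists>q>0. \<exists>r \<epsilon>\<^sub>0. pos_slow_scale r \<and> \<epsilon>\<^sub>0 > 0 \<and>
        (\<forall>\<epsilon>. 0 < \<epsilon> \<and> \<epsilon> < \<epsilon>\<^sub>0 \<longrightarrow> (\<forall>x\<in>K. \<forall>\<xi>\<in>\<Gamma>. norm \<xi> \<ge> r \<epsilon> \<longrightarrow>
          norm (op_symbol m A \<epsilon> x \<xi>) \<ge> \<epsilon> powr q * (1 + norm \<xi>) powr m\<^sub>0))"
    and sub: "V \<subseteq> K" "\<Gamma>' \<subseteq> \<Gamma>"
  obtains q where "\<forall>\<^sub>F z in high_freq \<Gamma>'. \<forall>x\<in>V. symbol_at m A z x \<noteq> 0 \<and>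
    inverse (norm (symbol_at m A z x)) \<le> fst z powr (- q) * freq z powr (- m\<^sub>0)"
proof -
  obtain q \<tau> e where e: "pos_slow_scale \<tau>" "e > 0"
    and lower: "\<And>\<epsilon> x \<xi>. 0 < \<epsilon> \<Longrightarrow> \<epsilon> < e \<Longrightarrow> x \<in> K \<Longrightarrow> \<xi> \<in> \<Gamma> \<Longrightarrow> \<tau> \<epsilon> \<le> norm \<xi> \<Longrightarrow>
        \<epsilon> powr q * (1 + norm \<xi>) powr m\<^sub>0 \<le> norm (op_symbol m A \<epsilon> x \<xi>)"
    using ell by (elim exE conjE) metis
  have "\<forall>\<^sub>F z in high_freq \<Gamma>'. \<forall>x\<in>V. fst z powr q * freq z powr m\<^sub>0 \<le> norm (symbol_at m A z x)"
    unfolding eventually_high_freq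
    by (intro exI[of _ \<tau>] conjI pos_slow_scale_imp_slow[OF e(1)] eventually_mono[OF eventually_at_right_0_small[OF e(2)]])
       (use lower sub in \<open>simp add: subset_iff\<close>)
  with eventually_high_freq_pos[of \<Gamma>']
  have "\<forall>\<^sub>F z in high_freq \<Gamma>'. \<forall>x\<in>V. symbol_at m A z x \<noteq> 0 \<and>
      inverse (norm (symbol_at m A z x)) \<le> fst z powr (- q) * freq z powr (- m\<^sub>0)"
  proof eventually_elim
    case (elim z)
    show ?case
    proof
      fix x assume "x \<in> V"
      then have le: "fst z powr q * freq z powr m\<^sub>0 \<le> norm (symbol_at m A z x)" using elim(2) by blast
      have pos: "0 < fst z powr q * freq z powr m\<^sub>0" using elim(1) by simp
      then have "symbol_at m A z x \<noteq> 0" using le by auto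
      then show "symbol_at m A z x \<noteq> 0 \<and> inverse (norm (symbol_at m A z x)) \<le> fst z powr (- q) * freq z powr (- m\<^sub>0)"
        using le_imp_inverse_le[OF le pos] by (simp add: powr_minus)
    qed
  qed
  then show thesis by (rule that)
qed

text \<open>With the parametrix \<open>w\<close> of order \<open>J\<close>, the transform of \<open>\<phi> v\<close> is the sum of that of \<open>w P v\<close>,
  which decays by the regularity of \<open>P v\<close>, and that of \<open>(R^J \<phi>) v\<close>, which is small because \<open>R^J \<phi>\<close>
  is.  The number \<open>J\<close> depends on the order \<open>l\<close> of decay, but the exponent of \<open>1/\<epsilon>\<close> does not.\<close>

theorem elliptic_regularity:
  assumes v: "v \<in> moderate \<Omega>" and pt: "x\<^sub>1 \<in> U" "\<xi>\<^sub>1 \<in> \<Gamma>"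
    and ell: "\<And>K. compact K \<Longrightarrow> K \<subseteq> U \<Longrightarrow>
      \<exists>q>0. \<exists>r \<epsilon>\<^sub>0. pos_slow_scale r \<and> \<epsilon>\<^sub>0 > 0 \<and>
        (\<forall>\<epsilon>. 0 < \<epsilon> \<and> \<epsilon> < \<epsilon>\<^sub>0 \<longrightarrow> (\<forall>x\<in>K. \<forall>\<xi>\<in>\<Gamma>. norm \<xi> \<ge> r \<epsilon> \<longrightarrow>
          norm (op_symbol m A \<epsilon> x \<xi>) \<ge> \<epsilon> powr q * (1 + norm \<xi>) powr m\<^sub>0))"
    and reg: "microlocally_regular_net \<Omega> (diff_op_net m A v) x\<^sub>1 \<xi>\<^sub>1"
  shows "microlocally_regular_net \<Omega> v x\<^sub>1 \<xi>\<^sub>1"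
proof -
  define f where "f = diff_op_net m A v"
  have f: "f \<in> moderate \<Omega>" unfolding f_def by (rule operator_moderate[OF v])
  obtain r s \<psi> \<Gamma>' c \<Gamma>\<^sub>1 M N where r: "0 < r" "r < s" and s: "cball x\<^sub>1 s \<subseteq> U" and \<psi>: "\<And>x. x \<in> cball x\<^sub>1 r \<Longrightarrow> \<psi> x = 1"
    and \<Gamma>': "open_cone \<Gamma>'" "\<xi>\<^sub>1 \<in> \<Gamma>'" "\<Gamma>' \<subseteq> \<Gamma>"
    and c: "0 < c" "c \<le> 1 / 2" "\<And>\<xi> \<eta>. \<xi> \<in> \<Gamma>' \<Longrightarrow> \<eta> \<notin> \<Gamma>\<^sub>1 \<Longrightarrow> c * norm \<xi> \<le> norm (\<xi> - \<eta>)"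
    and h: "\<forall>\<^sub>F \<epsilon> in at_right 0. integrable lborel (\<lambda>x. \<psi> x * f \<epsilon> x)"
    and hB: "\<forall>\<^sub>F \<epsilon> in at_right 0. \<forall>\<eta>. norm (fourier (\<lambda>x. \<psi> x * f \<epsilon> x) \<eta>) \<le> \<epsilon> powr (- M)"
    and hA: "\<And>l::nat. \<forall>\<^sub>F \<epsilon> in at_right 0. \<forall>\<eta>\<in>\<Gamma>\<^sub>1. norm (fourier (\<lambda>x. \<psi> x * f \<epsilon> x) \<eta>) * (1 + norm \<eta>) ^ l \<le> \<epsilon> powr (- N)"
    by (rule microlocal_localisation[OF \<Omega> f U pt(1) \<Gamma> pt(2) reg[folded f_def]], rule that, assumption+)
  define V where "V = ball x\<^sub>1 s"
  have V: "open V" "V \<subseteq> cball x\<^sub>1 s" "V \<subseteq> \<Omega>" using ball_in_\<Omega>[OF s] by (auto simp: V_def)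
  note smA = coefficients_smooth[OF V(3)]
  have P: "symbol_derivs_slow m A \<delta> \<rho> \<Gamma>' V" unfolding V_def by (rule symbol_derivs_slow_ball[OF s \<Gamma>'(3)])
  let ?P = "symbol_at m A"
  have P0: "slow_symbol \<delta> \<Gamma>' V k (\<lambda>z x. norm (?P z x)) ?P" for k
    using P[unfolded symbol_derivs_slow_def, rule_format, of "\<lambda>i. 0" k] by (simp add: mi_len_def mderiv_0)
  obtain q where q: "\<forall>\<^sub>F z in high_freq \<Gamma>'. \<forall>x\<in>V. ?P z x \<noteq> 0 \<and> inverse (norm (?P z x)) \<le> fst z powr (- q) * freq z powr (- m\<^sub>0)"
    by (rule elliptic_inverse_bound[OF ell[OF compact_cball s] V(2) \<Gamma>'(3)])
  have nz: "\<forall>\<^sub>F z in high_freq \<Gamma>'. \<forall>x\<in>V. ?P z x \<noteq> 0" using q by eventually_elim blast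
  have inv: "slow_symbol \<delta> \<Gamma>' V k (\<lambda>z x. inverse (norm (?P z x))) (\<lambda>z x. inverse (?P z x))" for k
    by (rule slow_symbol_inverse[OF V(1) nz P0])
  have "rapidly_decreasing \<Gamma>' (\<lambda>\<epsilon>. fourier (\<lambda>x. \<phi> x * v \<epsilon> x))" if ph: "\<phi> \<in> test_functions (ball x\<^sub>1 r)" for \<phi>
  proof -
    obtain K where K: "compact K" "K \<subseteq> ball x\<^sub>1 r" "\<And>x. x \<notin> K \<Longrightarrow> \<phi> x = 0" and \<phi>: "smooth_on UNIV \<phi>"
      using test_functions_support[OF ph] by blast
    note cl = compact_imp_closed[OF K(1)]
    have KV: "K \<subseteq> V" using K(2) r by (auto simp: V_def)
    have K\<Omega>: "K \<subseteq> \<Omega>" using KV V(3) by auto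
    have \<phi>s: "slow_symbol \<delta> \<Gamma>' V k (\<lambda>z x. 1) (\<lambda>z. \<phi>)" for k
      unfolding V_def by (rule test_function_slow[OF \<phi>])
    let ?R = "\<lambda>j z. (remainder_op m A z ^^ j) \<phi>"
    note R_slow = iterated_remainder_slow[OF V(1) \<delta>\<rho>(2) P inv \<phi>s]
    have R0: "?R j z x = 0" if "x \<notin> K" for j z x
      by (rule iterated_remainder_off_support[OF cl K(3) that])
    obtain M\<^sub>v where Mv: "\<forall>\<^sub>F \<epsilon> in at_right 0. \<forall>\<xi>. norm (fourier (\<lambda>x. \<phi> x * v \<epsilon> x) \<xi>) \<le> \<epsilon> powr (- M\<^sub>v)"
      by (rule moderate_test_bound[OF \<Omega> v K(1) K\<Omega> _ smooth_on_imp_continuous[OF \<phi>]], rule K(3), assumption, blast)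
    obtain p where "growth K [] v p" using v K(1) K\<Omega> unfolding moderate_iff[OF \<Omega>] by blast
    then have p: "growth K [] v (- (- p))" by simp
    define E where "E = max (q + max M N + 1) (- p + 1)"
    show ?thesis
    proof (rule rapidly_decreasing_high_freqI[OF Mv])
      fix l :: nat
      obtain J where "real l / (\<rho> - \<delta>) \<le> real J" using real_arch_simple by blast
      then have J: "- (\<rho> - \<delta>) * real J + real l \<le> 0" using \<delta>\<rho> by (simp add: divide_le_eq algebra_simps)
      let ?g = "parametrix m A J \<phi>"
      have g: "slow_symbol \<delta> \<Gamma>' V k (\<lambda>z x. inverse (norm (?P z x))) ?g" for k
        by (rule parametrix_slow[OF V(1) \<delta>\<rho>(2) P inv \<phi>s])
      have g0: "?g z x = 0" if "x \<notin> K" for z x using R0[OF that] by (simp add: parametrix_def)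
      have main: "\<forall>\<^sub>F z in high_freq \<Gamma>'. norm (fourier (\<lambda>x. ?g z x * (\<psi> x * f (fst z) x)) (snd z)) * freq z ^ l
        \<le> fst z powr (- (q + max M N + 1))"
      proof (rule symbol_pairing_decay[OF V(1) K(1) KV \<delta>\<rho>(1) _ g _ _ _ h hB hA c])
        show "\<forall>\<^sub>F z in high_freq \<Gamma>'. \<forall>x\<in>V. inverse (norm (?P z x)) \<le> fst z powr (- q) * freq z powr (- m\<^sub>0)"
          using q by eventually_elim blast
      qed (use \<delta>\<rho> g0 in auto)
      have rest: "\<forall>\<^sub>F z in high_freq \<Gamma>'. norm (fourier (\<lambda>x. ?R J z x * v (fst z) x) (snd z)) * freq z ^ l \<le> fst z powr (- (- p + 1))"
        by (rule decaying_amplitude_fourier[OF K(1) KV R0 p slow_symbol_bound[OF R_slow[of 0 J]] J])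
      have two: "\<forall>\<^sub>F \<epsilon> in at_right (0::real). 2 \<le> 1 / \<epsilon>" by (rule slow_le_inverse[OF slow_const]) simp
      have R_smooth: "\<forall>\<^sub>F z in high_freq \<Gamma>'. \<forall>j\<in>{..J}. smooth_on V (?R j z)"
        by (intro eventually_ball_finite finite_atMost ballI slow_symbol_smooth[OF R_slow])
      show "\<forall>\<^sub>F z in high_freq \<Gamma>'. norm (fourier (\<lambda>x. \<phi> x * v (fst z) x) (snd z)) * freq z ^ l \<le> fst z powr (- (E + 1))"
        using main rest nz R_smooth slow_symbol_smooth[OF g[of 0]] slow_symbol_smooth[OF inv[of 0]]
          eventually_high_freq_fst[OF two] eventually_high_freq_fst[OF eventually_unit_interval]
      proof eventually_elim
        case (elim z)
        let ?\<epsilon> = "fst z" and ?\<xi> = "snd z"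
        have \<epsilon>: "0 < ?\<epsilon>" "?\<epsilon> \<le> 1" using elim(8) by auto
        have smv: "smooth_on V (v ?\<epsilon>)" by (rule smooth_on_subset[OF moderate_smooth[OF v elim(8)] V(3)])
        have amp: "amplitude_op m A ?\<epsilon> ?\<xi> (?g z) x = \<phi> x - ?R J z x" for x
        proof (cases "x \<in> K")
          case True
          then have x: "x \<in> V" using KV by auto
          show ?thesis
            by (rule amplitude_op_parametrix[OF V(1) x smA]) (use elim(3,4,6,8) x in auto)
        next
          case False
          then show ?thesis using amplitude_op_off_support[OF cl g0 False] K(3) R0 by simp
        qed
        have int: "integrable lborel (\<lambda>x. a x * v ?\<epsilon> x * expi ?\<xi> x)" if "smooth_on V a" "\<And>x. x \<notin> K \<Longrightarrow> a x = 0" for a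
          by (rule integrable_smooth_expi[OF V(1) that(1) smv K(1) KV that(2)])
        have "fourier (\<lambda>x. ?g z x * f ?\<epsilon> x) ?\<xi> = fourier (\<lambda>x. amplitude_op m A ?\<epsilon> ?\<xi> (?g z) x * v ?\<epsilon> x) ?\<xi>"
          unfolding f_def
          by (rule fourier_diff_op[where u = v and V = V and K = K and \<epsilon> = "fst z" and w = "?g z", OF V(1) smv K(1) KV _ elim(5) g0]) (use elim(8) smA in auto)
        also have "\<dots> = fourier (\<lambda>x. \<phi> x * v ?\<epsilon> x) ?\<xi> - fourier (\<lambda>x. ?R J z x * v ?\<epsilon> x) ?\<xi>"
          unfolding amp fourier_eq left_diff_distrib
          by (rule Bochner_Integration.integral_diff[OF int int]) (use K(3) R0 elim(4) smooth_on_subset[OF \<phi>] in auto)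
        finally have split: "fourier (\<lambda>x. \<phi> x * v ?\<epsilon> x) ?\<xi> = fourier (\<lambda>x. ?g z x * (\<psi> x * f ?\<epsilon> x)) ?\<xi> + fourier (\<lambda>x. ?R J z x * v ?\<epsilon> x) ?\<xi>"
          using fourier_product_cutoff[where K = K and g = "?g z" and \<psi> = \<psi> and f = "f ?\<epsilon>", OF g0 \<psi>] K(2) by (simp add: subset_iff less_imp_le)
        have mono: "?\<epsilon> powr (- a) \<le> ?\<epsilon> powr (- E)" if "a \<le> E" for a
          using \<epsilon> that by (intro powr_mono') auto
        have "norm (fourier (\<lambda>x. \<phi> x * v ?\<epsilon> x) ?\<xi>) * freq z ^ l
            \<le> (norm (fourier (\<lambda>x. ?g z x * (\<psi> x * f ?\<epsilon> x)) ?\<xi>) + norm (fourier (\<lambda>x. ?R J z x * v ?\<epsilon> x) ?\<xi>)) * freq z ^ l"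
          unfolding split by (rule mult_right_mono[OF norm_triangle_ineq]) simp
        also have "\<dots> \<le> ?\<epsilon> powr (- E) + ?\<epsilon> powr (- E)"
          unfolding distrib_right
          by (rule add_mono[OF order_trans[OF elim(1) mono] order_trans[OF elim(2) mono]]) (auto simp: E_def)
        also have "\<dots> = 2 * ?\<epsilon> powr (- E)" by simp
        also have "\<dots> \<le> ?\<epsilon> powr (- (E + 1))" by (rule mult_powr_absorb[OF \<epsilon>(1) elim(7)])
        finally show ?case .
      qed
    qed
  qed
  moreover have "ball x\<^sub>1 r \<subseteq> \<Omega>" using r V(3) by (auto simp: V_def)
  ultimately show ?thesis
    unfolding microlocally_regular_net_iff using r(1) \<Gamma>'(1,2)
    by (intro exI[of _ "ball x\<^sub>1 r"] exI[of _ \<Gamma>']) auto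
qed

end

section \<open>Passage to classes\<close>

text \<open>A representative of \<open>P u\<close> may arise from any representatives of the coefficients, whereas the
  estimates are known for the given ones.  All representatives differ by negligible nets, which do
  not affect microlocal regularity.\<close>

lemma colombeau_member_moderate: "u \<in> colombeau \<Omega> \<Longrightarrow> v \<in> u \<Longrightarrow> v \<in> moderate \<Omega>"
  unfolding colombeau_def colombeau_rel_def by (auto elim!: quotientE)

lemma colombeau_members_negligible:
  assumes "open \<Omega>" "u \<in> colombeau \<Omega>" "v \<in> u" "w \<in> u"
  shows "(\<lambda>\<epsilon> x. v \<epsilon> x - w \<epsilon> x) \<in> negligible_nets \<Omega>"
proof -
  obtain u0 where "(\<lambda>\<epsilon> x. u0 \<epsilon> x - v \<epsilon> x) \<in> negligible_nets \<Omega>" "(\<lambda>\<epsilon> x. u0 \<epsilon> x - w \<epsilon> x) \<in> negligible_nets \<Omega>"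
    using assms(2-4) unfolding colombeau_def colombeau_rel_def by (auto elim!: quotientE)
  from negligible_add[OF assms(1) this(2) negligible_uminus[OF assms(1) this(1)]] show ?thesis by simp
qed

theorem theorem3p2:
  fixes \<Omega> U \<Gamma> :: "(real ^ 'n::finite) set"
    and m :: nat
    and a :: "'n multi_index \<Rightarrow> 'n net set"
    and A :: "'n multi_index \<Rightarrow> 'n net"
    and x\<^sub>0 \<xi>\<^sub>0 :: "real ^ 'n"
    and m\<^sub>0 \<delta> \<rho> :: real
    and u :: "'n net set"
  assumes "open \<Omega>"
    and "\<And>\<alpha>. mi_len \<alpha> \<le> m \<Longrightarrow> a \<alpha> \<in> colombeau \<Omega>"
    and "represents m A a"
    and "x\<^sub>0 \<in> \<Omega>" and "\<xi>\<^sub>0 \<noteq> 0"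
    and "open U" and "U \<subseteq> \<Omega>" and "x\<^sub>0 \<in> U"
    and "open_cone \<Gamma>" and "\<xi>\<^sub>0 \<in> \<Gamma>"
    and "0 \<le> \<delta>" and "\<delta> < \<rho>" and "\<rho> \<le> 1"
    and "\<And>K. compact K \<Longrightarrow> K \<subseteq> U \<Longrightarrow>
      \<exists>q>0. \<exists>r \<epsilon>\<^sub>0. pos_slow_scale r \<and> \<epsilon>\<^sub>0 > 0 \<and>
        (\<forall>\<epsilon>. 0 < \<epsilon> \<and> \<epsilon> < \<epsilon>\<^sub>0 \<longrightarrow> (\<forall>x\<in>K. \<forall>\<xi>\<in>\<Gamma>. norm \<xi> \<ge> r \<epsilon> \<longrightarrow>
          norm (op_symbol m A \<epsilon> x \<xi>) \<ge> \<epsilon> powr q * (1 + norm \<xi>) powr m\<^sub>0))"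
    and "\<And>K \<alpha>. compact K \<Longrightarrow> K \<subseteq> U \<Longrightarrow>
      \<exists>s r \<epsilon>\<^sub>\<alpha>. pos_slow_scale s \<and> pos_slow_scale r \<and> \<epsilon>\<^sub>\<alpha> > 0 \<and>
        (\<forall>\<beta>. mi_len \<beta> \<le> m \<longrightarrow>
          (\<forall>\<epsilon>. 0 < \<epsilon> \<and> \<epsilon> < \<epsilon>\<^sub>\<alpha> \<longrightarrow> (\<forall>x\<in>K. \<forall>\<xi>\<in>\<Gamma>. norm \<xi> \<ge> r \<epsilon> \<longrightarrow>
            norm (op_symbol_deriv m A \<alpha> \<beta> \<epsilon> x \<xi>)
              \<le> s \<epsilon> * norm (op_symbol m A \<epsilon> x \<xi>)
                  * (1 + norm \<xi>) powr (\<delta> * real (mi_len \<alpha>) - \<rho> * real (mi_len \<beta>)))))"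
    and "u \<in> colombeau \<Omega>"
  shows "(U \<times> \<Gamma>) \<inter> WFg \<Omega> u = (U \<times> \<Gamma>) \<inter> WFg \<Omega> (diff_op \<Omega> m a u)"
proof -
  note \<Omega> = assms(1)
  have A: "A \<alpha> \<in> moderate \<Omega>" if "mi_len \<alpha> \<le> m" for \<alpha>
    using assms(2)[OF that] assms(3) that colombeau_member_moderate unfolding represents_def by blast
  have um: "v \<in> moderate \<Omega>" if "v \<in> u" for v by (rule colombeau_member_moderate[OF assms(16) that])
  interpret microlocal_operator \<Omega> U \<Gamma> m A \<delta> \<rho>
    by unfold_locales (use assms(1,6,7,9,11-13,15) A in \<open>auto simp: symbol_estimates_def\<close>)
  have "microlocally_regular \<Omega> u x \<xi> \<longleftrightarrow> microlocally_regular \<Omega> (diff_op \<Omega> m a u) x \<xi>" if "x \<in> U" "\<xi> \<in> \<Gamma>" for x \<xi>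
  proof
    assume "microlocally_regular \<Omega> u x \<xi>"
    then obtain v where v: "v \<in> u" "microlocally_regular_net \<Omega> v x \<xi>" unfolding microlocally_regular_def by blast
    have "diff_op_net m A v \<in> moderate \<Omega>" by (rule operator_moderate[OF um[OF v(1)]])
    then have "(diff_op_net m A v, diff_op_net m A v) \<in> colombeau_rel \<Omega>"
      unfolding colombeau_rel_def using zero_negligible[OF \<Omega>] by simp
    then have "diff_op_net m A v \<in> diff_op \<Omega> m a u" unfolding diff_op_def using assms(3) v(1) by blast
    moreover have "microlocally_regular_net \<Omega> (diff_op_net m A v) x \<xi>"
      by (rule diff_op_preserves_regularity[OF um[OF v(1)] that v(2)])
    ultimately show "microlocally_regular \<Omega> (diff_op \<Omega> m a u) x \<xi>" unfolding microlocally_regular_def by blast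
  next
    assume "microlocally_regular \<Omega> (diff_op \<Omega> m a u) x \<xi>"
    then obtain w A' v where w: "microlocally_regular_net \<Omega> w x \<xi>" and A': "represents m A' a" and v: "v \<in> u"
      and rel: "(diff_op_net m A' v, w) \<in> colombeau_rel \<Omega>"
      unfolding microlocally_regular_def diff_op_def by blast
    have "(\<lambda>\<epsilon> x. A \<alpha> \<epsilon> x - A' \<alpha> \<epsilon> x) \<in> negligible_nets \<Omega>" if "mi_len \<alpha> \<le> m" for \<alpha>
      using colombeau_members_negligible[OF \<Omega> assms(2)[OF that]] assms(3) A' that unfolding represents_def by blast
    then have "(\<lambda>\<epsilon> x. diff_op_net m A v \<epsilon> x - diff_op_net m A' v \<epsilon> x) \<in> negligible_nets \<Omega>"
      by (rule diff_op_net_diff_negligible[OF \<Omega> _ um[OF v]])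
    moreover have "(\<lambda>\<epsilon> x. diff_op_net m A' v \<epsilon> x - w \<epsilon> x) \<in> negligible_nets \<Omega>" "w \<in> moderate \<Omega>"
      using rel unfolding colombeau_rel_def by auto
    ultimately have "(\<lambda>\<epsilon> x. diff_op_net m A v \<epsilon> x - w \<epsilon> x) \<in> negligible_nets \<Omega>"
      using negligible_add[OF \<Omega>] by fastforce
    from microlocally_regular_net_cong[OF \<Omega> \<open>w \<in> moderate \<Omega>\<close> operator_moderate[OF um[OF v]] this w]
    have "microlocally_regular_net \<Omega> (diff_op_net m A v) x \<xi>" .
    then have "microlocally_regular_net \<Omega> v x \<xi>"
      by (rule elliptic_regularity[OF um[OF v] that assms(14), rotated -1])
    then show "microlocally_regular \<Omega> u x \<xi>" using v unfolding microlocally_regular_def by blast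
  qed
  then show ?thesis unfolding WFg_def by auto
qed

end
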